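(* The complex slope $\Omega$ defined in the context satisfies, in the liquid region $\mathcal E$, the inhomogeneous complex Burgers equation $$\frac{\Omega_x}{\Omega}-\frac{\Omega_t}{1-\Omega}=-\log(q)\,\frac{q^{c+t}+\kappa^2q^{2x}}{q^{c+t}-\kappa^2q^{2x}} .$$
   Context: Parameters (of the $q$-Racah weighted lozenge tiling of a hexagon): $b,c>0$; $q>0$, $q\neq1$; and either $\kappa\in i\mathbb R\setminus\{0\}$, or $\kappa\in\mathbb R\setminus\{0\}$ with $|\kappa|$ not in the open interval with endpoints $q^{-1}$ and $q^{(b+c)/2}$. The rescaled hexagon is the set of $(t,x)$ with $0<t<b+c$, $\max\{0,t-b\}\le x\le1+\min\{t,c\}$. Put $\mu(t,x)=q^{-x}+\kappa^2q^{-t-c+x}$, $a(\xi;t)=\sqrt{A(\xi;t)C(\xi;t)}$, $b(\xi;t)=1+\kappa^2q^{-t-c}-A(\xi;t)-C(\xi;t)$, $$A(\xi;t)=\frac{(1-q^{-c+\xi-1})(1-q^{\xi-t-1})(1-q^{-b-c+\xi-2})(1-\kappa^2q^{-b-c+\xi})}{(1-q^{-b-c+2\xi-2})^2},$$ $$C(\xi;t)=\frac{(1-q^\xi)(1-q^{-b+\xi-1})(\kappa^2q^{1-c}-q^{-c+\xi-1})(q^{-t-1}-q^{-b-c+\xi-2})}{(1-q^{-b-c+2\xi-2})^2}.$$ The liquid region is $\mathcal E=\{(t,x):4a(1;t)^2-(\mu(t,x)-b(1;t))^2>0\}$ (inside the rescaled hexagon). Limiting height function: $h(t,x)=\int_{\max\{0,t-b\}}^x\rho(t,u)\,du$,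 where, with $\xi_-(x)\le\xi_+(x)$ the solutions $\xi\in[0,1+\min\{t,b,c,b+c-t\}]$ of $4a(\xi;t)^2-(\mu(t,x)-b(\xi;t))^2=0$ and $y(\xi)=q^{-\xi}+q^{\xi-b-c-2}$, $\rho(t,x)=1$ if $\xi_-<\xi_+\le1$; $\rho(t,x)=0$ if $1\le\xi_-<\xi_+$; and $\rho(t,x)=\frac1\pi\arccos\left(\frac{2y(1)-y(\xi_-)-y(\xi_+)}{|y(\xi_-)-y(\xi_+)|}\right)$ if $\xi_-<1<\xi_+$. Lozenge densities (times $\pi$): $\rho_I=-\pi\partial_th$, $\rho_{II}=\pi\partial_th+\pi\partial_xh$, $\rho_{III}=\pi-\pi\partial_xh$. The complex slope $\Omega=\Omega(t,x)$ is the point in the upper half plane such that the triangle with vertices $0,1,\Omega$ has angle $\rho_I$ at $0$, $\rho_{III}$ at $1$, $\rho_{II}$ at $\Omega$; explicitly $$\Omega=\frac{\tan\rho_{III}}{\tan\rho_{III}+\tan\rho_I}+i\frac{\tan\rho_{III}\tan\rho_I}{\tan\rho_{III}+\tan\rho_I}.$$ *)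

theory Defs
  imports "HOL-Analysis.Analysis"
begin

(* The parameter \<kappa> is complex (real or purely imaginary). Only its square enters the
   coefficients, and in both cases that square is real, so Re (\<kappa>^2) stands for it. *)

definition coeff_A :: "real \<Rightarrow> real \<Rightarrow> real \<Rightarrow> complex \<Rightarrow> real \<Rightarrow> real \<Rightarrow> real" where
  "coeff_A b c q \<kappa> \<xi> t =
     (1 - q powr (-c + \<xi> - 1)) * (1 - q powr (\<xi> - t - 1)) *
     (1 - q powr (-b - c + \<xi> - 2)) * (1 - Re (\<kappa>\<^sup>2) * q powr (-b - c + \<xi>))
     / (1 - q powr (-b - c + 2 * \<xi> - 2))\<^sup>2"

definition coeff_C :: "real \<Rightarrow> real \<Rightarrow> real \<Rightarrow> complex \<Rightarrow> real \<Rightarrow> real \<Rightarrow> real" where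
  "coeff_C b c q \<kappa> \<xi> t =
     (1 - q powr \<xi>) * (1 - q powr (-b + \<xi> - 1)) *
     (Re (\<kappa>\<^sup>2) * q powr (1 - c) - q powr (-c + \<xi> - 1)) *
     (q powr (-t - 1) - q powr (-b - c + \<xi> - 2))
     / (1 - q powr (-b - c + 2 * \<xi> - 2))\<^sup>2"

definition coeff_a :: "real \<Rightarrow> real \<Rightarrow> real \<Rightarrow> complex \<Rightarrow> real \<Rightarrow> real \<Rightarrow> real" where
  "coeff_a b c q \<kappa> \<xi> t = sqrt (coeff_A b c q \<kappa> \<xi> t * coeff_C b c q \<kappa> \<xi> t)"

definition coeff_b :: "real \<Rightarrow> real \<Rightarrow> real \<Rightarrow> complex \<Rightarrow> real \<Rightarrow> real \<Rightarrow> real" where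
  "coeff_b b c q \<kappa> \<xi> t =
     1 + Re (\<kappa>\<^sup>2) * q powr (-t - c) - coeff_A b c q \<kappa> \<xi> t - coeff_C b c q \<kappa> \<xi> t"

definition lattice_mu :: "real \<Rightarrow> real \<Rightarrow> complex \<Rightarrow> real \<Rightarrow> real \<Rightarrow> real" where
  "lattice_mu c q \<kappa> t x = q powr (-x) + Re (\<kappa>\<^sup>2) * q powr (-t - c + x)"

definition disc :: "real \<Rightarrow> real \<Rightarrow> real \<Rightarrow> complex \<Rightarrow> real \<Rightarrow> real \<Rightarrow> real \<Rightarrow> real" where
  "disc b c q \<kappa> \<xi> t x =
     4 * (coeff_a b c q \<kappa> \<xi> t)\<^sup>2 - (lattice_mu c q \<kappa> t x - coeff_b b c q \<kappa> \<xi> t)\<^sup>2"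

definition hexagon :: "real \<Rightarrow> real \<Rightarrow> (real \<times> real) set" where
  "hexagon b c = {(t, x). 0 < t \<and> t < b + c \<and> max 0 (t - b) \<le> x \<and> x \<le> 1 + min t c}"

definition liquid_region :: "real \<Rightarrow> real \<Rightarrow> real \<Rightarrow> complex \<Rightarrow> (real \<times> real) set" where
  "liquid_region b c q \<kappa> = {(t, x) \<in> hexagon b c. disc b c q \<kappa> 1 t x > 0}"

(* The equation disc = 0 in \<xi>, multiplied by the common denominator of A * C and (A + C)^2.
   On the interval for \<xi> this denominator vanishes only for b = c = t and \<xi> = 1 + b.
   There all numerators vanish too, so that \<xi> solves the equation cleared of
   denominators; it is the limit of the larger solution as t tends to b = c.
   At every other \<xi> the condition is disc = 0 itself. *)
definition solutions_xi ::
    "real \<Rightarrow> real \<Rightarrow> real \<Rightarrow> complex \<Rightarrow> real \<Rightarrow> real \<Rightarrow> real set" where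
  "solutions_xi b c q \<kappa> t x =
     {\<xi> \<in> {0..1 + Min {t, b, c, b + c - t}}.
        (1 - q powr (-b - c + 2 * \<xi> - 2)) ^ 4 * disc b c q \<kappa> \<xi> t x = 0}"

definition xi_minus :: "real \<Rightarrow> real \<Rightarrow> real \<Rightarrow> complex \<Rightarrow> real \<Rightarrow> real \<Rightarrow> real" where
  "xi_minus b c q \<kappa> t x = Inf (solutions_xi b c q \<kappa> t x)"

definition xi_plus :: "real \<Rightarrow> real \<Rightarrow> real \<Rightarrow> complex \<Rightarrow> real \<Rightarrow> real \<Rightarrow> real" where
  "xi_plus b c q \<kappa> t x = Sup (solutions_xi b c q \<kappa> t x)"

definition lattice_y :: "real \<Rightarrow> real \<Rightarrow> real \<Rightarrow> real \<Rightarrow> real" where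
  "lattice_y b c q \<xi> = q powr (-\<xi>) + q powr (\<xi> - b - c - 2)"

(* For fixed t in (0, b + c) the last branch concerns at most the two end points
   of the hexagon's vertical section, where the two solutions may coincide. *)
definition density :: "real \<Rightarrow> real \<Rightarrow> real \<Rightarrow> complex \<Rightarrow> real \<Rightarrow> real \<Rightarrow> real" where
  "density b c q \<kappa> t x =
     (let l = xi_minus b c q \<kappa> t x; r = xi_plus b c q \<kappa> t x; y = lattice_y b c q in
        if l < r \<and> r \<le> 1 then 1
        else if 1 \<le> l \<and> l < r then 0
        else if l < 1 \<and> 1 < r then arccos ((2 * y 1 - y l - y r) / \<bar>y l - y r\<bar>) / pi
        else 0)"

definition height :: "real \<Rightarrow> real \<Rightarrow> real \<Rightarrow> complex \<Rightarrow> real \<Rightarrow> real \<Rightarrow> real" where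
  "height b c q \<kappa> t x = integral {max 0 (t - b)..x} (\<lambda>u. density b c q \<kappa> t u)"

definition height_dt :: "real \<Rightarrow> real \<Rightarrow> real \<Rightarrow> complex \<Rightarrow> real \<Rightarrow> real \<Rightarrow> real" where
  "height_dt b c q \<kappa> t x = deriv (\<lambda>s. height b c q \<kappa> s x) t"

definition height_dx :: "real \<Rightarrow> real \<Rightarrow> real \<Rightarrow> complex \<Rightarrow> real \<Rightarrow> real \<Rightarrow> real" where
  "height_dx b c q \<kappa> t x = deriv (\<lambda>u. height b c q \<kappa> t u) x"

definition rho_I :: "real \<Rightarrow> real \<Rightarrow> real \<Rightarrow> complex \<Rightarrow> real \<Rightarrow> real \<Rightarrow> real" where
  "rho_I b c q \<kappa> t x = - pi * height_dt b c q \<kappa> t x"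

definition rho_II :: "real \<Rightarrow> real \<Rightarrow> real \<Rightarrow> complex \<Rightarrow> real \<Rightarrow> real \<Rightarrow> real" where
  "rho_II b c q \<kappa> t x = pi * height_dt b c q \<kappa> t x + pi * height_dx b c q \<kappa> t x"

definition rho_III :: "real \<Rightarrow> real \<Rightarrow> real \<Rightarrow> complex \<Rightarrow> real \<Rightarrow> real \<Rightarrow> real" where
  "rho_III b c q \<kappa> t x = pi - pi * height_dx b c q \<kappa> t x"

definition angle_at :: "complex \<Rightarrow> complex \<Rightarrow> complex \<Rightarrow> real" where
  "angle_at v z w = arccos (inner (z - v) (w - v) / (norm (z - v) * norm (w - v)))"

(* The tangent formula
     \<Omega> = (tan \<rho>III + i tan \<rho>III tan \<rho>I) / (tan \<rho>III + tan \<rho>I)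
   for this point breaks down where \<rho>I or \<rho>III is pi/2, hence the triangle itself. *)
definition complex_slope :: "real \<Rightarrow> real \<Rightarrow> real \<Rightarrow> complex \<Rightarrow> real \<Rightarrow> real \<Rightarrow> complex" where
  "complex_slope b c q \<kappa> t x =
     (THE z. Im z > 0 \<and>
        angle_at 0 1 z = rho_I b c q \<kappa> t x \<and>
        angle_at 1 0 z = rho_III b c q \<kappa> t x \<and>
        angle_at z 0 1 = rho_II b c q \<kappa> t x)"

end

theory Submission
  imports Defs
begin

text \<open>
  Fix a point inside the hexagon. Multiplied by the square of the denominator, the discriminant is
  a concave quadratic polynomial in \<open>y(\<xi>)\<close>. Both of its roots lie in the range of \<open>\<xi>\<close> and its
  discriminant factorizes over the four sloped edges of the hexagon. This yields three functions
  \<open>a\<close>, \<open>b\<close>, \<open>v\<close> of \<open>(t,x)\<close>, positive inside the hexagon and products of elementary factors, such that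
  \<open>\<pi> - \<pi> \<rho>\<close> is the angle opposite to the last side of the triangle with squared sides \<open>a\<close>, \<open>b\<close>, \<open>v\<close>,
  and the liquid region is the region where this triangle exists. Scaled to the base from 0
  to 1, its apex \<open>z\<close> solves \<open>a z (z - 1) + v (1 - z) + b z = 0\<close>, and differentiating this equation
  turns the Burgers equation for \<open>z\<close> into relations between the logarithmic derivatives of \<open>a\<close>, \<open>b\<close>,
  \<open>v\<close>. The imaginary part says that the form (angle at 1) \<open>dx\<close> + (angle at 0) \<open>dt\<close> is closed.

  It remains to identify the time derivative of the height with minus the angle at 0 over \<open>\<pi>\<close>.
  At a time at which the lower boundary of the liquid region does not touch the hexagon one
  differentiates the height integral by dominated convergence: across the boundary the difference
  quotients of the arccosine are dominated by a multiple of an inverse square root. The remaining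
  times are isolated, and there the derivative is the limit of the derivatives nearby.
\<close>

section \<open>The clamped arccosine\<close>

text \<open>The height is given through its x-derivative only, so its time derivative has to be
  built from the closed form: \<open>angle1\<close> changes in time at the rate at which
  \<open>angle0\<close> changes in x. Integrated over the liquid part of a slice, from
  \<open>p\<close> to \<open>x\<close>, this leaves the value of \<open>angle0\<close> at
  \<open>p\<close>. There the triangle is degenerate and the value is 0 or pi; it is cancelled
  exactly by the term from the lower edge of the hexagon, which moves with speed 0 for t < b and 1
  for t > b. So a slice is treated directly only if it starts in a frozen region. Excluded are t =
  b, where the edge has a kink, and the times of tangency, where \<open>heron\<close> vanishes on
  the edge: no frozen interval then separates the square root singularity from the edge, where
  \<open>side_a\<close> or \<open>side_b\<close> vanishes and \<open>cosine1\<close> is singular.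
  Clamping the argument of arccos gives one continuous formula for frozen and liquid points. The
  hypothesis on \<kappa> enters through signs: it gives the factors with \<open>J\<close> a common
  sign, and it keeps \<kappa>^2 away from 1/q, which makes the tangencies isolated.\<close>

definition clamped_arccos :: "real \<Rightarrow> real" where
  "clamped_arccos g = arccos (max (-1) (min 1 g))"

lemma clamped_arccos_uminus: "clamped_arccos (- g) = pi - clamped_arccos g"
proof -
  have "max (-1) (min 1 (- g)) = - max (-1) (min 1 g)" by auto
  then show ?thesis unfolding clamped_arccos_def by (simp add: arccos_minus)
qed

text \<open>Jordan's inequality with 1/4 in place of 2/pi: beyond pi/3 the bound 1/2 on the sine
  suffices, as y/4 < 1/2. The value 1/4 is the source of the constant 8 in the Lipschitz
  estimates.\<close>

lemma sin_ge_quarter: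
  fixes y :: real
  assumes "0 \<le> y" "y \<le> pi / 2"
  shows "y / 4 \<le> sin y"
proof (cases "y \<le> pi / 3")
  case True
  show ?thesis
  proof (cases "y = 0")
    case False
    then have "y > 0" using assms by simp
    then obtain z where z: "0 < z" "z < y" "sin y - sin 0 = (y - 0) * cos z"
      using MVT2[of 0 y sin cos] by (auto simp: DERIV_sin)
    have "cos (pi / 3) \<le> cos z" using z True pi_gt_zero by (intro cos_monotone_0_pi_le) auto
    then have "y * (1 / 4) \<le> y * cos z" using assms by (intro mult_left_mono) (auto simp: cos_60)
    then show ?thesis using z by simp
  qed simp
next
  case False
  have "sin (pi / 6) \<le> sin y" using False assms pi_gt_zero by (intro sin_monotone_2pi_le) auto
  then show ?thesis using assms pi_less_4 by (simp add: sin_30)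
qed

lemma clamped_arccos_range: "0 \<le> clamped_arccos g" "clamped_arccos g \<le> pi"
  unfolding clamped_arccos_def by (rule arccos_lbound arccos_ubound; simp)+

lemma cos_clamped_arccos: "cos (clamped_arccos g) = max (-1) (min 1 g)"
  unfolding clamped_arccos_def by (rule cos_arccos) auto

lemma continuous_clamped_arccos: "continuous_on UNIV clamped_arccos"
proof -
  have "continuous_on UNIV (arccos \<circ> (\<lambda>g. max (-1) (min 1 g)))"
    by (intro continuous_on_compose continuous_intros continuous_on_subset[OF continuous_on_arccos']) auto
  then show ?thesis by (simp add: clamped_arccos_def[abs_def] comp_def)
qed

lemma clamped_arccos_Lipschitz_gt:
  assumes "g0 > 1"
  shows "\<bar>clamped_arccos g1 - clamped_arccos g0\<bar> * sqrt \<bar>1 - g0\<^sup>2\<bar> \<le> 8 * \<bar>g1 - g0\<bar>"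
proof (cases "g1 \<ge> 1")
  case True
  then show ?thesis using assms by (simp add: clamped_arccos_def)
next
  case False
  \<comment> \<open>The distances \<open>e\<close> and \<open>d\<close> of the clamped
    \<open>g1\<close> and of \<open>g0\<close> from 1 lie on opposite sides of 1, so they add up to
    at most the distance of \<open>g1\<close> and \<open>g0\<close>. Clamping also gives
    \<open>e \<le> 2\<close>.\<close>
  define t e d where "t = clamped_arccos g1" and "e = 1 - max (-1) (min 1 g1)" and "d = g0 - 1"
  have e: "0 \<le> e" "e \<le> 2" "d > 0" "e + d \<le> \<bar>g1 - g0\<bar>"
    using False assms by (auto simp: e_def d_def)
  have t: "0 \<le> t" "t \<le> pi" unfolding t_def by (rule clamped_arccos_range)+
  have "cos t = 1 - 2 * (sin (t / 2))\<^sup>2" using cos_double_sin[of "t / 2"] by simp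
  then have "e = 2 * (sin (t / 2))\<^sup>2" unfolding t_def cos_clamped_arccos e_def by simp
  moreover have "t / 8 \<le> sin (t / 2)" using sin_ge_quarter[of "t / 2"] t by simp
  then have "(t / 8)\<^sup>2 \<le> (sin (t / 2))\<^sup>2" using t by (intro power_mono) auto
  ultimately have te: "t\<^sup>2 \<le> 32 * e" by (simp add: power_divide)
  have g: "\<bar>1 - g0\<^sup>2\<bar> = d * (d + 2)" 
  proof -
    have "1 \<le> g0\<^sup>2" using assms by (simp add: power_le_one_iff one_le_power)
    then show ?thesis by (simp add: d_def power2_eq_square algebra_simps)
  qed
  have "(t * sqrt \<bar>1 - g0\<^sup>2\<bar>)\<^sup>2 = t\<^sup>2 * (d * (d + 2))" using e by (simp add: power_mult_distrib g)
  also have "\<dots> \<le> 32 * e * (d * (d + 2))" using te e by (intro mult_right_mono) auto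
  also have "\<dots> \<le> (8 * (e + d))\<^sup>2"
  proof -
    have "(8 * (e + d))\<^sup>2 - 32 * e * (d * (d + 2)) = 64 * e\<^sup>2 + 64 * (e * d) + 32 * (2 - e) * d\<^sup>2" by algebra
    also have "\<dots> \<ge> 0" using e by (intro add_nonneg_nonneg mult_nonneg_nonneg) auto
    finally show ?thesis by simp
  qed
  finally have "t * sqrt \<bar>1 - g0\<^sup>2\<bar> \<le> 8 * (e + d)" by (rule power2_le_imp_le) (use e in auto)
  moreover have "clamped_arccos g0 = 0" using assms by (simp add: clamped_arccos_def)
  ultimately show ?thesis using e t by (simp add: t_def[symmetric])
qed

text \<open>The weight is the reciprocal of the derivative of arccos at the base point
  \<open>g0\<close>. It controls the difference quotient for every \<open>g1\<close>, not just
  nearby ones, up to a factor 8. In product form the estimate is also meaningful at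
  \<open>g0\<close> = 1 and -1.\<close>

lemma clamped_arccos_Lipschitz:
  "\<bar>clamped_arccos g1 - clamped_arccos g0\<bar> * sqrt \<bar>1 - g0\<^sup>2\<bar> \<le> 8 * \<bar>g1 - g0\<bar>"
proof -
  consider "g0 > 1" | "g0 < -1" | "-1 \<le> g0" "g0 \<le> 1" by linarith
  then show ?thesis
  proof cases
    case 1
    then show ?thesis by (rule clamped_arccos_Lipschitz_gt)
  next
    case 2
    then have "- g0 > 1" by simp
    from clamped_arccos_Lipschitz_gt[OF this, of "- g1"] show ?thesis
      by (simp add: clamped_arccos_uminus abs_minus_commute)
  next
    case 3
    define \<alpha> \<beta> where "\<alpha> = clamped_arccos g0" and "\<beta> = clamped_arccos g1"
    have r: "0 \<le> \<alpha>" "\<alpha> \<le> pi" "0 \<le> \<beta>" "\<beta> \<le> pi"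
      unfolding \<alpha>_def \<beta>_def by (rule clamped_arccos_range)+
    have c: "cos \<alpha> = g0" "cos \<beta> = max (-1) (min 1 g1)"
      unfolding \<alpha>_def \<beta>_def cos_clamped_arccos using 3 by auto
    have "g0\<^sup>2 \<le> 1" using 3 by (simp add: abs_square_le_1 abs_le_iff)
    then have s: "sqrt \<bar>1 - g0\<^sup>2\<bar> = sin \<alpha>" using sin_cos_sqrt[OF sin_ge_zero[OF r(1,2)]] c by simp
    \<comment> \<open>The sum-to-product formula for cos \<alpha> - cos \<beta> reduces the claim to
      sin \<alpha> / 2 \<le> sin ((\<alpha> + \<beta>) / 2), uniformly in \<beta>. This follows by
      expanding the right side, since both half-angle functions of \<alpha> are at least sin
      \<alpha> / 2 and those of \<beta> add up to at least 1.\<close>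
    have half: "0 \<le> sin (\<alpha> / 2)" "0 \<le> cos (\<alpha> / 2)" "0 \<le> sin (\<beta> / 2)" "0 \<le> cos (\<beta> / 2)"
      using r by (auto intro!: sin_ge_zero cos_ge_zero)
    have "sin \<alpha> = 2 * (sin (\<alpha> / 2) * cos (\<alpha> / 2))" using sin_double[of "\<alpha> / 2"] by simp
    moreover have "sin (\<alpha> / 2) * cos (\<alpha> / 2) \<le> sin (\<alpha> / 2) * 1" "sin (\<alpha> / 2) * cos (\<alpha> / 2) \<le> 1 * cos (\<alpha> / 2)"
      using half by (intro mult_left_mono mult_right_mono; simp)+
    ultimately have h2: "sin \<alpha> / 2 \<le> sin (\<alpha> / 2)" "sin \<alpha> / 2 \<le> cos (\<alpha> / 2)" by simp_all
    have "(cos (\<beta> / 2) + sin (\<beta> / 2))\<^sup>2 = 1 + 2 * (cos (\<beta> / 2) * sin (\<beta> / 2))"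
      using sin_cos_squared_add[of "\<beta> / 2"] by algebra
    moreover have "0 \<le> cos (\<beta> / 2) * sin (\<beta> / 2)" using half by simp
    ultimately have "1\<^sup>2 \<le> (cos (\<beta> / 2) + sin (\<beta> / 2))\<^sup>2" by simp
    then have "1 \<le> cos (\<beta> / 2) + sin (\<beta> / 2)" by (rule power2_le_imp_le) (use half in simp)
    then have "sin \<alpha> / 2 * 1 \<le> sin \<alpha> / 2 * (cos (\<beta> / 2) + sin (\<beta> / 2))"
      using r by (intro mult_left_mono) (auto intro: sin_ge_zero)
    also have "\<dots> \<le> sin (\<alpha> / 2) * cos (\<beta> / 2) + cos (\<alpha> / 2) * sin (\<beta> / 2)"
      unfolding distrib_left using half h2 by (intro add_mono mult_right_mono) auto
    also have "\<dots> = sin ((\<alpha> + \<beta>) / 2)" by (simp add: sin_add add_divide_distrib)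
    finally have m: "sin \<alpha> / 2 \<le> sin ((\<alpha> + \<beta>) / 2)" by simp
    have "\<bar>\<beta> - \<alpha>\<bar> / 2 / 4 \<le> sin (\<bar>\<beta> - \<alpha>\<bar> / 2)" by (rule sin_ge_quarter) (use r in auto)
    also have "sin (\<bar>\<beta> - \<alpha>\<bar> / 2) \<le> \<bar>sin ((\<beta> - \<alpha>) / 2)\<bar>"
    proof -
      have "sin \<bar>y\<bar> \<le> \<bar>sin y\<bar>" for y :: real by (cases "0 \<le> y") auto
      from this[of "(\<beta> - \<alpha>) / 2"] show ?thesis by simp
    qed
    finally have d: "\<bar>\<beta> - \<alpha>\<bar> / 8 \<le> \<bar>sin ((\<beta> - \<alpha>) / 2)\<bar>" by simp
    have "cos \<alpha> - cos \<beta> = 2 * sin ((\<alpha> + \<beta>) / 2) * sin ((\<beta> - \<alpha>) / 2)" by (rule cos_diff_cos)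
    then have "\<bar>cos \<alpha> - cos \<beta>\<bar> = 2 * \<bar>sin ((\<alpha> + \<beta>) / 2)\<bar> * \<bar>sin ((\<beta> - \<alpha>) / 2)\<bar>" by (simp add: abs_mult)
    also have "\<dots> \<ge> 2 * (sin \<alpha> / 2) * (\<bar>\<beta> - \<alpha>\<bar> / 8)"
      using m d r sin_ge_zero[of \<alpha>] by (intro mult_mono) auto
    finally have "\<bar>\<beta> - \<alpha>\<bar> * sin \<alpha> \<le> 8 * \<bar>cos \<alpha> - cos \<beta>\<bar>"
      by (simp add: mult.commute)
    also have "\<bar>cos \<alpha> - cos \<beta>\<bar> \<le> \<bar>g1 - g0\<bar>" unfolding c using 3 by auto
    finally show ?thesis unfolding s \<alpha>_def \<beta>_def by simp
  qed
qed

section \<open>Differentiation under the integral across a square root singularity\<close>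

lemma integrable_inverse_sqrt:
  fixes l p r :: real
  assumes "l \<le> p" "p \<le> r"
  shows "(\<lambda>u. 1 / sqrt \<bar>u - p\<bar>) integrable_on {l..r}"
proof -
  have "((\<lambda>u. 1 / sqrt \<bar>u - p\<bar>) has_integral (2 * sqrt (r - p) - 2 * sqrt (p - p))) {p..r}"
  proof (rule fundamental_theorem_of_calculus_interior)
    fix u assume "u \<in> {p<..<r}"
    then show "((\<lambda>u. 2 * sqrt (u - p)) has_vector_derivative 1 / sqrt \<bar>u - p\<bar>) (at u)"
      unfolding has_real_derivative_iff_has_vector_derivative[symmetric]
      by (auto intro!: derivative_eq_intros simp: field_simps)
  qed (use assms in \<open>auto intro!: continuous_intros\<close>)
  moreover have "((\<lambda>u. 1 / sqrt \<bar>u - p\<bar>) has_integral (- 2 * sqrt (p - p) - (- 2 * sqrt (p - l)))) {l..p}"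
  proof (rule fundamental_theorem_of_calculus_interior)
    fix u assume "u \<in> {l<..<p}"
    then show "((\<lambda>u. - 2 * sqrt (p - u)) has_vector_derivative 1 / sqrt \<bar>u - p\<bar>) (at u)"
      unfolding has_real_derivative_iff_has_vector_derivative[symmetric]
      by (auto intro!: derivative_eq_intros simp: field_simps)
  qed (use assms in \<open>auto intro!: continuous_intros\<close>)
  ultimately show ?thesis using assms Henstock_Kurzweil_Integration.integrable_combine by blast
qed

text \<open>At \<open>p\<close> the function \<open>g s0\<close> may cross 1 or -1, and
  \<open>W\<close> may be unbounded there. The linear lower bound on 1 - g^2 turns the Lipschitz
  estimate of the clamped arccosine into a multiple of the inverse square root of |u - p|, an
  integrable majorant of all difference quotients.\<close>

lemma clamped_arccos_integral_derivative:
  fixes g :: "real \<Rightarrow> real \<Rightarrow> real"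
  assumes lpr: "l \<le> p" "p \<le> r" and "c > 0" "\<delta> > 0"
    and Lip: "\<And>s u. \<bar>s - s0\<bar> < \<delta> \<Longrightarrow> u \<in> {l..r} \<Longrightarrow> \<bar>g s u - g s0 u\<bar> \<le> C * \<bar>s - s0\<bar>"
    and lower: "\<And>u. u \<in> {l..r} \<Longrightarrow> c * \<bar>u - p\<bar> \<le> \<bar>1 - (g s0 u)\<^sup>2\<bar>"
    and deriv: "\<And>u. u \<in> {l..r} \<Longrightarrow> u \<noteq> p \<Longrightarrow> ((\<lambda>s. clamped_arccos (g s u)) has_real_derivative W u) (at s0)"
    and int: "\<And>s. \<bar>s - s0\<bar> < \<delta> \<Longrightarrow> (\<lambda>u. clamped_arccos (g s u)) integrable_on {l..r}"
    and W: "(W has_integral I) {l..r}"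
  shows "((\<lambda>s. integral {l..r} (\<lambda>u. clamped_arccos (g s u))) has_real_derivative I) (at s0)"
proof -
  define F where "F s = integral {l..r} (\<lambda>u. clamped_arccos (g s u))" for s
  \<comment> \<open>The quotient is set to 0 at \<open>p\<close>, which changes it on a null set
    only: \<open>B p\<close> is 0 by the convention for division by zero, so it would not dominate
    the actual quotient at that point.\<close>
  define Q where "Q h u = (if u = p then 0 else (clamped_arccos (g (s0 + h) u) - clamped_arccos (g s0 u)) / h)" for h u
  define W' where "W' u = (if u = p then 0 else W u)" for u
  define B where "B u = 8 * \<bar>C\<bar> / sqrt c * (1 / sqrt \<bar>u - p\<bar>)" for u
  have W': "(W' has_integral I) {l..r}"
    by (rule has_integral_spike[OF _ _ W, of "{p}"]) (auto simp: W'_def)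
  have lim: "(\<lambda>n. (F (s0 + S n) - F s0) / S n) \<longlonglongrightarrow> I"
    if S: "\<And>n. S n \<noteq> 0" "S \<longlonglongrightarrow> 0" and small: "\<And>n. \<bar>S n\<bar> < \<delta>" for S
  proof -
    have Q_int: "(Q (S n) has_integral (F (s0 + S n) - F s0) / S n) {l..r}" for n
    proof -
      have "((\<lambda>u. (clamped_arccos (g (s0 + S n) u) - clamped_arccos (g s0 u)) / S n) has_integral (F (s0 + S n) - F s0) / S n) {l..r}"
        unfolding F_def using int[of "s0 + S n"] int[of s0] small[of n] \<open>\<delta> > 0\<close>
        by (intro has_integral_divide has_integral_diff integrable_integral; simp)
      then show ?thesis by (rule has_integral_spike[rotated 2, where S = "{p}"]) (auto simp: Q_def)
    qed
    have B_int: "B integrable_on {l..r}"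
      unfolding B_def using integrable_inverse_sqrt[OF lpr] by (rule integrable_on_mult_right)
    have bound: "norm (Q (S n) u) \<le> B u" if u: "u \<in> {l..r}" for n u
    proof (cases "u = p")
      case False
      let ?d = "\<bar>clamped_arccos (g (s0 + S n) u) - clamped_arccos (g s0 u)\<bar>"
      have pos: "0 < c * \<bar>u - p\<bar>" using False \<open>c > 0\<close> by simp
      have "?d * sqrt (c * \<bar>u - p\<bar>) \<le> ?d * sqrt \<bar>1 - (g s0 u)\<^sup>2\<bar>"
        using lower[OF u] by (intro mult_left_mono) auto
      also have "\<dots> \<le> 8 * \<bar>g (s0 + S n) u - g s0 u\<bar>" by (rule clamped_arccos_Lipschitz)
      also have "\<dots> \<le> 8 * (C * \<bar>S n\<bar>)" using Lip[of "s0 + S n" u] small[of n] u by simp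
      also have "\<dots> \<le> 8 * (\<bar>C\<bar> * \<bar>S n\<bar>)" by (intro mult_left_mono mult_right_mono) auto
      finally have "?d \<le> 8 * (\<bar>C\<bar> * \<bar>S n\<bar>) / sqrt (c * \<bar>u - p\<bar>)"
        using pos by (simp add: pos_le_divide_eq)
      then have "?d / \<bar>S n\<bar> \<le> 8 * (\<bar>C\<bar> * \<bar>S n\<bar>) / sqrt (c * \<bar>u - p\<bar>) / \<bar>S n\<bar>"
        by (rule divide_right_mono) simp
      also have "\<dots> = B u" using S(1)[of n] unfolding B_def real_sqrt_mult by simp
      finally show ?thesis using False by (simp add: Q_def)
    qed (use \<open>c > 0\<close> in \<open>simp add: Q_def B_def\<close>)
    have conv: "(\<lambda>n. Q (S n) u) \<longlonglongrightarrow> W' u" if u: "u \<in> {l..r}" for u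
    proof (cases "u = p")
      case False
      have "((\<lambda>h. (clamped_arccos (g (s0 + h) u) - clamped_arccos (g s0 u)) / h) \<longlongrightarrow> W u) (at 0)"
        using deriv[OF u False] unfolding DERIV_def .
      from this have "(\<lambda>n. (clamped_arccos (g (s0 + S n) u) - clamped_arccos (g s0 u)) / S n) \<longlonglongrightarrow> W u"
        by (rule filterlim_compose) (use S in \<open>simp add: filterlim_at\<close>)
      then show ?thesis using False by (simp add: Q_def W'_def)
    qed (simp add: Q_def W'_def)
    have "(\<lambda>n. integral {l..r} (Q (S n))) \<longlonglongrightarrow> integral {l..r} W'"
      by (rule dominated_convergence(2)[OF _ B_int bound conv]) (use Q_int in auto)
    then show ?thesis unfolding integral_unique[OF Q_int] integral_unique[OF W'] .
  qed
  have "((\<lambda>h. (F (s0 + h) - F s0) / h) \<longlongrightarrow> I) (at 0)"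
    unfolding LIMSEQ_SEQ_conv[symmetric]
  proof (intro allI impI)
    fix S :: "nat \<Rightarrow> real" assume S: "(\<forall>n. S n \<noteq> 0) \<and> S \<longlonglongrightarrow> 0"
    then obtain N where N: "\<And>n. n \<ge> N \<Longrightarrow> \<bar>S n\<bar> < \<delta>"
      using \<open>\<delta> > 0\<close> LIMSEQ_D[of S 0 \<delta>] by auto
    have "(\<lambda>n. (F (s0 + S (n + N)) - F s0) / S (n + N)) \<longlonglongrightarrow> I"
      by (rule lim) (use S N in \<open>auto intro: LIMSEQ_ignore_initial_segment\<close>)
    then show "(\<lambda>n. (F (s0 + S n) - F s0) / S n) \<longlonglongrightarrow> I" by (rule LIMSEQ_offset)
  qed
  then show ?thesis unfolding DERIV_def F_def .
qed

text \<open>L'Hospital's rule for the difference quotient. It fills in the isolated times at which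
  the height cannot be differentiated directly.\<close>

lemma DERIV_punctured_limit:
  fixes f g :: "real \<Rightarrow> real"
  assumes "f \<midarrow>a\<rightarrow> f a" "\<forall>\<^sub>F x in at a. (f has_real_derivative g x) (at x)" "g \<midarrow>a\<rightarrow> g a"
  shows "(f has_real_derivative g a) (at a)"
proof -
  have "((\<lambda>x. (f x - f a) / (x - a)) \<longlongrightarrow> g a) (at a)"
  proof (rule lhopital[where f' = g and g' = "\<lambda>_. 1"])
    show "((\<lambda>x. f x - f a) \<longlongrightarrow> 0) (at a)" using assms(1) by (simp add: LIM_zero)
    show "((\<lambda>x. x - a) \<longlongrightarrow> 0) (at a)" by (simp add: LIM_zero)
    show "\<forall>\<^sub>F x in at a. x - a \<noteq> 0" by (simp add: eventually_at_filter)
    show "\<forall>\<^sub>F x in at a. DERIV (\<lambda>x. f x - f a) x :> g x"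
      using assms(2) by eventually_elim (auto intro!: derivative_eq_intros)
    show "\<forall>\<^sub>F x in at a. DERIV (\<lambda>x. x - a) x :> 1" by (auto intro!: derivative_eq_intros always_eventually)
  qed (use assms(3) in auto)
  then show ?thesis by (simp add: has_field_derivative_iff)
qed

lemma nonzero_same_sign:
  fixes \<phi> :: "real \<Rightarrow> real"
  assumes "l \<le> r" "continuous_on {l..r} \<phi>" "\<And>u. u \<in> {l..r} \<Longrightarrow> \<phi> u \<noteq> 0"
  shows "\<phi> l * \<phi> r > 0"
proof (rule ccontr)
  assume "\<not> ?thesis"
  then have "\<phi> l \<le> 0 \<and> 0 \<le> \<phi> r \<or> \<phi> r \<le> 0 \<and> 0 \<le> \<phi> l" by (auto simp: not_less mult_le_0_iff)
  then show False
    using IVT'[of \<phi> l 0 r] IVT2'[of \<phi> r 0 l] assms by fastforce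
qed

section \<open>Triangles over the unit interval\<close>

lemma Im_normalized_sq:
  assumes "norm z > 0"
  shows "(Im z / norm z)\<^sup>2 = 1 - (Re z / norm z)\<^sup>2"
proof -
  have "(Re z / norm z)\<^sup>2 + (Im z / norm z)\<^sup>2 = ((Re z)\<^sup>2 + (Im z)\<^sup>2) / (norm z)\<^sup>2"
    by (simp add: power_divide add_divide_distrib)
  also have "\<dots> = 1" using assms by (simp flip: cmod_power2)
  finally show ?thesis by simp
qed

lemma unit_upper_eq:
  assumes "Im z > 0" "Im w > 0" "Re z / norm z = Re w / norm w"
  shows "w = of_real (norm w / norm z) * z"
proof -
  have nz: "norm z > 0" "norm w > 0" using assms by auto
  have "(Im z / norm z)\<^sup>2 = (Im w / norm w)\<^sup>2" using Im_normalized_sq nz assms(3) by metis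
  then have "Im z / norm z = Im w / norm w"
    using nz assms by (simp add: power2_eq_iff_nonneg)
  then show ?thesis using nz assms(3) by (simp add: complex_eq_iff field_simps)
qed

lemma abs_Re_norm_le: "\<bar>Re z / norm z\<bar> \<le> 1"
  using abs_Re_le_cmod[of z] by (cases "z = 0") (auto simp: divide_le_eq)

lemma Re_norm_bounds: "-1 \<le> Re z / norm z" "Re z / norm z \<le> 1"
  using abs_Re_norm_le[of z] unfolding abs_le_iff by linarith+

lemma clamped_arccos_eq: "-1 \<le> g \<Longrightarrow> g \<le> 1 \<Longrightarrow> clamped_arccos g = arccos g"
  by (simp add: clamped_arccos_def)

lemma angle_at_0_1: "angle_at 0 1 z = arccos (Re z / norm z)"
  and angle_at_1_0: "angle_at 1 0 z = arccos (Re (1 - z) / norm (1 - z))"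
  by (simp_all add: angle_at_def inner_complex_def norm_minus_commute)

text \<open>The angle at 0 fixes the ray from 0, so w = r z; the angle at 1 fixes the ray from 1, so
  1 - w = s (1 - z). Imaginary parts give r = s, and then real parts give r = 1. The conjugates move
  1 - z and 1 - w back to the upper half plane.\<close>

lemma triangle_angles_unique:
  assumes "Im z > 0" "Im w > 0" "angle_at 0 1 w = angle_at 0 1 z" "angle_at 1 0 w = angle_at 1 0 z"
  shows "w = z"
proof -
  have "Re z / norm z = Re w / norm w"
    using assms(3) abs_Re_norm_le arccos_eq_iff unfolding angle_at_0_1 by metis
  from unit_upper_eq[OF assms(1,2) this] obtain r where r: "w = of_real r * z" by blast
  have "Re (1 - z) / norm (1 - z) = Re (1 - w) / norm (1 - w)"
    using assms(4) abs_Re_norm_le arccos_eq_iff unfolding angle_at_1_0 by metis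
  then have "Re (cnj (1 - z)) / norm (cnj (1 - z)) = Re (cnj (1 - w)) / norm (cnj (1 - w))"
    unfolding complex_mod_cnj cnj.sel .
  then have "cnj (1 - w) = of_real (norm (cnj (1 - w)) / norm (cnj (1 - z))) * cnj (1 - z)"
    by (rule unit_upper_eq[rotated 2]) (use assms in auto)
  then obtain s where s: "cnj (1 - w) = of_real s * cnj (1 - z)" by blast
  have i: "Im w = r * Im z" "Re w = r * Re z" using r by simp_all
  have j: "Im w = s * Im z" "1 - Re w = s * (1 - Re z)"
    using s by (simp_all add: complex_eq_iff)
  have "r = s" using i j assms(1) by simp
  then have "r = 1" using i j by (simp add: algebra_simps)
  then show ?thesis using r by simp
qed

lemma Arg_upper: 
  assumes "Im z > 0"
  shows "Im (Ln z) = arccos (Re z / norm z)"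
proof -
  have "z \<noteq> 0" using assms by auto
  have "0 < Im (Ln z)" "Im (Ln z) < pi" using assms Im_Ln_pos_lt_imp by auto
  moreover have "cos (Im (Ln z)) = Re z / norm z"
    using \<open>z \<noteq> 0\<close> by (metis Arg_def Arg_eq_Im_Ln cos_Arg)
  ultimately show ?thesis by (metis arccos_cos less_imp_le)
qed

text \<open>The three lozenge densities add up to pi by definition, so this makes the third
  condition in \<open>complex_slope\<close> a consequence of the other two. The sine of the sum of
  the base angles is positive, hence that sum is at most pi and the arccosine can be undone.\<close>

lemma triangle_angle_sum:
  assumes "Im z > 0"
  shows "angle_at z 0 1 = pi - angle_at 0 1 z - angle_at 1 0 z"
proof -
  have nz: "norm z > 0" "norm (1 - z) > 0" using assms by (auto simp: complex_eq_iff)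
  define \<alpha> \<gamma> where "\<alpha> = angle_at 0 1 z" and "\<gamma> = angle_at 1 0 z"
  have c: "cos \<alpha> = Re z / norm z" "cos \<gamma> = Re (1 - z) / norm (1 - z)"
    using abs_Re_norm_le[of z] abs_Re_norm_le[of "1 - z"] 
    unfolding \<alpha>_def \<gamma>_def angle_at_0_1 angle_at_1_0 by (simp_all add: cos_arccos_abs)
  have range: "0 \<le> \<alpha>" "\<alpha> \<le> pi" "0 \<le> \<gamma>" "\<gamma> \<le> pi"
    unfolding \<alpha>_def \<gamma>_def angle_at_0_1 angle_at_1_0
    by (rule arccos_lbound[OF Re_norm_bounds] arccos_ubound[OF Re_norm_bounds])+
  note sq = Im_normalized_sq[symmetric]
  have s: "sin \<alpha> = Im z / norm z" "sin \<gamma> = Im z / norm (1 - z)"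
  proof -
    have "sin \<alpha> = sqrt ((Im z / norm z)\<^sup>2)"
      using sin_cos_sqrt[OF sin_ge_zero[OF range(1,2)]] unfolding c sq[OF nz(1)] .
    then show "sin \<alpha> = Im z / norm z" using assms by simp
    have "sin \<gamma> = sqrt ((Im (1 - z) / norm (1 - z))\<^sup>2)"
      using sin_cos_sqrt[OF sin_ge_zero[OF range(3,4)]] unfolding c sq[OF nz(2)] .
    then show "sin \<gamma> = Im z / norm (1 - z)" using assms by simp
  qed
  have "sin (\<alpha> + \<gamma>) = Im z / (norm z * norm (1 - z))"
    unfolding sin_add s c using nz by (simp add: field_simps)
  also have "\<dots> > 0" using assms nz by simp
  finally have "\<alpha> + \<gamma> \<le> pi"
    using sin_le_zero[of "\<alpha> + \<gamma>"] range by (cases "\<alpha> + \<gamma> = 2 * pi") force+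
  have "angle_at z 0 1 = arccos (- cos (\<alpha> + \<gamma>))"
    unfolding angle_at_def cos_add s c using nz
    by (intro arg_cong[of _ _ arccos]) (simp add: inner_complex_def field_simps norm_minus_commute power2_eq_square)
  also have "\<dots> = pi - (\<alpha> + \<gamma>)"
    using \<open>\<alpha> + \<gamma> \<le> pi\<close> range arccos_cos[of "pi - (\<alpha> + \<gamma>)"] by simp
  finally show ?thesis by (simp add: \<alpha>_def \<gamma>_def)
qed

text \<open>The apex of a triangle over the edge from 0 to 1, whose squared side lengths opposite to the
  apex, to 0 and to 1 are proportional to \<open>a\<close>, \<open>b\<close>, \<open>v\<close>.\<close>

definition apex :: "real \<Rightarrow> real \<Rightarrow> real \<Rightarrow> complex" where
  "apex a b v = Complex ((a + v - b) / (2 * a)) (sqrt (4 * a * b - (a + b - v)\<^sup>2) / (2 * a))"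

text \<open>The apex and its conjugate are the roots of the real quadratic in the fourth claim:
  their product is v/a and their sum (a + v - b)/a. The fifth claim is the derivative of this
  quadratic at \<open>z\<close>. Heron's expression is symmetric in the sides, so one square root
  serves all angles.\<close>

lemma apex_props:
  assumes "a > 0" "b > 0" "v > 0" "4 * a * b - (a + b - v)\<^sup>2 > 0"
  defines "z \<equiv> apex a b v"
  shows "Im z > 0" "(norm z)\<^sup>2 = v / a" "(norm (1 - z))\<^sup>2 = b / a"
    "of_real a * z * (z - 1) + of_real v * (1 - z) + of_real b * z = 0"
    "2 * of_real a * z - of_real (a + v - b) = \<i> * of_real (sqrt (4 * a * b - (a + b - v)\<^sup>2))"
    "Im (Ln z) = clamped_arccos ((a + v - b) / (2 * sqrt (a * v)))"
    "Im (Ln (1 - z)) = - clamped_arccos ((a + b - v) / (2 * sqrt (a * b)))"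
    "angle_at 0 1 z = clamped_arccos ((a + v - b) / (2 * sqrt (a * v)))"
    "angle_at 1 0 z = clamped_arccos ((a + b - v) / (2 * sqrt (a * b)))"
proof -
  define S where "S = sqrt (4 * a * b - (a + b - v)\<^sup>2)"
  have S: "S\<^sup>2 = 4 * a * b - (a + b - v)\<^sup>2" "S > 0" using assms by (simp_all add: S_def)
  have z: "Re z = (a + v - b) / (2 * a)" "Im z = S / (2 * a)" by (simp_all add: z_def apex_def S_def)
  show im: "Im z > 0" unfolding z using S assms(1) by simp
  have "(norm z)\<^sup>2 = ((a + v - b)\<^sup>2 + S\<^sup>2) / (4 * a\<^sup>2)"
    unfolding cmod_power2 z by (simp add: power_divide power_mult_distrib add_divide_distrib)
  also have "(a + v - b)\<^sup>2 + S\<^sup>2 = 4 * a * v" unfolding S by algebra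
  finally show nz: "(norm z)\<^sup>2 = v / a" using assms by (simp add: field_simps power2_eq_square)
  have "1 - (a + v - b) / (2 * a) = (a + b - v) / (2 * a)" using assms by (simp add: field_simps)
  then have re1: "Re (1 - z) = (a + b - v) / (2 * a)" unfolding minus_complex.sel z by simp
  have "(norm (1 - z))\<^sup>2 = ((a + b - v)\<^sup>2 + S\<^sup>2) / (4 * a\<^sup>2)"
    unfolding cmod_power2 re1 by (simp add: z power_divide power_mult_distrib add_divide_distrib)
  also have "(a + b - v)\<^sup>2 + S\<^sup>2 = 4 * a * b" unfolding S by algebra
  finally show nz1: "(norm (1 - z))\<^sup>2 = b / a" using assms by (simp add: field_simps power2_eq_square)
  have zz: "2 * of_real a * z = of_real (a + v - b) + \<i> * of_real S"
    using assms(1) by (simp add: complex_eq_iff z)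
  then show "2 * of_real a * z - of_real (a + v - b) = \<i> * of_real (sqrt (4 * a * b - (a + b - v)\<^sup>2))"
    by (simp add: S_def)
  have "4 * of_real a * (of_real a * z * (z - 1) + of_real v * (1 - z) + of_real b * z)
      = (2 * of_real a * z - of_real (a + v - b))\<^sup>2 + of_real (4 * a * v - (a + v - b)\<^sup>2)"
    by (simp add: power2_eq_square algebra_simps)
  also have "\<dots> = - of_real (S\<^sup>2) + of_real (4 * a * v - (a + v - b)\<^sup>2)"
    unfolding zz by (simp add: power_mult_distrib)
  also have "S\<^sup>2 = 4 * a * v - (a + v - b)\<^sup>2" unfolding S by algebra
  finally show "of_real a * z * (z - 1) + of_real v * (1 - z) + of_real b * z = 0"
    using assms(1) by simp
  have n: "norm z = sqrt (v / a)" "norm (1 - z) = sqrt (b / a)"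
    using nz nz1 by (metis norm_ge_zero real_sqrt_abs abs_of_nonneg)+
  have sq: "a * sqrt (v / a) = sqrt (a * v)" "a * sqrt (b / a) = sqrt (a * b)"
    using assms by (simp_all add: real_sqrt_divide real_sqrt_mult field_simps)
  have r1: "Re z / norm z = (a + v - b) / (2 * sqrt (a * v))"
    unfolding n z sq(1)[symmetric] by simp
  have r3: "Re (1 - z) / norm (1 - z) = (a + b - v) / (2 * sqrt (a * b))"
    unfolding n re1 sq(2)[symmetric] by simp
  have cl: "clamped_arccos (Re u / norm u) = arccos (Re u / norm u)" for u
    by (rule clamped_arccos_eq[OF Re_norm_bounds])
  show "Im (Ln z) = clamped_arccos ((a + v - b) / (2 * sqrt (a * v)))"
    "angle_at 0 1 z = clamped_arccos ((a + v - b) / (2 * sqrt (a * v)))"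
    unfolding r1[symmetric] cl angle_at_0_1 using Arg_upper[OF im] by auto
  have "Im (Ln (1 - z)) = - Im (Ln (cnj (1 - z)))"
    using im by (subst cnj_Ln[symmetric]) (auto simp: complex_nonpos_Reals_iff)
  also have "Im (Ln (cnj (1 - z))) = arccos (Re (cnj (1 - z)) / norm (cnj (1 - z)))"
    using im by (intro Arg_upper) simp
  also have "\<dots> = arccos (Re (1 - z) / norm (1 - z))" unfolding complex_mod_cnj by simp
  finally show "Im (Ln (1 - z)) = - clamped_arccos ((a + b - v) / (2 * sqrt (a * b)))"
    unfolding r3[symmetric] cl .
  show "angle_at 1 0 z = clamped_arccos ((a + b - v) / (2 * sqrt (a * b)))"
    unfolding r3[symmetric] cl angle_at_1_0 ..
qed

lemma solve_linear:
  fixes e m w :: complex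
  assumes "e + m * w = 0" "m \<noteq> 0"
  shows "w = - e / m"
proof -
  have h: "m * w = - e" using assms(1) by (simp add: eq_neg_iff_add_eq_0 add.commute)
  have "w = m * w / m" using assms(2) by simp
  then show ?thesis unfolding h .
qed

text \<open>Implicit differentiation. The explicit formula is used only to see that a derivative
  exists; the quadratic equation then determines it as a rational expression in \<open>z\<close>,
  free of square roots, to which polynomial identities apply.\<close>

lemma apex_has_derivative:
  fixes a b v :: "real \<Rightarrow> real"
  assumes "(a has_real_derivative a') (at s)" "(b has_real_derivative b') (at s)"
    "(v has_real_derivative v') (at s)"
    and pos: "\<forall>\<^sub>F s in nhds s. a s > 0 \<and> b s > 0 \<and> v s > 0 \<and> 4 * a s * b s - (a s + b s - v s)\<^sup>2 > 0"
  defines "z \<equiv> apex (a s) (b s) (v s)"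
  shows "((\<lambda>s. apex (a s) (b s) (v s)) has_vector_derivative
    - (of_real a' * z * (z - 1) + of_real v' * (1 - z) + of_real b' * z) /
      (2 * of_real (a s) * z - of_real (a s + v s - b s))) (at s)"
proof -
  have p: "a s > 0" "b s > 0" "v s > 0" and D: "4 * a s * b s - (a s + b s - v s)\<^sup>2 > 0"
    using eventually_nhds_x_imp_x[OF pos] by auto
  have dS: "\<exists>S'. ((\<lambda>s. sqrt (4 * a s * b s - (a s + b s - v s)\<^sup>2) / (2 * a s)) has_real_derivative S') (at s)"
    using p D by (auto intro!: exI derivative_eq_intros assms(1-3))
  have dR: "\<exists>R'. ((\<lambda>s. (a s + v s - b s) / (2 * a s)) has_real_derivative R') (at s)"
    using p by (auto intro!: exI derivative_eq_intros assms(1-3))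
  obtain z' where z': "((\<lambda>s. apex (a s) (b s) (v s)) has_vector_derivative z') (at s)"
  proof -
    from dS dR obtain S' R' where
      "((\<lambda>s. sqrt (4 * a s * b s - (a s + b s - v s)\<^sup>2) / (2 * a s)) has_real_derivative S') (at s)"
      "((\<lambda>s. (a s + v s - b s) / (2 * a s)) has_real_derivative R') (at s)"
      by blast
    then have "((\<lambda>s. apex (a s) (b s) (v s)) has_vector_derivative Complex R' S') (at s)"
      unfolding apex_def has_vector_derivative_complex_iff by simp
    then show thesis by (rule that)
  qed
  have da: "((\<lambda>s. complex_of_real (a s)) has_vector_derivative of_real a') (at s)"
    "((\<lambda>s. complex_of_real (b s)) has_vector_derivative of_real b') (at s)"
    "((\<lambda>s. complex_of_real (v s)) has_vector_derivative of_real v') (at s)"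
    using assms(1-3) by (auto intro!: has_vector_derivative_of_real simp: has_real_derivative_iff_has_vector_derivative)
  let ?E = "\<lambda>s. of_real (a s) * apex (a s) (b s) (v s) * (apex (a s) (b s) (v s) - 1) +
      of_real (v s) * (1 - apex (a s) (b s) (v s)) + of_real (b s) * apex (a s) (b s) (v s)"
  have "(?E has_vector_derivative (of_real a' * z * (z - 1) + of_real v' * (1 - z) + of_real b' * z) +
      (2 * of_real (a s) * z - of_real (a s + v s - b s)) * z') (at s)"
  proof (rule has_vector_derivative_eq_rhs)
    show "(?E has_vector_derivative (of_real (a s) * z * (z' - 0) + (of_real (a s) * z' + of_real a' * z) * (z - 1))
      + (of_real (v s) * (0 - z') + of_real v' * (1 - z)) + (of_real (b s) * z' + of_real b' * z)) (at s)"
      unfolding z_def by (intro has_vector_derivative_add has_vector_derivative_mult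
          has_vector_derivative_diff has_vector_derivative_const da z')
  qed (unfold of_real_add of_real_diff, algebra)
  moreover have "(?E has_vector_derivative 0) (at s)"
  proof -
    from pos obtain U where U: "open U" "s \<in> U"
      "\<And>s. s \<in> U \<Longrightarrow> a s > 0 \<and> b s > 0 \<and> v s > 0 \<and> 4 * a s * b s - (a s + b s - v s)\<^sup>2 > 0"
      unfolding eventually_nhds by blast
    show ?thesis
      by (rule has_vector_derivative_transform_within_open[of "\<lambda>_. 0" _ _ U])
        (use U apex_props(4) in \<open>auto intro!: derivative_eq_intros\<close>)
  qed
  ultimately have "(of_real a' * z * (z - 1) + of_real v' * (1 - z) + of_real b' * z) +
      (2 * of_real (a s) * z - of_real (a s + v s - b s)) * z' = 0"
    using vector_derivative_unique_at by blast
  moreover have "2 * of_real (a s) * z - of_real (a s + v s - b s) \<noteq> 0"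
    unfolding z_def apex_props(5)[OF p D] using real_sqrt_gt_zero[OF D]
    by (simp del: real_sqrt_eq_zero_cancel_iff real_sqrt_gt_0_iff)
  ultimately have "z' = - (of_real a' * z * (z - 1) + of_real v' * (1 - z) + of_real b' * z) /
      (2 * of_real (a s) * z - of_real (a s + v s - b s))"
    by (rule solve_linear)
  with z' show ?thesis by simp
qed

text \<open>Each side is assumed to have a known logarithmic derivative in one direction:
  \<open>v\<close> along x, \<open>b\<close> along t, \<open>a\<close> along x + t. With
  \<open>rel\<close>, the defect of the Burgers equation, cleared of denominators, is then \<beta> z
  - 2 l (1 - z) times the quadratic in \<open>E\<close>, hence zero.\<close>

lemma burgers_algebra:
  fixes z :: complex and a b v a\<^sub>x b\<^sub>x v\<^sub>x a\<^sub>t b\<^sub>t v\<^sub>t l \<beta> :: real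
  assumes E: "of_real a * z * (z - 1) + of_real v * (1 - z) + of_real b * z = 0"
    and nz: "z \<noteq> 0" "1 - z \<noteq> 0" "2 * of_real a * z - of_real (a + v - b) \<noteq> (0::complex)"
    and log_derivs: "v\<^sub>x = 2 * l * v" "b\<^sub>t = \<beta> * b" "a\<^sub>x + a\<^sub>t = \<beta> * a"
    and rel: "a * l - a\<^sub>x + b\<^sub>x - b * l + \<beta> * v - v\<^sub>t - v * l = 0"
  defines "M \<equiv> 2 * of_real a * z - of_real (a + v - b)"
  defines "z\<^sub>x \<equiv> - (of_real a\<^sub>x * z * (z - 1) + of_real v\<^sub>x * (1 - z) + of_real b\<^sub>x * z) / M"
    and "z\<^sub>t \<equiv> - (of_real a\<^sub>t * z * (z - 1) + of_real v\<^sub>t * (1 - z) + of_real b\<^sub>t * z) / M"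
  shows "z\<^sub>x / z - z\<^sub>t / (1 - z) = of_real l"
proof -
  have M: "M \<noteq> 0" using nz by (simp add: M_def)
  have x: "z\<^sub>x * M = - (of_real a\<^sub>x * z * (z - 1) + of_real v\<^sub>x * (1 - z) + of_real b\<^sub>x * z)"
    and t: "z\<^sub>t * M = - (of_real a\<^sub>t * z * (z - 1) + of_real v\<^sub>t * (1 - z) + of_real b\<^sub>t * z)"
    unfolding z\<^sub>x_def z\<^sub>t_def using M by simp_all
  define p r where "p = z\<^sub>x / z" and "r = z\<^sub>t / (1 - z)"
  have pr: "z\<^sub>x = p * z" "z\<^sub>t = r * (1 - z)" using nz by (simp_all add: p_def r_def)
  have "(p - r - of_real l) * (M * z * (1 - z)) =
      (z\<^sub>x * M) * (1 - z) - (z\<^sub>t * M) * z - of_real l * M * z * (1 - z)"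
    unfolding pr by algebra
  then have "(z\<^sub>x / z - z\<^sub>t / (1 - z) - of_real l) * (M * z * (1 - z)) =
      (z\<^sub>x * M) * (1 - z) - (z\<^sub>t * M) * z - of_real l * M * z * (1 - z)"
    unfolding p_def r_def .
  also have "\<dots> = 0"
  proof -
    have 1: "of_real v\<^sub>x = 2 * of_real l * (of_real v :: complex)"
      and 2: "of_real b\<^sub>t = of_real \<beta> * (of_real b :: complex)"
      unfolding log_derivs by simp_all
    have "a\<^sub>t = \<beta> * a - a\<^sub>x" using log_derivs(3) by simp
    then have 3: "of_real a\<^sub>t = of_real \<beta> * (of_real a :: complex) - of_real a\<^sub>x" by simp
    have "v\<^sub>t = a * l - a\<^sub>x + b\<^sub>x - b * l + \<beta> * v - v * l" using rel by simp
    then have 4: "of_real v\<^sub>t = of_real a * of_real l - of_real a\<^sub>x + of_real b\<^sub>x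
        - of_real b * of_real l + of_real \<beta> * of_real v - (of_real v * of_real l :: complex)"
      by simp
    have "(z\<^sub>x * M) * (1 - z) - (z\<^sub>t * M) * z - of_real l * M * z * (1 - z) =
        (of_real \<beta> * z - 2 * of_real l * (1 - z)) *
        (of_real a * z * (z - 1) + of_real v * (1 - z) + of_real b * z)"
      unfolding x t unfolding M_def of_real_add of_real_diff 1 2 3 4 by algebra
    then show ?thesis unfolding E by simp
  qed
  finally show ?thesis using nz M by simp
qed

section \<open>The sides of the triangle\<close>

text \<open>Applied with w = q^\<xi>, \<open>D\<close> the denominator and \<open>A\<close>,
  \<open>C\<close> the numerators of the two coefficients; \<open>m\<close> is \<mu> - 1 -
  \<kappa>^2 q^(-t-c). The point is that the factor (Z - J)^2 makes D^2 split off from the numerator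
  of the discriminant.\<close>

lemma quartic_identity:
  fixes e1 e2 n J Z w :: real
  assumes "k = J * Z" "N = n * e1 * e2" "m = (Z - 1) * (1 - J)" "D = 1 - w\<^sup>2 * N"
    and "A = (1 - w * e1) * (1 - w * e2) * (1 - w * N) * (1 - w * k * n)"
    and "C = (1 - w) * (1 - w * n * e2) * (k - e1 * e2 * w) * (1 - w * n * e1)"
    and "a = -(1 - J) * (e1 - J) * (1 - n * Z) * (e2 - Z)"
    and "b = -(1 - Z) * (e1 - Z) * (1 - n * J) * (e2 - J)"
  shows "(Z - J)\<^sup>2 * (4 * A * C - (m * D\<^sup>2 + A + C)\<^sup>2) =
    D\<^sup>2 * (4 * a * b * w\<^sup>2 - ((a + b) * w - (1 - e2 * w) * (1 - n * e1 * w) * (Z - J)\<^sup>2)\<^sup>2)"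
  unfolding assms by algebra

lemma powr_diff_sign:
  fixes q u v :: real
  assumes "q > 0" "q \<noteq> 1" "v < u"
  shows "ln q * (q powr u - q powr v) > 0"
proof (cases "q > 1")
  case True
  then show ?thesis using assms by simp
next
  case False
  then have "q < 1" using assms by simp
  then have "ln q < 0" "q powr u < q powr v" using assms by (auto intro: powr_less_mono')
  then show ?thesis by (simp add: mult_neg_neg)
qed

text \<open>Only \<kappa>^2 matters. Written as a power of q, the excluded interval for |\<kappa>|
  becomes the range -2 < s < b + c of exponents, the same for q < 1 and q > 1.\<close>

locale q_racah =
  fixes b c q :: real and \<kappa> :: complex
  assumes b_pos: "b > 0" and c_pos: "c > 0" and q_pos: "q > 0" and q_neq: "q \<noteq> 1"
    and K_range: "Re (\<kappa>\<^sup>2) < 0 \<or> (\<exists>s. Re (\<kappa>\<^sup>2) = q powr s \<and> (s \<le> -2 \<or> b + c \<le> s))"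
begin

text \<open>
  In these coordinates \<open>\<mu> = Z + J\<close>, the parameters of \<open>A\<close> and \<open>C\<close> are \<open>e1\<close>, \<open>e2\<close>, \<open>nn * e1 * e2\<close>
  and \<open>nn * Z * J\<close>, all dependencies are polynomial, and the reflection \<open>\<mu>(x) = \<mu>(x')\<close> of the
  lattice exchanges \<open>Z\<close> and \<open>J\<close>, hence \<open>side_a\<close> and \<open>side_b\<close>.
\<close>

definition K where "K = Re (\<kappa>\<^sup>2)"
definition e1 where "e1 = q powr (-c - 1)"
definition e2 where "e2 t = q powr (-t - 1)"
definition nn where "nn t = q powr (t - b)"
definition Z where "Z x = q powr (-x)"
definition J where "J t x = K * q powr (x - t - c)"

text \<open>The factors in \<open>Z\<close> vanish on edges of the hexagon: those of
  \<open>side_a\<close> at x = t - b and x = 1 + t, those of \<open>side_b\<close> at x = 0 and x =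
  1 + c. The constant factors of \<open>side_v\<close> vanish on the vertical edges t = 0 and t = b
  + c. The common scale q, irrelevant for the angles, removes the denominator of y(1).\<close>

definition side_a where "side_a t x = - q * (1 - J t x) * (e1 - J t x) * (1 - nn t * Z x) * (e2 t - Z x)"
definition side_b where "side_b t x = - q * (1 - Z x) * (e1 - Z x) * (1 - nn t * J t x) * (e2 t - J t x)"
definition side_v where "side_v t x = (1 - e2 t * q) * (1 - nn t * e1 * q) * (Z x - J t x)\<^sup>2"

text \<open>Heron: sixteen times the squared area, hence positive exactly where the triangle exists.\<close>

definition heron where
  "heron t x = 4 * side_a t x * side_b t x - (side_a t x + side_b t x - side_v t x)\<^sup>2"

definition inside where
  "inside t x \<longleftrightarrow> 0 < t \<and> t < b + c \<and> max 0 (t - b) < x \<and> x < 1 + min t c"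

lemma q_nonzero [simp]: "q \<noteq> 0"
  using q_pos by simp

lemma qdiff: "v < u \<Longrightarrow> ln q * (q powr u - q powr v) > 0"
  using powr_diff_sign q_pos q_neq by blast

text \<open>Each difference of powers has the sign of ln q times the difference of exponents. In a
  product of two the sign of ln q cancels, so no distinction between q < 1 and q > 1 is
  needed.\<close>

lemma qprod_pos: "0 < (u - v) * (u' - v') \<Longrightarrow> (q powr u - q powr v) * (q powr u' - q powr v') > 0"
proof -
  assume *: "0 < (u - v) * (u' - v')"
  have l: "ln q \<noteq> 0" using q_pos q_neq by simp
  consider "v < u" "v' < u'" | "u < v" "u' < v'"
    using * by (auto simp: zero_less_mult_iff)
  then have "0 < (ln q * (q powr u - q powr v)) * (ln q * (q powr u' - q powr v'))"
  proof cases
    case 1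
    then show ?thesis using qdiff by simp
  next
    case 2
    have "0 < (ln q * (q powr v - q powr u)) * (ln q * (q powr v' - q powr u'))"
      using 2 qdiff by simp
    then show ?thesis by (simp add: algebra_simps)
  qed
  also have "\<dots> = (ln q)\<^sup>2 * ((q powr u - q powr v) * (q powr u' - q powr v'))"
    by (simp add: power2_eq_square)
  finally show ?thesis using l by (simp add: zero_less_mult_iff)
qed

lemma qprod_nonneg: "0 \<le> (u - v) * (u' - v') \<Longrightarrow> (q powr u - q powr v) * (q powr u' - q powr v') \<ge> 0"
  using qprod_pos[of u v u' v'] by (cases "u = v \<or> u' = v'") (auto simp: less_le)

lemma Z_signs:
  shows "0 < x \<Longrightarrow> 0 < ln q * (1 - Z x)" "x < 1 + c \<Longrightarrow> 0 < ln q * (Z x - e1)"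
    "t - b < x \<Longrightarrow> 0 < ln q * (1 - nn t * Z x)" "x < 1 + t \<Longrightarrow> 0 < ln q * (Z x - e2 t)"
proof -
  show "0 < ln q * (1 - Z x)" if "0 < x" using qdiff[of "-x" 0] that by (simp add: Z_def q_pos)
  show "0 < ln q * (Z x - e1)" if "x < 1 + c" using qdiff[of "-c-1" "-x"] that
    by (simp add: Z_def e1_def algebra_simps)
  show "0 < ln q * (1 - nn t * Z x)" if "t - b < x" using qdiff[of "t - b - x" 0] that q_pos
    by (simp add: Z_def nn_def flip: powr_add)
  show "0 < ln q * (Z x - e2 t)" if "x < 1 + t" using qdiff[of "-t-1" "-x"] that
    by (simp add: Z_def e2_def algebra_simps)
qed

text \<open>Take \<tau> = 1 for negative \<kappa>^2, and ln q or - ln q for \<kappa>^2 = q^s with s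
  \<le> -2 or s \<ge> b + c. Afterwards only the existence of a common \<tau> is used, because the
  factors with \<open>J\<close> occur in pairs or with a sign that can be normalized.\<close>

lemma J_signs:
  obtains \<tau> where "\<And>t x. t - b < x \<Longrightarrow> x < 1 + t \<Longrightarrow> 0 < \<tau> * (1 - J t x) \<and> 0 < \<tau> * (e1 - J t x)"
    "\<And>t x. 0 < x \<Longrightarrow> x < 1 + c \<Longrightarrow> 0 < \<tau> * (1 - nn t * J t x) \<and> 0 < \<tau> * (e2 t - J t x)"
    "\<And>t x. t - b < 2 * x \<Longrightarrow> 2 * x < t + c + 2 \<Longrightarrow> 0 < \<tau> * (Z x - J t x)"
proof -
  have eqn: "nn t * J t x = K * q powr (x - b - c)" for t x
    by (simp add: nn_def J_def algebra_simps flip: powr_add)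
  consider "K < 0" | s where "K = q powr s" "s \<le> -2" | s where "K = q powr s" "b + c \<le> s"
    using K_range unfolding K_def by blast
  then show thesis
  proof cases
    case 1
    have J: "J t x < 0" "nn t * J t x < 0" for t x
      using 1 q_pos by (auto simp: J_def nn_def mult_less_0_iff)
    have e: "0 < e1" "\<And>t. 0 < e2 t" "\<And>x. 0 < Z x"
      using q_pos by (auto simp: e1_def e2_def Z_def)
    have "0 < 1 - J t x" "0 < e1 - J t x" "0 < 1 - nn t * J t x" "0 < e2 t - J t x"
      "0 < Z x - J t x" for t x
      using J[of t x] e(1) e(2)[of t] e(3)[of x] by linarith+
    then show thesis using that[of 1] by simp
  next
    case 2
    have J: "J t x = q powr (s + x - t - c)" "nn t * J t x = q powr (s + x - b - c)" for t x
      unfolding eqn using 2(1) by (auto simp: J_def algebra_simps simp flip: powr_add)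
    show thesis
      apply (rule that[of "ln q"])
      subgoal for t x
        using qdiff[of "s + x - t - c" 0] qdiff[of "s + x - t - c" "-c-1"] 2 c_pos q_pos
        by (simp add: J e1_def)
      subgoal for t x
        using qdiff[of "s + x - b - c" 0] qdiff[of "s + x - t - c" "-t-1"] 2 b_pos q_pos
        unfolding J(2) unfolding J(1) by (simp add: e2_def)
      subgoal for t x
        using qdiff[of "s + x - t - c" "-x"] 2 by (simp add: J Z_def)
      done
  next
    case 3
    have J: "J t x = q powr (s + x - t - c)" "nn t * J t x = q powr (s + x - b - c)" for t x
      unfolding eqn using 3(1) by (auto simp: J_def algebra_simps simp flip: powr_add)
    show thesis
      apply (rule that[of "- ln q"])
      subgoal for t x
        using qdiff[of 0 "s + x - t - c"] qdiff[of "-c-1" "s + x - t - c"] 3 c_pos q_pos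
        by (simp add: J e1_def algebra_simps)
      subgoal for t x
        using qdiff[of 0 "s + x - b - c"] qdiff[of "-t-1" "s + x - t - c"] 3 b_pos q_pos
        unfolding J(2) unfolding J(1) by (simp add: e2_def algebra_simps)
      subgoal for t x
        using qdiff[of "-x" "s + x - t - c"] 3 by (simp add: J Z_def algebra_simps)
      done
  qed
qed

lemma pos_of_signs: "0 < \<tau> * y \<Longrightarrow> 0 < \<tau> * z \<Longrightarrow> 0 < y * (z::real)"
  by (auto simp: zero_less_mult_iff)

lemma L_neq0: "t - b < 2 * x \<Longrightarrow> 2 * x < t + c + 2 \<Longrightarrow> Z x \<noteq> J t x"
  using J_signs by (metis diff_self less_irrefl mult_zero_right)

lemma side_a_pos: "t - b < x \<Longrightarrow> x < 1 + t \<Longrightarrow> 0 < side_a t x"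
proof -
  assume x: "t - b < x" "x < 1 + t"
  obtain \<tau> where "0 < \<tau> * (1 - J t x)" "0 < \<tau> * (e1 - J t x)" using J_signs x by metis
  then have 1: "0 < (1 - J t x) * (e1 - J t x)" by (rule pos_of_signs)
  have "0 < (1 - nn t * Z x) * (Z x - e2 t)" by (rule pos_of_signs[of "ln q"]) (use Z_signs(3,4) x in auto)
  from mult_pos_pos[OF mult_pos_pos[OF 1 this] q_pos] show ?thesis
    by (simp add: side_a_def algebra_simps)
qed

lemma side_b_pos: "0 < x \<Longrightarrow> x < 1 + c \<Longrightarrow> 0 < side_b t x"
proof -
  assume x: "0 < x" "x < 1 + c"
  obtain \<tau> where "0 < \<tau> * (1 - nn t * J t x)" "0 < \<tau> * (e2 t - J t x)" using J_signs x by metis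
  then have 1: "0 < (1 - nn t * J t x) * (e2 t - J t x)" by (rule pos_of_signs)
  have "0 < (1 - Z x) * (Z x - e1)" by (rule pos_of_signs[of "ln q"]) (use Z_signs(1,2) x in auto)
  from mult_pos_pos[OF mult_pos_pos[OF 1 this] q_pos] show ?thesis
    by (simp add: side_b_def algebra_simps)
qed

lemma side_v_pos: "0 < t \<Longrightarrow> t < b + c \<Longrightarrow> t - b < 2 * x \<Longrightarrow> 2 * x < t + c + 2 \<Longrightarrow> 0 < side_v t x"
proof -
  assume x: "0 < t" "t < b + c" "t - b < 2 * x" "2 * x < t + c + 2"
  have e: "e2 t * q = q powr (-t)" "nn t * e1 * q = q powr (t - b - c)"
    using q_pos by (simp_all add: e2_def nn_def e1_def powr_mult_base mult.commute[of _ q] algebra_simps flip: powr_add)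
  have "0 < (q powr 0 - q powr (-t)) * (q powr 0 - q powr (t - b - c))"
    by (rule qprod_pos) (use x in \<open>simp add: mult_pos_pos\<close>)
  then show ?thesis unfolding side_v_def e using L_neq0[OF x(3,4)] q_pos by simp
qed

lemma inside_bounds:
  assumes "inside t x"
  shows "0 < t" "t < b + c" "0 < x" "t - b < x" "x < 1 + t" "x < 1 + c"
    "t - b < 2 * x" "2 * x < t + c + 2"
  using assms by (auto simp: inside_def)

lemma inside_pos:
  assumes "inside t x"
  shows "0 < side_a t x" "0 < side_b t x" "0 < side_v t x" "Z x \<noteq> J t x"
  using inside_bounds[OF assms] side_a_pos side_b_pos side_v_pos L_neq0 by auto

section \<open>Numerators of the coefficients and the sign of their product\<close>

definition denom where "denom \<xi> = 1 - q powr (-b - c + 2 * \<xi> - 2)"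
definition numA where
  "numA \<xi> t = (1 - q powr (-c + \<xi> - 1)) * (1 - q powr (\<xi> - t - 1)) *
     (1 - q powr (-b - c + \<xi> - 2)) * (1 - K * q powr (-b - c + \<xi>))"
definition numC where
  "numC \<xi> t = (1 - q powr \<xi>) * (1 - q powr (-b + \<xi> - 1)) *
     (K * q powr (1 - c) - q powr (-c + \<xi> - 1)) * (q powr (-t - 1) - q powr (-b - c + \<xi> - 2))"

lemma coeff_num:
  "coeff_A b c q \<kappa> \<xi> t = numA \<xi> t / (denom \<xi>)\<^sup>2" "coeff_C b c q \<kappa> \<xi> t = numC \<xi> t / (denom \<xi>)\<^sup>2"
  by (simp_all add: coeff_A_def coeff_C_def numA_def numC_def denom_def K_def)

text \<open>\<open>disc\<close> contains the square of a square root, which agrees with the product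
  of the coefficients only where that product is nonnegative. The strict version is for \<xi> = 1,
  an interior point of the range.\<close>

lemma numAC_sign:
  assumes "0 \<le> \<xi>" "\<xi> \<le> 1 + c" "\<xi> \<le> 1 + t" "\<xi> \<le> 1 + b" "\<xi> \<le> 1 + b + c - t" "0 < t" "t < b + c"
  shows "0 \<le> numA \<xi> t * numC \<xi> t"
    and "0 < \<xi> \<Longrightarrow> \<xi> < 1 + c \<Longrightarrow> \<xi> < 1 + t \<Longrightarrow> \<xi> < 1 + b \<Longrightarrow> \<xi> < 1 + b + c - t \<Longrightarrow> 0 < numA \<xi> t * numC \<xi> t"
proof -
  \<comment> \<open>The factors are grouped into four products of two, chosen so that both members
    have the same sign on the range of \<xi>.\<close>
  let ?p1 = "(q powr 0 - q powr (-c + \<xi> - 1)) * (q powr 0 - q powr (\<xi> - t - 1))"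
  let ?p2 = "(q powr 0 - q powr (-b - c + \<xi> - 2)) * (q powr (-t - 1) - q powr (-b - c + \<xi> - 2))"
  let ?p3 = "(q powr \<xi> - q powr 0) * (q powr 0 - q powr (-b + \<xi> - 1))"
  let ?p4 = "(1 - K * q powr (-b - c + \<xi>)) * (q powr (-c + \<xi> - 1) - K * q powr (1 - c))"
  have eq: "numA \<xi> t * numC \<xi> t = ?p1 * ?p2 * (?p3 * ?p4)"
    using q_pos by (simp add: numA_def numC_def algebra_simps)
  have n1: "0 \<le> ?p1" by (rule qprod_nonneg) (use assms in \<open>auto intro!: mult_nonneg_nonneg\<close>)
  have n2: "0 \<le> ?p2" by (rule qprod_nonneg) (use assms in \<open>auto intro!: mult_nonneg_nonneg\<close>)
  have n3: "0 \<le> ?p3" by (rule qprod_nonneg) (use assms in \<open>auto intro!: mult_nonneg_nonneg\<close>)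
  have n4: "0 \<le> ?p4 \<and> (0 < \<xi> \<longrightarrow> \<xi> < 1 + c \<longrightarrow> 0 < ?p4)"
    using K_range unfolding K_def[symmetric]
  proof (elim disjE exE conjE)
    assume "K < 0"
    then have "K * q powr (-b - c + \<xi>) < 0" "K * q powr (1 - c) < 0" using q_pos by (simp_all add: mult_neg_pos)
    then have "0 < ?p4" using q_pos by (intro mult_pos_pos) (auto intro: less_le_trans[of _ 0] simp: less_trans)
    then show ?thesis by simp
  next
    fix s assume s: "K = q powr s" "s \<le> -2"
    have eq: "?p4 = (q powr 0 - q powr (s - b - c + \<xi>)) * (q powr (-c + \<xi> - 1) - q powr (s + 1 - c))"
      using q_pos s by (simp add: algebra_simps flip: powr_add)
    have "0 < (0 - (s - b - c + \<xi>)) * ((-c + \<xi> - 1) - (s + 1 - c))" if "0 < \<xi>"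
      using s assms b_pos c_pos that by (intro mult_pos_pos) auto
    moreover have "0 \<le> (0 - (s - b - c + \<xi>)) * ((-c + \<xi> - 1) - (s + 1 - c))"
      using s assms b_pos c_pos by (intro mult_nonneg_nonneg) auto
    ultimately show ?thesis unfolding eq using qprod_pos qprod_nonneg by presburger
  next
    fix s assume s: "K = q powr s" "b + c \<le> s"
    have eq: "?p4 = (q powr (s - b - c + \<xi>) - q powr 0) * (q powr (s + 1 - c) - q powr (-c + \<xi> - 1))"
      using q_pos s by (simp add: algebra_simps flip: powr_add)
    have "0 < ((s - b - c + \<xi>) - 0) * ((s + 1 - c) - (-c + \<xi> - 1))" if "0 < \<xi>"
      using s assms b_pos c_pos that by (intro mult_pos_pos) auto
    moreover have "0 \<le> ((s - b - c + \<xi>) - 0) * ((s + 1 - c) - (-c + \<xi> - 1))"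
      using s assms b_pos c_pos by (intro mult_nonneg_nonneg) auto
    ultimately show ?thesis unfolding eq using qprod_pos qprod_nonneg by presburger
  qed
  show "0 \<le> numA \<xi> t * numC \<xi> t" unfolding eq
    using mult_nonneg_nonneg[OF mult_nonneg_nonneg[OF n1 n2] mult_nonneg_nonneg[OF n3 conjunct1[OF n4]]] .
  assume st: "0 < \<xi>" "\<xi> < 1 + c" "\<xi> < 1 + t" "\<xi> < 1 + b" "\<xi> < 1 + b + c - t"
  have s1: "0 < ?p1" by (rule qprod_pos) (use assms st in \<open>auto intro!: mult_pos_pos\<close>)
  have s2: "0 < ?p2" by (rule qprod_pos) (use assms st in \<open>auto intro!: mult_pos_pos\<close>)
  have s3: "0 < ?p3" by (rule qprod_pos) (use assms st in \<open>auto intro!: mult_pos_pos\<close>)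
  show "0 < numA \<xi> t * numC \<xi> t" unfolding eq
    using mult_pos_pos[OF mult_pos_pos[OF s1 s2] mult_pos_pos[OF s3]] n4 st by blast
qed

section \<open>The density\<close>

definition reduced_a where "reduced_a t x = - (1 - J t x) * (e1 - J t x) * (1 - nn t * Z x) * (e2 t - Z x)"
definition reduced_b where "reduced_b t x = - (1 - Z x) * (e1 - Z x) * (1 - nn t * J t x) * (e2 t - J t x)"

lemma side_reduced: "side_a t x = q * reduced_a t x" "side_b t x = q * reduced_b t x"
  unfolding side_a_def reduced_a_def side_b_def reduced_b_def by algebra+

lemma powr_relations:
  shows "q powr (-c + \<xi> - 1) = q powr \<xi> * e1" "q powr (\<xi> - t - 1) = q powr \<xi> * e2 t"
    "q powr (-b - c + \<xi> - 2) = q powr \<xi> * (nn t * e1 * e2 t)"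
    "K * q powr (-b - c + \<xi>) = q powr \<xi> * (J t x * Z x) * nn t"
    "q powr (-b + \<xi> - 1) = q powr \<xi> * nn t * e2 t"
    "K * q powr (1 - c) * e2 t = J t x * Z x"
    "q powr (-b - c + 2 * \<xi> - 2) = (q powr \<xi>)\<^sup>2 * (nn t * e1 * e2 t)"
    "K * q powr (- t - c) = J t x * Z x"
    "q powr (\<xi> - b - c - 2) = q powr \<xi> * (nn t * e1 * e2 t)"
proof -
  show "q powr (-c + \<xi> - 1) = q powr \<xi> * e1" "q powr (\<xi> - t - 1) = q powr \<xi> * e2 t"
    "q powr (-b - c + \<xi> - 2) = q powr \<xi> * (nn t * e1 * e2 t)"
    "q powr (-b + \<xi> - 1) = q powr \<xi> * nn t * e2 t"
    "q powr (-b - c + 2 * \<xi> - 2) = (q powr \<xi>)\<^sup>2 * (nn t * e1 * e2 t)"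
    "q powr (\<xi> - b - c - 2) = q powr \<xi> * (nn t * e1 * e2 t)"
    by (simp_all add: e1_def e2_def nn_def algebra_simps power2_eq_square flip: powr_add)
  have JZ: "J t x * Z x = K * q powr (- t - c)"
    using powr_add[of q "x - t - c" "- x"] by (simp add: J_def Z_def)
  then show "K * q powr (- t - c) = J t x * Z x" by simp
  have "q powr (-b - c + \<xi>) = q powr \<xi> * q powr (- t - c) * nn t"
    by (simp add: nn_def algebra_simps flip: powr_add)
  then show "K * q powr (-b - c + \<xi>) = q powr \<xi> * (J t x * Z x) * nn t" unfolding JZ by simp
  have "q powr (1 - c) * e2 t = q powr (- t - c)"
    unfolding e2_def powr_add[symmetric] by (rule arg_cong[of _ _ "(powr) q"]) simp
  then show "K * q powr (1 - c) * e2 t = J t x * Z x" unfolding JZ by (simp add: mult.assoc)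
qed

lemma numA_eq: "numA \<xi> t = (1 - q powr \<xi> * e1) * (1 - q powr \<xi> * e2 t) *
    (1 - q powr \<xi> * (nn t * e1 * e2 t)) * (1 - q powr \<xi> * (J t x * Z x) * nn t)"
  unfolding numA_def powr_relations(1) powr_relations(2) powr_relations(3)[of _ t]
    powr_relations(4)[of _ t x] by simp

lemma numC_eq: "numC \<xi> t = (1 - q powr \<xi>) * (1 - q powr \<xi> * nn t * e2 t) *
    (J t x * Z x - e1 * e2 t * q powr \<xi>) * (1 - q powr \<xi> * nn t * e1)"
  unfolding numC_def powr_relations(1) powr_relations(3)[of _ t] powr_relations(5)[of _ t] e2_def[symmetric]
  using powr_relations(6)[of t x] by algebra

lemma denom_eq: "denom \<xi> = 1 - (q powr \<xi>)\<^sup>2 * (nn t * e1 * e2 t)"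
  unfolding denom_def powr_relations(7)[of _ t] by simp

lemma disc_numerator:
  assumes "denom \<xi> \<noteq> 0" "0 \<le> numA \<xi> t * numC \<xi> t"
  shows "disc b c q \<kappa> \<xi> t x * denom \<xi> ^ 4 = 4 * numA \<xi> t * numC \<xi> t -
    ((Z x - 1) * (1 - J t x) * (denom \<xi>)\<^sup>2 + numA \<xi> t + numC \<xi> t)\<^sup>2"
proof -
  have a: "(coeff_a b c q \<kappa> \<xi> t)\<^sup>2 = numA \<xi> t * numC \<xi> t / denom \<xi> ^ 4"
    using assms by (simp add: coeff_a_def coeff_num real_sqrt_pow2 flip: power_add)
  have "lattice_mu c q \<kappa> t x - coeff_b b c q \<kappa> \<xi> t =
      (Z x - 1) * (1 - J t x) + numA \<xi> t / (denom \<xi>)\<^sup>2 + numC \<xi> t / (denom \<xi>)\<^sup>2"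
    unfolding lattice_mu_def coeff_b_def coeff_num K_def[symmetric] powr_relations(8)[of _ x]
    by (simp add: Z_def J_def algebra_simps)
  also have "\<dots> = ((Z x - 1) * (1 - J t x) * (denom \<xi>)\<^sup>2 + numA \<xi> t + numC \<xi> t) / (denom \<xi>)\<^sup>2"
    using assms by (simp add: field_simps)
  finally show ?thesis
    unfolding disc_def a using assms(1) by (simp add: power_divide left_diff_distrib flip: power_mult)
qed

text \<open>Divided by (Z - J)^2, this is the value of y at which the concave quadratic polynomial
  in y is largest.\<close>

definition vertex where "vertex t x = reduced_a t x + reduced_b t x + (e2 t + nn t * e1) * (Z x - J t x)\<^sup>2"

text \<open>With w = q^\<xi> one has y w = 1 + nn e1 e2 w^2, so the product (1 - e2 w)(1 - nn e1 w)
  in \<open>quartic_identity\<close> is w (y - e2 - nn e1). Every term then carries w^2, and only y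
  is left.\<close>

lemma disc_quadratic:
  assumes "denom \<xi> \<noteq> 0" "0 \<le> numA \<xi> t * numC \<xi> t"
  shows "(Z x - J t x)\<^sup>2 * (denom \<xi>)\<^sup>2 * disc b c q \<kappa> \<xi> t x = (q powr \<xi>)\<^sup>2 *
    (4 * reduced_a t x * reduced_b t x - (vertex t x - (Z x - J t x)\<^sup>2 * lattice_y b c q \<xi>)\<^sup>2)"
proof -
  let ?w = "q powr \<xi>" and ?L = "(Z x - J t x)\<^sup>2"
  have "?L * (disc b c q \<kappa> \<xi> t x * denom \<xi> ^ 4) = (denom \<xi>)\<^sup>2 * (4 * reduced_a t x * reduced_b t x * ?w\<^sup>2 -
      ((reduced_a t x + reduced_b t x) * ?w - (1 - e2 t * ?w) * (1 - nn t * e1 * ?w) * ?L)\<^sup>2)"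
    unfolding disc_numerator[OF assms] 
    by (rule quartic_identity[OF refl refl refl]) 
      (rule denom_eq numA_eq numC_eq reduced_a_def reduced_b_def)+
  then have "(denom \<xi>)\<^sup>2 * (?L * (denom \<xi>)\<^sup>2 * disc b c q \<kappa> \<xi> t x) = (denom \<xi>)\<^sup>2 * (4 * reduced_a t x * reduced_b t x * ?w\<^sup>2 -
      ((reduced_a t x + reduced_b t x) * ?w - (1 - e2 t * ?w) * (1 - nn t * e1 * ?w) * ?L)\<^sup>2)"
    by (simp add: power4_eq_xxxx power2_eq_square algebra_simps)
  then have *: "?L * (denom \<xi>)\<^sup>2 * disc b c q \<kappa> \<xi> t x = 4 * reduced_a t x * reduced_b t x * ?w\<^sup>2 -
      ((reduced_a t x + reduced_b t x) * ?w - (1 - e2 t * ?w) * (1 - nn t * e1 * ?w) * ?L)\<^sup>2"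
    using assms(1) by simp
  have y: "lattice_y b c q \<xi> * ?w = 1 + nn t * e1 * e2 t * ?w\<^sup>2"
    unfolding lattice_y_def powr_relations(9)[of _ t]
    by (simp add: algebra_simps power2_eq_square flip: powr_add) (simp add: powr_add)?
  have h: "(reduced_a t x + reduced_b t x) * ?w - (1 - e2 t * ?w) * (1 - nn t * e1 * ?w) * ?L
      = ?w * (vertex t x - ?L * lattice_y b c q \<xi>)"
  proof -
    have "?w * (vertex t x - ?L * lattice_y b c q \<xi>) = ?w * vertex t x - ?L * (lattice_y b c q \<xi> * ?w)"
      by (simp add: algebra_simps)
    also have "\<dots> = (reduced_a t x + reduced_b t x) * ?w - (1 - e2 t * ?w) * (1 - nn t * e1 * ?w) * ?L"
      unfolding y vertex_def by algebra
    finally show ?thesis by simp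
  qed
  show ?thesis unfolding * h by algebra
qed

text \<open>The bound (b + c + 2)/2 is the centre of the reflection of \<xi> that preserves y; it is
  also the zero of \<open>denom\<close>.\<close>

lemma y_decreasing:
  assumes "\<xi> < \<eta>" "\<eta> \<le> (b + c + 2) / 2"
  shows "lattice_y b c q \<eta> < lattice_y b c q \<xi>"
proof -
  have "lattice_y b c q \<xi> - lattice_y b c q \<eta> =
      (q powr (-\<xi>) - q powr (-\<eta>)) * (q powr 0 - q powr (\<xi> + \<eta> - b - c - 2))"
    by (simp add: lattice_y_def algebra_simps flip: powr_add)
  also have "\<dots> > 0"
  proof (rule qprod_pos)
    show "0 < (- \<xi> - - \<eta>) * (0 - (\<xi> + \<eta> - b - c - 2))"
      by (rule mult_pos_pos) (use assms in auto)
  qed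
  finally show ?thesis by simp
qed

text \<open>The reflection of \<xi> exchanges 1 + t with 1 + b + c - t and 1 + b with 1 + c. So the
  four possible upper ends of the range of \<xi> give only two values of y.\<close>

lemma y_at_edges:
  "lattice_y b c q (1 + t) = e2 t + nn t * e1"
  "lattice_y b c q (1 + b + c - t) = e2 t + nn t * e1"
  "lattice_y b c q (1 + c) = e1 + nn t * e2 t"
  "lattice_y b c q (1 + b) = e1 + nn t * e2 t"
proof -
  have n: "nn t * e1 = q powr (t - b - c - 1)" "nn t * e2 t = q powr (-b - 1)"
    unfolding nn_def e1_def e2_def powr_add[symmetric] by (rule arg_cong[of _ _ "(powr) q"]; simp)+
  note cong = arg_cong2[of _ _ _ _ "(+)"] arg_cong[of _ _ "(powr) q"]
  show "lattice_y b c q (1 + t) = e2 t + nn t * e1" "lattice_y b c q (1 + c) = e1 + nn t * e2 t"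
    unfolding n unfolding lattice_y_def e1_def e2_def by (intro cong; simp)+
  show "lattice_y b c q (1 + b + c - t) = e2 t + nn t * e1" "lattice_y b c q (1 + b) = e1 + nn t * e2 t"
    unfolding n unfolding lattice_y_def e1_def e2_def
    by (subst add.commute, (intro cong; simp))+
qed

lemma solutions_characterized:
  assumes ins: "inside t x"
  defines "r \<equiv> sqrt (reduced_a t x * reduced_b t x)" and "l2 \<equiv> (Z x - J t x)\<^sup>2"
  defines "end \<equiv> 1 + Min {t, b, c, b + c - t}"
  shows "solutions_xi b c q \<kappa> t x = {\<xi> \<in> {0..end}. 
     lattice_y b c q \<xi> = (vertex t x - 2 * r) / l2 \<or> lattice_y b c q \<xi> = (vertex t x + 2 * r) / l2}"
proof -
  note ib = inside_bounds[OF ins]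
  have tab: "0 < reduced_a t x" "0 < reduced_b t x" using inside_pos[OF ins] q_pos by (simp_all add: side_reduced zero_less_mult_iff)
  have l2: "l2 > 0" using inside_pos(4)[OF ins] by (simp add: l2_def)
  have r: "r\<^sup>2 = reduced_a t x * reduced_b t x" using tab by (simp add: r_def)
  have root: "4 * reduced_a t x * reduced_b t x - (vertex t x - l2 * y)\<^sup>2 = 0 \<longleftrightarrow>
      y = (vertex t x - 2 * r) / l2 \<or> y = (vertex t x + 2 * r) / l2" for y
  proof -
    have "4 * reduced_a t x * reduced_b t x - (vertex t x - l2 * y)\<^sup>2 = - (l2 * y - (vertex t x - 2 * r)) * (l2 * y - (vertex t x + 2 * r))"
      using r by algebra
    then have "4 * reduced_a t x * reduced_b t x - (vertex t x - l2 * y)\<^sup>2 = 0 \<longleftrightarrow>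
        l2 * y = vertex t x - 2 * r \<or> l2 * y = vertex t x + 2 * r"
      by (simp only: mult_eq_0_iff neg_equal_0_iff_equal right_minus_eq)
    then show ?thesis using l2 by (simp add: eq_divide_eq mult.commute)
  qed
  have "denom \<xi> ^ 4 * disc b c q \<kappa> \<xi> t x = 0 \<longleftrightarrow>
      lattice_y b c q \<xi> = (vertex t x - 2 * r) / l2 \<or> lattice_y b c q \<xi> = (vertex t x + 2 * r) / l2"
    if xi: "\<xi> \<in> {0..end}" for \<xi>
  proof (cases "denom \<xi> = 0")
    case False
    have "0 \<le> numA \<xi> t * numC \<xi> t"
      by (rule numAC_sign) (use xi ib in \<open>auto simp: end_def\<close>)
    have "l2 * (denom \<xi>)\<^sup>2 * disc b c q \<kappa> \<xi> t x = 0 \<longleftrightarrow>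
        4 * reduced_a t x * reduced_b t x - (vertex t x - l2 * lattice_y b c q \<xi>)\<^sup>2 = 0"
      unfolding l2_def disc_quadratic[OF False \<open>0 \<le> numA \<xi> t * numC \<xi> t\<close>, of x] by simp
    then show ?thesis using False l2 unfolding root by simp
  next
    case True
    \<comment> \<open>The degenerate case b = c = t at the upper end of the range. The equation
      cleared of denominators holds trivially there, so it has to be checked that y takes one of the
      two root values: now \<open>reduced_a\<close> = \<open>reduced_b\<close>, and it is the
      smaller root.\<close>
    then have "q powr (-b - c + 2 * \<xi> - 2) = q powr 0" by (simp add: denom_def)
    then have "-b - c + 2 * \<xi> - 2 = 0"
      using qdiff[of 0 "-b - c + 2 * \<xi> - 2"] qdiff[of "-b - c + 2 * \<xi> - 2" 0] by (cases "-b - c + 2 * \<xi> - 2" "0 :: real" rule: linorder_cases) auto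
    with xi have bct: "b = c" "t = c" "\<xi> = 1 + c" by (auto simp: end_def)
    have n: "nn t = 1" "e2 t = e1" unfolding nn_def e1_def e2_def using bct by simp_all
    have ab: "reduced_a t x = reduced_b t x" unfolding reduced_a_def reduced_b_def n by algebra
    then have "r = reduced_a t x" using tab by (simp add: r_def)
    moreover have "lattice_y b c q \<xi> = e2 t + nn t * e1"
      using y_at_edges(1)[of t] bct(2,3) by simp
    ultimately have "lattice_y b c q \<xi> = (vertex t x - 2 * r) / l2"
      using l2 by (simp add: vertex_def ab l2_def[symmetric])
    then show ?thesis using True by simp
  qed
  then show ?thesis unfolding solutions_xi_def denom_def[symmetric] end_def by blast
qed

text \<open>At the ends of the range of \<open>\<xi>\<close> the distance of \<open>y(\<xi>)\<close> to the vertex of the quadratic polynomial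
  is a sum of two products of positive factors whose product is the discriminant, so that the
  inequality of arithmetic and geometric means puts both roots inside the range.\<close>

lemma xi_values:
  assumes ins: "inside t x"
  defines "r \<equiv> sqrt (reduced_a t x * reduced_b t x)" and "l2 \<equiv> (Z x - J t x)\<^sup>2"
  defines "l \<equiv> xi_minus b c q \<kappa> t x" and "u \<equiv> xi_plus b c q \<kappa> t x"
  shows "0 \<le> l" "l < u" "u \<le> (b + c + 2) / 2"
    "lattice_y b c q l = (vertex t x + 2 * r) / l2" "lattice_y b c q u = (vertex t x - 2 * r) / l2"
    "0 < r" "0 < l2"
proof -
  define e where "e = 1 + Min {t, b, c, b + c - t}"
  note ib = inside_bounds[OF ins]
  have tab: "0 < reduced_a t x" "0 < reduced_b t x" using inside_pos[OF ins] q_pos by (simp_all add: side_reduced zero_less_mult_iff)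
  show l2: "l2 > 0" using inside_pos(4)[OF ins] by (simp add: l2_def)
  show r0: "0 < r" using tab by (simp add: r_def)
  have e: "0 \<le> e" "e \<le> (b + c + 2) / 2" "e \<le> 1 + t" "e \<le> 1 + b" "e \<le> 1 + c" "e \<le> 1 + b + c - t"
    using ib b_pos c_pos by (auto simp: e_def min_def field_simps)
  obtain \<tau> where "0 < \<tau> * (1 - J t x)" "0 < \<tau> * (e1 - J t x)"
    "0 < \<tau> * (1 - nn t * J t x)" "0 < \<tau> * (e2 t - J t x)" using J_signs ib by metis
  note Js = pos_of_signs[OF this(1) this(3)] pos_of_signs[OF this(2) this(4)]
    pos_of_signs[OF this(1) this(4)] pos_of_signs[OF this(2) this(3)]
  have "0 < ln q * (1 - Z x)" "0 < ln q * (Z x - e1)" "0 < ln q * (1 - nn t * Z x)" "0 < ln q * (Z x - e2 t)"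
    using Z_signs ib by auto
  note Zs = pos_of_signs[OF this(2) this(4)] pos_of_signs[OF this(1) this(3)]
    pos_of_signs[OF this(2) this(3)] pos_of_signs[OF this(1) this(4)]
  have y0: "(vertex t x + 2 * r) / l2 \<le> lattice_y b c q 0"
  proof -
    let ?P = "((1 - J t x) * (1 - nn t * J t x)) * ((Z x - e1) * (Z x - e2 t))"
    let ?Q = "((1 - Z x) * (1 - nn t * Z x)) * ((e1 - J t x) * (e2 t - J t x))"
    have "0 \<le> ?P" "0 \<le> ?Q" using Js Zs by (auto intro!: mult_nonneg_nonneg less_imp_le)
    then have "sqrt (?P * ?Q) \<le> (?P + ?Q) / 2" by (rule arith_geo_mean_sqrt)
    moreover have "?P * ?Q = reduced_a t x * reduced_b t x" unfolding reduced_a_def reduced_b_def by algebra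
    moreover have "lattice_y b c q 0 = 1 + nn t * e1 * e2 t"
      using powr_relations(9)[of 0 t] by (simp add: lattice_y_def)
    moreover have "l2 * (1 + nn t * e1 * e2 t) - vertex t x = ?P + ?Q"
      unfolding vertex_def reduced_a_def reduced_b_def l2_def by algebra
    ultimately show ?thesis using l2 by (simp add: r_def field_simps)
  qed
  have ye: "lattice_y b c q e \<le> (vertex t x - 2 * r) / l2"
  proof -
    have "e = 1 + t \<or> e = 1 + b + c - t \<or> e = 1 + b \<or> e = 1 + c"
      by (auto simp: e_def min_def)
    then consider "lattice_y b c q e = e2 t + nn t * e1" | "lattice_y b c q e = e1 + nn t * e2 t"
      using y_at_edges[of t] by metis
    then show ?thesis
    proof cases
      case 1
      have "sqrt (reduced_a t x * reduced_b t x) \<le> (reduced_a t x + reduced_b t x) / 2"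
        using tab by (intro arith_geo_mean_sqrt) auto
      then show ?thesis using l2 unfolding 1 by (simp add: r_def vertex_def field_simps l2_def[symmetric])
    next
      case 2
      let ?P = "((1 - J t x) * (e2 t - J t x)) * ((Z x - e1) * (1 - nn t * Z x))"
      let ?Q = "((1 - Z x) * (Z x - e2 t)) * ((e1 - J t x) * (1 - nn t * J t x))"
      have "0 \<le> ?P" "0 \<le> ?Q" using Js Zs by (auto intro!: mult_nonneg_nonneg less_imp_le)
      then have "sqrt (?P * ?Q) \<le> (?P + ?Q) / 2" by (rule arith_geo_mean_sqrt)
      moreover have "?P * ?Q = reduced_a t x * reduced_b t x" unfolding reduced_a_def reduced_b_def by algebra
      moreover have "vertex t x - l2 * (e1 + nn t * e2 t) = ?P + ?Q"
        unfolding vertex_def reduced_a_def reduced_b_def l2_def by algebra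
      ultimately show ?thesis using l2 unfolding 2 by (simp add: r_def field_simps)
    qed
  qed
  have lohi: "(vertex t x - 2 * r) / l2 < (vertex t x + 2 * r) / l2" using r0 l2 by (simp add: divide_strict_right_mono)
  have cont: "continuous_on {0..e} (lattice_y b c q)"
    unfolding lattice_y_def by (intro continuous_intros) auto
  obtain p where p: "0 \<le> p" "p \<le> e" "lattice_y b c q p = (vertex t x + 2 * r) / l2"
    using IVT2'[OF _ _ e(1) cont, of "(vertex t x + 2 * r) / l2"] ye lohi y0 by auto
  obtain p' where p': "0 \<le> p'" "p' \<le> e" "lattice_y b c q p' = (vertex t x - 2 * r) / l2"
    using IVT2'[OF _ _ e(1) cont, of "(vertex t x - 2 * r) / l2"] ye lohi y0 by auto
  have inj: "\<xi> = \<eta>" if "lattice_y b c q \<xi> = lattice_y b c q \<eta>" "\<xi> \<le> e" "\<eta> \<le> e" for \<xi> \<eta>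
    using y_decreasing[of \<xi> \<eta>] y_decreasing[of \<eta> \<xi>] that e
    by (cases \<xi> \<eta> rule: linorder_cases) auto
  have pp': "p < p'"
    using y_decreasing[of p' p] p p' lohi e
    by (cases p p' rule: linorder_cases) auto
  have "solutions_xi b c q \<kappa> t x = {p, p'}"
    unfolding solutions_characterized[OF ins] r_def[symmetric] l2_def[symmetric] e_def[symmetric]
    using p p' inj by auto
  then have "l = p" "u = p'" unfolding l_def u_def xi_minus_def xi_plus_def
    using pp' by (simp_all add: cInf_eq_Min cSup_eq_Max)
  then show "0 \<le> l" "l < u" "u \<le> (b + c + 2) / 2"
    "lattice_y b c q l = (vertex t x + 2 * r) / l2" "lattice_y b c q u = (vertex t x - 2 * r) / l2"
    using p p' pp' e by auto
qed

text \<open>Law of cosines; the digit names the vertex. The side opposite to 1 is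
  \<open>side_v\<close>, the side opposite to 0 is \<open>side_b\<close>.\<close>

definition cosine1 where "cosine1 t x = (side_a t x + side_b t x - side_v t x) / (2 * sqrt (side_a t x * side_b t x))"
definition cosine0 where "cosine0 t x = (side_a t x + side_v t x - side_b t x) / (2 * sqrt (side_a t x * side_v t x))"
definition angle1 where "angle1 t x = clamped_arccos (cosine1 t x)"
definition angle0 where "angle0 t x = clamped_arccos (cosine0 t x)"

text \<open>The argument of arccos in \<open>density\<close> is the position of y(1) relative to the
  midpoint of the two roots, in units of half their distance, and equals \<open>- cosine1\<close>.
  As y decreases, the branches with densities 1 and 0 say that this position is at most -1 or at
  least 1, where the clamped arccosine takes the same values.\<close>

lemma density_eq:
  assumes ins: "inside t x"
  shows "density b c q \<kappa> t x = 1 - angle1 t x / pi"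
proof -
  define r where "r = sqrt (reduced_a t x * reduced_b t x)"
  define l2 where "l2 = (Z x - J t x)\<^sup>2"
  define l where "l = xi_minus b c q \<kappa> t x"
  define u where "u = xi_plus b c q \<kappa> t x"
  define y where "y = lattice_y b c q"
  note v = xi_values[OF ins, folded r_def l2_def l_def u_def y_def]
  have ev: "side_v t x = q * (l2 * ((1 - e2 t * q) * (1 - nn t * e1 * q) / q))" by (simp add: side_v_def l2_def)
  have y1: "y 1 = 1 / q + nn t * e1 * e2 t * q" 
    unfolding y_def lattice_y_def powr_relations(9)[of _ t] using q_pos by (simp add: powr_minus_divide)
  have vq: "(1 - e2 t * q) * (1 - nn t * e1 * q) / q = y 1 - e2 t - nn t * e1"
    unfolding y1 using q_pos by (simp add: field_simps power2_eq_square)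
  then have side_v: "side_v t x = q * (l2 * (y 1 - e2 t - nn t * e1))" unfolding ev vq by simp
  have srt: "sqrt (side_a t x * side_b t x) = q * r"
    using q_pos by (simp add: side_reduced r_def real_sqrt_mult)
  have g: "- cosine1 t x = (l2 * y 1 - vertex t x) / (2 * r)"
    unfolding cosine1_def srt unfolding side_reduced side_v vertex_def l2_def[symmetric] using q_pos v by (simp add: field_simps)
  have d: "y l - y u = 4 * r / l2" unfolding v(4,5) using v by (simp add: field_simps)
  have g': "(2 * y 1 - y l - y u) / \<bar>y l - y u\<bar> = - cosine1 t x"
    unfolding g d v(4,5) using v by (simp add: field_simps)
  have lt1: "l < 1 \<longleftrightarrow> y 1 < y l"
  proof
    show "l < 1 \<Longrightarrow> y 1 < y l" unfolding y_def using y_decreasing[of l 1] b_pos c_pos by simp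
    show "y 1 < y l \<Longrightarrow> l < 1"
      unfolding y_def using y_decreasing[of 1 l] v(2,3) by (cases l "1 :: real" rule: linorder_cases) auto
  qed
  have gt1: "1 < u \<longleftrightarrow> y u < y 1"
  proof
    show "1 < u \<Longrightarrow> y u < y 1" unfolding y_def using y_decreasing[of 1 u] v(3) by simp
    show "y u < y 1 \<Longrightarrow> 1 < u"
      unfolding y_def using y_decreasing[of u 1] b_pos c_pos
      by (cases u "1 :: real" rule: linorder_cases) auto
  qed
  have lt1': "l < 1 \<longleftrightarrow> - cosine1 t x < 1" unfolding lt1 v(4) g using v(6,7) by (simp add: field_simps)
  have gt1': "1 < u \<longleftrightarrow> - cosine1 t x > -1" unfolding gt1 v(5) g using v(6,7) by (simp add: field_simps)
  have "density b c q \<kappa> t x = clamped_arccos (- cosine1 t x) / pi"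
  proof -
    consider "- cosine1 t x \<le> -1" | "- cosine1 t x \<ge> 1" | "-1 < - cosine1 t x" "- cosine1 t x < 1" by linarith
    then show ?thesis
    proof cases
      case 1
      then have "u \<le> 1" using gt1' by linarith
      then show ?thesis using 1 v(2) 
        by (simp add: density_def Let_def l_def[symmetric] u_def[symmetric] clamped_arccos_def)
    next
      case 2
      then have "1 \<le> l" using lt1' by linarith
      then show ?thesis using 2 v(2)
        by (simp add: density_def Let_def l_def[symmetric] u_def[symmetric] clamped_arccos_def)
    next
      case 3
      then have "l < 1" "1 < u" using gt1' lt1' by auto
      then show ?thesis using 3 v(2) g'
        by (simp add: density_def Let_def l_def[symmetric] u_def[symmetric] y_def[symmetric] clamped_arccos_def)
    qed
  qed
  then show ?thesis by (simp add: clamped_arccos_uminus angle1_def diff_divide_distrib)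
qed

section \<open>The Burgers equation for the apex\<close>

lemma DERIV_qpowr [derivative_intros]:
  assumes "(f has_real_derivative f') (at x within S)"
  shows "((\<lambda>x. q powr f x) has_real_derivative ln q * q powr f x * f') (at x within S)"
  unfolding powr_def using assms q_pos by (auto intro!: derivative_eq_intros)

lemma DERIV_atoms:
  "((\<lambda>x. Z x) has_real_derivative - ln q * Z x) (at x)"
  "((\<lambda>x. J t x) has_real_derivative ln q * J t x) (at x)"
  "((\<lambda>t. J t x) has_real_derivative - ln q * J t x) (at t)"
  "((\<lambda>t. e2 t) has_real_derivative - ln q * e2 t) (at t)"
  "((\<lambda>t. nn t) has_real_derivative ln q * nn t) (at t)"
  unfolding Z_def J_def e2_def nn_def by (auto intro!: derivative_eq_intros)

text \<open>The derivatives of the sides divided by ln q, so that relations between them are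
  polynomial identities.\<close>

definition side_a_x where "side_a_x t x = - q * ((1 - nn t * Z x) * (e2 t - Z x) * (- J t x * (e1 - J t x) - J t x * (1 - J t x))
    + (1 - J t x) * (e1 - J t x) * (nn t * Z x * (e2 t - Z x) + Z x * (1 - nn t * Z x)))"
definition side_a_t where "side_a_t t x = - q * ((1 - nn t * Z x) * (e2 t - Z x) * (J t x * (e1 - J t x) + J t x * (1 - J t x))
    + (1 - J t x) * (e1 - J t x) * (- nn t * Z x * (e2 t - Z x) - e2 t * (1 - nn t * Z x)))"
definition side_b_x where "side_b_x t x = - q * ((1 - nn t * J t x) * (e2 t - J t x) * (Z x * (e1 - Z x) + Z x * (1 - Z x))
    + (1 - Z x) * (e1 - Z x) * (- nn t * J t x * (e2 t - J t x) - J t x * (1 - nn t * J t x)))"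
definition side_v_x where "side_v_x t x = - 2 * (1 - e2 t * q) * (1 - nn t * e1 * q) * (Z x - J t x) * (Z x + J t x)"
definition side_v_t where "side_v_t t x = (e2 t * q * (1 - nn t * e1 * q) - nn t * e1 * q * (1 - e2 t * q)) * (Z x - J t x)\<^sup>2
    + 2 * (1 - e2 t * q) * (1 - nn t * e1 * q) * (Z x - J t x) * J t x"

lemma DERIV_sides:
  "((\<lambda>x. side_a t x) has_real_derivative ln q * side_a_x t x) (at x)"
  "((\<lambda>t. side_a t x) has_real_derivative ln q * side_a_t t x) (at t)"
  "((\<lambda>x. side_b t x) has_real_derivative ln q * side_b_x t x) (at x)"
  "((\<lambda>t. side_b t x) has_real_derivative - ln q * side_b t x) (at t)"
  "((\<lambda>x. side_v t x) has_real_derivative ln q * side_v_x t x) (at x)"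
  "((\<lambda>t. side_v t x) has_real_derivative ln q * side_v_t t x) (at t)"
proof -
  show "((\<lambda>x. side_a t x) has_real_derivative ln q * side_a_x t x) (at x)"
    unfolding side_a_def by (rule derivative_eq_intros DERIV_atoms refl)+ (unfold side_a_x_def, algebra)
  show "((\<lambda>t. side_a t x) has_real_derivative ln q * side_a_t t x) (at t)"
    unfolding side_a_def by (rule derivative_eq_intros DERIV_atoms refl)+ (unfold side_a_t_def, algebra)
  show "((\<lambda>x. side_b t x) has_real_derivative ln q * side_b_x t x) (at x)"
    unfolding side_b_def by (rule derivative_eq_intros DERIV_atoms refl)+ (unfold side_b_x_def, algebra)
  show "((\<lambda>t. side_b t x) has_real_derivative - ln q * side_b t x) (at t)"
    unfolding side_b_def by (rule derivative_eq_intros DERIV_atoms refl)+ algebra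
  show "((\<lambda>x. side_v t x) has_real_derivative ln q * side_v_x t x) (at x)"
    unfolding side_v_def power2_eq_square by (rule derivative_eq_intros DERIV_atoms refl)+ (unfold side_v_x_def, algebra)
  show "((\<lambda>t. side_v t x) has_real_derivative ln q * side_v_t t x) (at t)"
    unfolding side_v_def power2_eq_square by (rule derivative_eq_intros DERIV_atoms refl)+ (unfold side_v_t_def power2_eq_square, algebra)
qed

text \<open>The hypotheses of \<open>burgers_algebra\<close> for \<beta> = - ln q and l = - ln q (Z
  + J)/(Z - J), with ln q cancelled and Z - J cleared.\<close>

lemma side_relations:
  "side_a_x t x + side_a_t t x = - side_a t x"
  "side_v_x t x * (Z x - J t x) = - 2 * (Z x + J t x) * side_v t x"
  "(side_b_x t x - side_a_x t x - side_v t x - side_v_t t x) * (Z x - J t x) = (side_a t x - side_b t x - side_v t x) * (Z x + J t x)"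
  unfolding side_a_def side_b_def side_v_def side_a_x_def side_a_t_def side_b_x_def side_v_x_def side_v_t_def by algebra+

definition slope where "slope t x = apex (side_a t x) (side_b t x) (side_v t x)"

definition slope_x where
  "slope_x t x = - (of_real (ln q * side_a_x t x) * slope t x * (slope t x - 1) +
      of_real (ln q * side_v_x t x) * (1 - slope t x) + of_real (ln q * side_b_x t x) * slope t x) /
    (2 * of_real (side_a t x) * slope t x - of_real (side_a t x + side_v t x - side_b t x))"

definition slope_t where
  "slope_t t x = - (of_real (ln q * side_a_t t x) * slope t x * (slope t x - 1) +
      of_real (ln q * side_v_t t x) * (1 - slope t x) + of_real (- ln q * side_b t x) * slope t x) /
    (2 * of_real (side_a t x) * slope t x - of_real (side_a t x + side_v t x - side_b t x))"

definition liquid where "liquid t x \<longleftrightarrow> inside t x \<and> heron t x > 0"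

lemma continuous_sides:
  "continuous_on UNIV (\<lambda>p. side_a (fst p) (snd p))" "continuous_on UNIV (\<lambda>p. side_b (fst p) (snd p))"
  "continuous_on UNIV (\<lambda>p. side_v (fst p) (snd p))" "continuous_on UNIV (\<lambda>p. heron (fst p) (snd p))"
  unfolding heron_def side_a_def side_b_def side_v_def Z_def J_def e2_def nn_def
  by (intro continuous_intros; simp)+

lemma open_inside: "open {p. inside (fst p) (snd p)}"
  unfolding inside_def by (intro open_Collect_conj open_Collect_less continuous_intros)

lemma open_liquid: "open {p. liquid (fst p) (snd p)}"
  unfolding liquid_def
  by (intro open_Collect_conj open_inside open_Collect_less continuous_intros continuous_sides)

lemma eventually_liquid:
  assumes "liquid t x"
  shows "\<forall>\<^sub>F u in nhds x. liquid t u" "\<forall>\<^sub>F s in nhds t. liquid s x"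
proof -
  have "open ((\<lambda>u. (t, u)) -` {p. liquid (fst p) (snd p)})" "open ((\<lambda>s. (s, x)) -` {p. liquid (fst p) (snd p)})"
    by (intro open_vimage open_liquid continuous_intros)+
  then show "\<forall>\<^sub>F u in nhds x. liquid t u" "\<forall>\<^sub>F s in nhds t. liquid s x"
    using assms by (auto dest: eventually_nhds_in_open)
qed

lemma liquid_pos:
  assumes "liquid t x"
  shows "side_a t x > 0" "side_b t x > 0" "side_v t x > 0" "4 * side_a t x * side_b t x - (side_a t x + side_b t x - side_v t x)\<^sup>2 > 0"
  using assms inside_pos unfolding liquid_def heron_def by auto

lemma slope_derivatives:
  assumes "liquid t x"
  shows "((\<lambda>u. slope t u) has_vector_derivative slope_x t x) (at x)"
    "((\<lambda>s. slope s x) has_vector_derivative slope_t t x) (at t)"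
proof -
  have "\<forall>\<^sub>F u in nhds x. side_a t u > 0 \<and> side_b t u > 0 \<and> side_v t u > 0 \<and> 4 * side_a t u * side_b t u - (side_a t u + side_b t u - side_v t u)\<^sup>2 > 0"
    using eventually_liquid(1)[OF assms] by eventually_elim (use liquid_pos in blast)
  from apex_has_derivative[OF DERIV_sides(1,3,5) this]
  show "((\<lambda>u. slope t u) has_vector_derivative slope_x t x) (at x)"
    unfolding slope_x_def slope_def .
  have "\<forall>\<^sub>F s in nhds t. side_a s x > 0 \<and> side_b s x > 0 \<and> side_v s x > 0 \<and> 4 * side_a s x * side_b s x - (side_a s x + side_b s x - side_v s x)\<^sup>2 > 0"
    using eventually_liquid(2)[OF assms] by eventually_elim (use liquid_pos in blast)
  from apex_has_derivative[OF DERIV_sides(2,4,6) this]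
  show "((\<lambda>s. slope s x) has_vector_derivative slope_t t x) (at t)"
    unfolding slope_t_def slope_def .
qed

lemma slope_nonzero:
  assumes "liquid t x"
  shows "Im (slope t x) > 0" "slope t x \<noteq> 0" "1 - slope t x \<noteq> 0"
    "slope t x \<notin> \<real>\<^sub>\<le>\<^sub>0" "1 - slope t x \<notin> \<real>\<^sub>\<le>\<^sub>0"
proof -
  show im: "Im (slope t x) > 0" using apex_props(1)[OF liquid_pos[OF assms]] by (simp add: slope_def)
  then have "Im (1 - slope t x) \<noteq> 0" by simp
  then show "slope t x \<noteq> 0" "1 - slope t x \<noteq> 0" "slope t x \<notin> \<real>\<^sub>\<le>\<^sub>0" "1 - slope t x \<notin> \<real>\<^sub>\<le>\<^sub>0"
    using im by (auto simp: complex_nonpos_Reals_iff)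
qed

lemma slope_burgers:
  assumes "liquid t x"
  shows "slope_x t x / slope t x - slope_t t x / (1 - slope t x) =
    of_real (- ln q * ((Z x + J t x) / (Z x - J t x)))"
  unfolding slope_x_def slope_t_def
proof (rule burgers_algebra[where \<beta> = "- ln q"])
  note p = liquid_pos[OF assms]
  have L: "Z x - J t x \<noteq> 0" using assms inside_pos(4) by (simp add: liquid_def)
  let ?r = "(Z x + J t x) / (Z x - J t x)"
  show "of_real (side_a t x) * slope t x * (slope t x - 1) + of_real (side_v t x) * (1 - slope t x) + of_real (side_b t x) * slope t x = 0"
    unfolding slope_def by (rule apex_props(4)[OF p])
  show "slope t x \<noteq> 0" "1 - slope t x \<noteq> 0" using slope_nonzero[OF assms] by auto
  show "2 * of_real (side_a t x) * slope t x - of_real (side_a t x + side_v t x - side_b t x) \<noteq> (0::complex)"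
    unfolding slope_def apex_props(5)[OF p] using real_sqrt_gt_zero[OF p(4)]
    by (simp del: real_sqrt_eq_zero_cancel_iff real_sqrt_gt_0_iff)
  have side_v_x: "side_v_x t x = - 2 * ?r * side_v t x"
    using side_relations(2)[of t x] L by (simp add: field_simps)
  show "ln q * side_v_x t x = 2 * (- ln q * ?r) * side_v t x"
    unfolding side_v_x by (simp only: mult_minus_left mult_minus_right mult.assoc mult.left_commute)
  show "- ln q * side_b t x = - ln q * side_b t x" ..
  show "ln q * side_a_x t x + ln q * side_a_t t x = - ln q * side_a t x"
    using side_relations(1)[of t x] by (simp flip: distrib_left)
  have "side_b_x t x - side_a_x t x - side_v t x - side_v_t t x = (side_a t x - side_b t x - side_v t x) * ?r"
    using side_relations(3)[of t x] L by (simp add: field_simps)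
  then have "ln q * (side_b_x t x - side_a_x t x - side_v t x - side_v_t t x) = ln q * ((side_a t x - side_b t x - side_v t x) * ?r)" by simp
  then show "side_a t x * (- ln q * ?r) - ln q * side_a_x t x + ln q * side_b_x t x - side_b t x * (- ln q * ?r) + - ln q * side_v t x -
      ln q * side_v_t t x - side_v t x * (- ln q * ?r) = 0"
    by (simp only: algebra_simps)
qed

lemma angles_as_Ln:
  assumes "liquid t x"
  shows "angle0 t x = Im (Ln (slope t x))" "angle1 t x = - Im (Ln (1 - slope t x))"
  using apex_props(6,7)[OF liquid_pos[OF assms]]
  by (simp_all add: angle0_def angle1_def cosine0_def cosine1_def slope_def)

definition angle_rate where "angle_rate t x = Im (slope_x t x / slope t x)"

text \<open>This is the imaginary part of the Burgers equation.\<close>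

lemma angles_closed:
  assumes "liquid t x"
  shows "((\<lambda>u. angle0 t u) has_real_derivative angle_rate t x) (at x)"
    "((\<lambda>s. angle1 s x) has_real_derivative angle_rate t x) (at t)"
proof -
  note nz = slope_nonzero[OF assms]
  have "((Ln \<circ> (\<lambda>u. slope t u)) has_vector_derivative slope_x t x * inverse (slope t x)) (at x)"
    by (rule field_vector_diff_chain_at[OF slope_derivatives(1)[OF assms] has_field_derivative_Ln[OF nz(4)]])
  from bounded_linear.has_vector_derivative[OF bounded_linear_Im this]
  have d: "((\<lambda>u. Im (Ln (slope t u))) has_real_derivative angle_rate t x) (at x)"
    by (simp add: has_real_derivative_iff_has_vector_derivative angle_rate_def divide_inverse)
  show "((\<lambda>u. angle0 t u) has_real_derivative angle_rate t x) (at x)"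
    by (rule DERIV_cong_ev[THEN iffD2, OF refl _ refl d])
      (use eventually_liquid(1)[OF assms] in \<open>eventually_elim, simp add: angles_as_Ln\<close>)
  have "((\<lambda>s. 1 - slope s x) has_vector_derivative 0 - slope_t t x) (at t)"
    by (intro has_vector_derivative_diff has_vector_derivative_const slope_derivatives(2)[OF assms])
  from field_vector_diff_chain_at[OF this has_field_derivative_Ln[OF nz(5)]]
  have "((Ln \<circ> (\<lambda>s. 1 - slope s x)) has_vector_derivative (0 - slope_t t x) * inverse (1 - slope t x)) (at t)" .
  from bounded_linear.has_vector_derivative[OF bounded_linear_Im this]
  have "((\<lambda>s. Im (Ln (1 - slope s x))) has_real_derivative - Im (slope_t t x / (1 - slope t x))) (at t)"
    by (simp add: has_real_derivative_iff_has_vector_derivative divide_inverse)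
  from DERIV_minus[OF this]
  have "((\<lambda>s. - Im (Ln (1 - slope s x))) has_real_derivative Im (slope_t t x / (1 - slope t x))) (at t)" by simp
  moreover have "Im (slope_t t x / (1 - slope t x)) = angle_rate t x"
    using arg_cong[OF slope_burgers[OF assms], of Im] by (simp add: angle_rate_def)
  ultimately have d: "((\<lambda>s. - Im (Ln (1 - slope s x))) has_real_derivative angle_rate t x) (at t)" by simp
  show "((\<lambda>s. angle1 s x) has_real_derivative angle_rate t x) (at t)"
    by (rule DERIV_cong_ev[THEN iffD2, OF refl _ refl d])
      (use eventually_liquid(2)[OF assms] in \<open>eventually_elim, simp add: angles_as_Ln\<close>)
qed

lemma complex_slope_eq:
  assumes "liquid t x" "rho_I b c q \<kappa> t x = angle0 t x" "rho_III b c q \<kappa> t x = angle1 t x"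
  shows "complex_slope b c q \<kappa> t x = slope t x"
proof -
  note p = apex_props[OF liquid_pos[OF assms(1)], folded slope_def]
  have II: "rho_II b c q \<kappa> t x = pi - rho_I b c q \<kappa> t x - rho_III b c q \<kappa> t x"
    by (simp add: rho_I_def rho_II_def rho_III_def)
  have a1: "angle_at 0 1 (slope t x) = rho_I b c q \<kappa> t x" "angle_at 1 0 (slope t x) = rho_III b c q \<kappa> t x"
    using p(8,9) assms(2,3) by (simp_all add: angle0_def angle1_def cosine0_def cosine1_def)
  show ?thesis unfolding complex_slope_def
  proof (rule the_equality)
    show "0 < Im (slope t x) \<and> angle_at 0 1 (slope t x) = rho_I b c q \<kappa> t x \<and>
       angle_at 1 0 (slope t x) = rho_III b c q \<kappa> t x \<and> angle_at (slope t x) 0 1 = rho_II b c q \<kappa> t x"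
      using triangle_angle_sum[OF p(1)] p(1) by (simp add: a1 II)
  next
    fix z assume "0 < Im z \<and> angle_at 0 1 z = rho_I b c q \<kappa> t x \<and>
       angle_at 1 0 z = rho_III b c q \<kappa> t x \<and> angle_at z 0 1 = rho_II b c q \<kappa> t x"
    then show "z = slope t x" using triangle_angles_unique[OF p(1), of z] by (simp add: a1)
  qed
qed

section \<open>The height function along a time slice\<close>

definition lower_edge where "lower_edge t = max 0 (t - b)"

lemma inside_iff: "inside t x \<longleftrightarrow> 0 < t \<and> t < b + c \<and> lower_edge t < x \<and> x < 1 + min t c"
  by (simp add: inside_def lower_edge_def)

lemma inside_between: "inside t x \<Longrightarrow> lower_edge t < u \<Longrightarrow> u \<le> x \<Longrightarrow> inside t u"
  by (auto simp: inside_iff)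

lemma side_b_at_0: "side_b t 0 = 0"
  by (simp add: side_b_def Z_def)

lemma side_a_at_edge: "side_a t (t - b) = 0"
  by (simp add: side_a_def Z_def nn_def flip: powr_add)

lemma side_a_nonneg: "t - b \<le> x \<Longrightarrow> x < 1 + t \<Longrightarrow> 0 \<le> side_a t x"
  using side_a_pos[of t x] side_a_at_edge[of t] by (cases "x = t - b") auto

lemma side_b_nonneg: "0 \<le> x \<Longrightarrow> x < 1 + c \<Longrightarrow> 0 \<le> side_b t x"
  using side_b_pos[of x t] side_b_at_0[of t] by (cases "x = 0") auto

lemma denom_1_nonzero: "denom 1 \<noteq> 0"
  using qdiff[of "-b - c" 0] b_pos c_pos by (auto simp: denom_def)

lemma num_1_pos: "0 < t \<Longrightarrow> t < b + c \<Longrightarrow> 0 < numA 1 t * numC 1 t"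
  by (rule numAC_sign) (use b_pos c_pos in auto)

lemma side_v_eq: "side_v t x = q * ((Z x - J t x)\<^sup>2 * (lattice_y b c q 1 - e2 t - nn t * e1))"
proof -
  have y1: "lattice_y b c q 1 = 1 / q + nn t * e1 * e2 t * q"
    unfolding lattice_y_def powr_relations(9)[of _ t] using q_pos by (simp add: powr_minus_divide)
  have "(1 - e2 t * q) * (1 - nn t * e1 * q) = q * (lattice_y b c q 1 - e2 t - nn t * e1)"
    unfolding y1 using q_pos by (simp add: field_simps)
  then show ?thesis unfolding side_v_def by simp
qed

text \<open>This is \<open>disc_quadratic\<close> at \<xi> = 1, where (q^1)^2 absorbs the factor q
  of each side. It identifies the liquid region with the region where the triangle exists.\<close>

lemma heron_eq:
  assumes "0 < t" "t < b + c"
  shows "heron t x = (Z x - J t x)\<^sup>2 * (denom 1)\<^sup>2 * disc b c q \<kappa> 1 t x"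
proof -
  have "heron t x = (q powr 1)\<^sup>2 *
    (4 * reduced_a t x * reduced_b t x - (vertex t x - (Z x - J t x)\<^sup>2 * lattice_y b c q 1)\<^sup>2)"
    unfolding heron_def side_v_eq side_reduced vertex_def using q_pos by (simp only: powr_one) algebra
  then show ?thesis
    unfolding disc_quadratic[OF denom_1_nonzero less_imp_le[OF num_1_pos[OF assms]]] by simp
qed

lemma disc_1_eq:
  assumes "0 < t" "t < b + c"
  shows "disc b c q \<kappa> 1 t x = (2 * coeff_a b c q \<kappa> 1 t)\<^sup>2 - (Z x + J t x - coeff_b b c q \<kappa> 1 t)\<^sup>2"
    "coeff_a b c q \<kappa> 1 t > 0"
proof -
  have "lattice_mu c q \<kappa> t x = Z x + J t x"
    by (simp add: lattice_mu_def Z_def J_def K_def add.commute diff_add_eq algebra_simps)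
  then show "disc b c q \<kappa> 1 t x = (2 * coeff_a b c q \<kappa> 1 t)\<^sup>2 - (Z x + J t x - coeff_b b c q \<kappa> 1 t)\<^sup>2"
    by (simp add: disc_def power_mult_distrib)
  show "coeff_a b c q \<kappa> 1 t > 0"
    using num_1_pos[OF assms] denom_1_nonzero by (simp add: coeff_a_def coeff_num zero_less_divide_iff)
qed

lemma one_minus_cosine1_sq:
  assumes "inside t u"
  shows "1 - (cosine1 t u)\<^sup>2 = heron t u / (4 * (side_a t u * side_b t u))"
proof -
  have "0 < side_a t u * side_b t u" using inside_pos[OF assms] by simp
  then have "(cosine1 t u)\<^sup>2 = (side_a t u + side_b t u - side_v t u)\<^sup>2 / (4 * (side_a t u * side_b t u))"
    by (simp add: cosine1_def power_divide power_mult_distrib)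
  then show ?thesis using inside_pos(1,2)[OF assms] by (simp add: heron_def diff_divide_distrib)
qed

lemma continuous_on_sides_x:
  "continuous_on S (\<lambda>u. side_a t u)" "continuous_on S (\<lambda>u. side_b t u)" "continuous_on S (\<lambda>u. side_v t u)"
  "continuous_on S (\<lambda>u. Z u)" "continuous_on S (\<lambda>u. J t u)" "continuous_on S (\<lambda>u. heron t u)"
  unfolding heron_def side_a_def side_b_def side_v_def Z_def J_def by (intro continuous_intros; simp)+

lemma continuous_on_sides_t:
  "continuous_on S (\<lambda>s. side_a s u)" "continuous_on S (\<lambda>s. side_b s u)" "continuous_on S (\<lambda>s. side_v s u)"
  "continuous_on S (\<lambda>s. heron s u)"
  unfolding heron_def side_a_def side_b_def side_v_def Z_def J_def e2_def nn_def by (intro continuous_intros; simp)+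

text \<open>For fixed t the discriminant depends on x only through \<mu> = Z + J, which is strictly
  monotone up to \<open>x\<close> because Z - J keeps its sign. A rescaled copy \<open>f\<close> of
  \<mu> increases, and the liquid points are those with -r < f < r. So \<open>f\<close> passes -r
  exactly once below \<open>x\<close>, with positive derivative, which gives the linear lower
  bound.\<close>

lemma slice:
  assumes liq: "liquid t x" and "t \<noteq> b" and frozen: "heron t (lower_edge t) < 0"
  obtains p where "lower_edge t < p" "p < x" "heron t p = 0"
    "\<And>u. lower_edge t \<le> u \<Longrightarrow> u < p \<Longrightarrow> heron t u < 0" "\<And>u. p < u \<Longrightarrow> u \<le> x \<Longrightarrow> heron t u > 0"
    "\<And>l. lower_edge t < l \<Longrightarrow> l \<le> p \<Longrightarrow> \<exists>k>0. \<forall>u\<in>{l..x}. k * \<bar>u - p\<bar> \<le> \<bar>1 - (cosine1 t u)\<^sup>2\<bar>"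
proof -
  have ins: "inside t x" and hx: "heron t x > 0" using liq by (auto simp: liquid_def)
  have t: "0 < t" "t < b + c" and lox: "lower_edge t < x" "x < 1 + t" "x < 1 + c" using ins by (auto simp: inside_iff)
  obtain \<tau> where \<tau>: "\<And>x. t - b < 2 * x \<Longrightarrow> 2 * x < t + c + 2 \<Longrightarrow> 0 < \<tau> * (Z x - J t x)"
    using J_signs by metis
  \<comment> \<open>The derivative of Z + J is - ln q (Z - J); the factor \<omega> turns it into the
    positive function \<open>f'\<close>.\<close>
  define \<omega> where "\<omega> = - (ln q * \<tau>)"
  define f where "f u = \<omega> * (Z u + J t u - coeff_b b c q \<kappa> 1 t)" for u
  define f' where "f' u = (ln q)\<^sup>2 * (\<tau> * (Z u - J t u))" for u
  define r where "r = \<bar>\<omega>\<bar> * (2 * coeff_a b c q \<kappa> 1 t)"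
  have lnq: "ln q \<noteq> 0" using q_pos q_neq by simp
  \<comment> \<open>For \<open>t \<noteq> b\<close> one has t - b < 2 \<open>lower_edge t\<close>,
    so Z and J differ even on the edge itself.\<close>
  have L: "0 < \<tau> * (Z u - J t u)" if "lower_edge t \<le> u" "u \<le> x" for u
    by (rule \<tau>) (use that lox t \<open>t \<noteq> b\<close> in \<open>auto simp: lower_edge_def max_def split: if_splits\<close>)
  then have L0: "Z u \<noteq> J t u" if "lower_edge t \<le> u" "u \<le> x" for u using that by fastforce
  have "\<tau> \<noteq> 0" using L[of x] lox by auto
  then have \<omega>: "\<omega> \<noteq> 0" using lnq by (simp add: \<omega>_def)
  have r: "r > 0" unfolding r_def using \<omega> disc_1_eq(2)[OF t] by simp
  have df: "(f has_real_derivative f' u) (at u)" for u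
    unfolding f_def f'_def \<omega>_def
    by (rule derivative_eq_intros DERIV_atoms refl)+ (simp add: power2_eq_square algebra_simps)
  have f': "f' u > 0" if "lower_edge t \<le> u" "u \<le> x" for u
    unfolding f'_def using L[OF that] lnq by simp
  have mono: "f u < f v" if "lower_edge t \<le> u" "u < v" "v \<le> x" for u v
    by (rule DERIV_pos_imp_increasing[OF that(2)]) (use df f' that in \<open>meson order_trans\<close>)
  have contf: "continuous_on S f" for S
    by (rule continuous_at_imp_continuous_on) (use df DERIV_isCont in blast)
  have disc: "\<omega>\<^sup>2 * disc b c q \<kappa> 1 t u = (r - f u) * (r + f u)" for u
    unfolding disc_1_eq(1)[OF t] r_def f_def 
    by (simp add: power2_eq_square algebra_simps flip: abs_mult) 
  have hdisc: "\<omega>\<^sup>2 * heron t u = (Z u - J t u)\<^sup>2 * (denom 1)\<^sup>2 * ((r - f u) * (r + f u))" for u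
    unfolding disc[symmetric] heron_eq[OF t] by simp
  have hsign: "heron t u > 0 \<longleftrightarrow> (r - f u) * (r + f u) > 0" "heron t u < 0 \<longleftrightarrow> (r - f u) * (r + f u) < 0"
    "heron t u = 0 \<longleftrightarrow> (r - f u) * (r + f u) = 0" if "lower_edge t \<le> u" "u \<le> x" for u
  proof -
    have "0 < (Z u - J t u)\<^sup>2 * (denom 1)\<^sup>2" using L0[OF that] denom_1_nonzero by simp
    moreover have "0 < \<omega>\<^sup>2" using \<omega> by simp
    ultimately show "heron t u > 0 \<longleftrightarrow> (r - f u) * (r + f u) > 0" "heron t u < 0 \<longleftrightarrow> (r - f u) * (r + f u) < 0"
      "heron t u = 0 \<longleftrightarrow> (r - f u) * (r + f u) = 0"
      using hdisc[of u] by (metis zero_less_mult_pos mult_pos_pos, metis mult_less_0_iff less_asym mult_pos_neg, metis mult_eq_0_iff less_irrefl)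
  qed
  have fx: "- r < f x" "f x < r"
    using hsign(1)[of x] hx lox r by (auto simp: zero_less_mult_iff)
  have flo: "f (lower_edge t) < - r"
    using hsign(2)[of "lower_edge t"] frozen lox r mono[of "lower_edge t" x] fx by (auto simp: mult_less_0_iff)
  obtain p where p: "lower_edge t \<le> p" "p \<le> x" "f p = - r"
    using IVT'[of f "lower_edge t" "- r" x] flo fx lox contf by auto
  have p': "lower_edge t < p" "p < x" using p flo fx by (metis less_irrefl order_less_le)+
  have lower: "\<exists>k>0. \<forall>u\<in>{l..x}. k * \<bar>u - p\<bar> \<le> \<bar>1 - (cosine1 t u)\<^sup>2\<bar>" if l: "lower_edge t < l" "l \<le> p" for l
  proof -
    \<comment> \<open>What remains of 1 - \<open>cosine1\<close>^2 after the simple zero r + f is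
      split off. It is continuous and positive on \<open>{l..x}\<close>; starting above the edge
      keeps the sides in the denominator away from 0.\<close>
    define m where "m u = (Z u - J t u)\<^sup>2 * (denom 1)\<^sup>2 * (r - f u) / (\<omega>\<^sup>2 * (4 * (side_a t u * side_b t u)))" for u
    have insu: "inside t u" if "u \<in> {l..x}" for u using inside_between[OF ins] that l by auto
    have mpos: "m u > 0" if "u \<in> {l..x}" for u
    proof -
      have "f u \<le> f x" using mono[of u x] that l by (cases "u = x") auto
      then have "0 < r - f u" using fx by simp
      then show ?thesis unfolding m_def using L0[of u] that l denom_1_nonzero \<omega> inside_pos[OF insu[OF that]] by simp
    qed
    have lx: "{l..x} \<noteq> {}" using l p' by auto
    have "continuous_on {l..x} m" unfolding m_def
      by (intro continuous_intros continuous_on_sides_x contf)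
        (use insu inside_pos \<omega> in \<open>fastforce\<close>)
    then obtain k1 where k1: "k1 \<in> {l..x}" "\<forall>u\<in>{l..x}. m k1 \<le> m u"
      using continuous_attains_inf[OF compact_Icc lx] by blast
    have "continuous_on {l..x} f'" unfolding f'_def by (intro continuous_intros continuous_on_sides_x)
    then obtain k2 where k2: "k2 \<in> {l..x}" "\<forall>u\<in>{l..x}. f' k2 \<le> f' u"
      using continuous_attains_inf[OF compact_Icc lx] by blast
    have f2: "f' k2 > 0" using k2 f'[of k2] l by auto
    have slope: "f' k2 * \<bar>u - p\<bar> \<le> \<bar>r + f u\<bar>" if u: "u \<in> {l..x}" for u
    proof -
      have "\<exists>z\<in>{l..x}. r + f u = (u - p) * f' z"
      proof (cases u p rule: linorder_cases)
        case less
        from MVT2[OF less df] obtain z where "u < z" "z < p" "f p - f u = (p - u) * f' z" by blast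
        then show ?thesis using u p' p(3) by (intro bexI[of _ z]) (auto simp: algebra_simps)
      next
        case greater
        from MVT2[OF greater df] obtain z where "p < z" "z < u" "f u - f p = (u - p) * f' z" by blast
        then show ?thesis using u l p(3) by (intro bexI[of _ z]) (auto simp: algebra_simps)
      qed (use u p(3) in auto)
      then obtain z where z: "z \<in> {l..x}" "r + f u = (u - p) * f' z" by blast
      have "f' k2 * \<bar>u - p\<bar> \<le> f' z * \<bar>u - p\<bar>" using k2 z by (intro mult_right_mono) auto
      moreover have "f' z > 0" using f'[of z] z l by auto
      ultimately show ?thesis unfolding z(2) by (simp add: abs_mult mult.commute)
    qed
    show ?thesis
    proof (intro exI conjI ballI)
      show "m k1 * f' k2 > 0" using mpos[OF k1(1)] f2 by simp
      fix u assume u: "u \<in> {l..x}"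
      have "m k1 * f' k2 * \<bar>u - p\<bar> \<le> m u * \<bar>r + f u\<bar>"
        using slope[OF u] k1 u mpos[OF u] f2 unfolding mult.assoc by (intro mult_mono) auto
      also have "\<dots> = \<bar>m u * (r + f u)\<bar>" using mpos[OF u] by (simp add: abs_mult)
      also have "m u * (r + f u) = (\<omega>\<^sup>2 * heron t u) / (\<omega>\<^sup>2 * (4 * (side_a t u * side_b t u)))"
        unfolding hdisc m_def by simp
      also have "\<dots> = 1 - (cosine1 t u)\<^sup>2" unfolding one_minus_cosine1_sq[OF insu[OF u]] using \<omega> by simp
      finally show "m k1 * f' k2 * \<bar>u - p\<bar> \<le> \<bar>1 - (cosine1 t u)\<^sup>2\<bar>" .
    qed
  qed
  show thesis
  proof (rule that[OF p' _ _ _ lower])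
    show "heron t p = 0" using hsign(3)[of p] p by auto
    show "heron t u < 0" if "lower_edge t \<le> u" "u < p" for u
      using hsign(2)[of u] mono[of u p] that p r by (auto simp: mult_less_0_iff)
    show "heron t u > 0" if "p < u" "u \<le> x" for u
    proof -
      have "- r < f u" using mono[of p u] that p by auto
      moreover have "f u < r" using mono[of u x] that p fx by (cases "u = x") auto
      ultimately show ?thesis using hsign(1)[of u] that p by simp
    qed
  qed
qed

lemma frozen_angle1:
  assumes "inside t u" "heron t u < 0"
  shows "angle1 t u = (if side_a t u + side_b t u - side_v t u > 0 then 0 else pi)" "side_a t u + side_b t u - side_v t u \<noteq> 0"
proof -
  define P where "P = side_a t u + side_b t u - side_v t u"
  have ab: "0 < side_a t u * side_b t u" using inside_pos[OF assms(1)] by simp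
  have P: "4 * (side_a t u * side_b t u) < P\<^sup>2" using assms(2) by (simp add: heron_def P_def)
  then show nz: "side_a t u + side_b t u - side_v t u \<noteq> 0" using ab by (auto simp: P_def[symmetric])
  have "sqrt (4 * (side_a t u * side_b t u)) < sqrt (P\<^sup>2)" using P by (rule real_sqrt_less_mono)
  then have "2 * sqrt (side_a t u * side_b t u) < \<bar>P\<bar>" by (simp add: real_sqrt_mult)
  moreover have "0 < sqrt (side_a t u * side_b t u)" using ab by simp
  ultimately have "P > 0 \<Longrightarrow> 1 \<le> cosine1 t u" "P < 0 \<Longrightarrow> cosine1 t u \<le> -1"
    unfolding cosine1_def P_def[symmetric] by (simp_all add: field_simps)
  then show "angle1 t u = (if side_a t u + side_b t u - side_v t u > 0 then 0 else pi)"
    using nz unfolding P_def[symmetric] angle1_def clamped_arccos_def by auto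
qed

lemma angle1_integrable: "(\<lambda>u. angle1 t u) integrable_on {l..r}"
proof -
  have [measurable]: "(\<lambda>u. side_a t u) \<in> borel_measurable borel" "(\<lambda>u. side_b t u) \<in> borel_measurable borel"
    "(\<lambda>u. side_v t u) \<in> borel_measurable borel" "clamped_arccos \<in> borel_measurable borel"
    by (intro borel_measurable_continuous_onI continuous_on_sides_x continuous_clamped_arccos)+
  have "(\<lambda>u. angle1 t u) \<in> borel_measurable borel" unfolding angle1_def cosine1_def by measurable
  then have "(\<lambda>u. angle1 t u) \<in> borel_measurable (lebesgue_on {l..r})"
    by (intro measurable_restrict_space1 measurable_completion) simp
  then show ?thesis
    by (rule measurable_bounded_by_integrable_imp_integrable[where g = "\<lambda>_. pi"])
      (auto simp: angle1_def clamped_arccos_range)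
qed

lemma density_integrable: "(\<lambda>u. 1 - angle1 t u / pi) integrable_on {l..r}"
  by (intro integrable_diff integrable_const_ivl integrable_on_divide angle1_integrable)

lemma height_eq:
  assumes "inside t x"
  shows "height b c q \<kappa> t x = integral {lower_edge t..x} (\<lambda>u. 1 - angle1 t u / pi)"
  unfolding height_def lower_edge_def[symmetric]
  by (rule integral_spike[of "{lower_edge t}"]) (use density_eq inside_between[OF assms] in auto)

lemma continuous_angles:
  "continuous_on {p. inside (fst p) (snd p)} (\<lambda>p. angle1 (fst p) (snd p))"
  "continuous_on {p. inside (fst p) (snd p)} (\<lambda>p. angle0 (fst p) (snd p))"
proof -
  note cont = continuous_on_compose2[OF continuous_clamped_arccos]
    continuous_on_subset[OF continuous_sides(1)] continuous_on_subset[OF continuous_sides(2)]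
    continuous_on_subset[OF continuous_sides(3)]
  show "continuous_on {p. inside (fst p) (snd p)} (\<lambda>p. angle1 (fst p) (snd p))"
    unfolding angle1_def cosine1_def by (intro continuous_intros cont) (auto dest: inside_pos)
  show "continuous_on {p. inside (fst p) (snd p)} (\<lambda>p. angle0 (fst p) (snd p))"
    unfolding angle0_def cosine0_def by (intro continuous_intros cont) (auto dest: inside_pos)
qed

lemma isCont_angles:
  assumes "inside t x"
  shows "isCont (\<lambda>s. angle1 s x) t" "isCont (\<lambda>u. angle1 t u) x" "isCont (\<lambda>s. angle0 s x) t" "isCont (\<lambda>u. angle0 t u) x"
proof -
  have i: "isCont (\<lambda>p. angle1 (fst p) (snd p)) (t, x)" "isCont (\<lambda>p. angle0 (fst p) (snd p)) (t, x)"
    using continuous_angles assms by (auto simp: continuous_on_eq_continuous_at[OF open_inside])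
  have j: "isCont (\<lambda>s. (s, x)) t" "isCont (\<lambda>u. (t, u)) x" by (intro continuous_intros)+
  show "isCont (\<lambda>s. angle1 s x) t" "isCont (\<lambda>u. angle1 t u) x" "isCont (\<lambda>s. angle0 s x) t" "isCont (\<lambda>u. angle0 t u) x"
    using isCont_o2[OF j(1) i(1)] isCont_o2[OF j(2) i(1)] isCont_o2[OF j(1) i(2)] isCont_o2[OF j(2) i(2)] by simp_all
qed

lemma height_has_derivative_x:
  assumes "inside t x"
  shows "((\<lambda>u. height b c q \<kappa> t u) has_real_derivative 1 - angle1 t x / pi) (at x)"
proof -
  have "open ((\<lambda>u. (t, u)) -` {p. inside (fst p) (snd p)})"
    by (intro open_vimage open_inside continuous_intros)
  then have op: "open {u. inside t u}" unfolding vimage_def by simp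
  moreover have "x \<in> {u. inside t u}" using assms by simp
  ultimately obtain e where e: "e > 0" "ball x e \<subseteq> {u. inside t u}" by (rule openE)
  define r where "r = x + e / 2"
  have "r \<in> ball x e" using e by (simp add: r_def dist_real_def)
  then have r: "x < r" "inside t r" using e(1) e(2) by (simp add: r_def, blast)
  have lox: "lower_edge t < x" using assms by (simp add: inside_iff)
  have ic: "isCont (\<lambda>u. 1 - angle1 t u / pi) x"
    unfolding divide_inverse by (intro continuous_diff continuous_const continuous_mult isCont_angles(2)[OF assms])
  have "((\<lambda>u. integral {lower_edge t..u} (\<lambda>u. 1 - angle1 t u / pi)) has_vector_derivative 1 - angle1 t x / pi)
      (at x within {lower_edge t..r} - {})"
  proof (rule integral_has_vector_derivative_continuous_at)
    show "x \<in> {lower_edge t..r} - {}" using r lox by simp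
    show "continuous (at x within {lower_edge t..r} - {}) (\<lambda>u. 1 - angle1 t u / pi)"
      by (rule continuous_at_imp_continuous_at_within[OF ic])
  qed (rule density_integrable finite.emptyI)+
  then have "((\<lambda>u. integral {lower_edge t..u} (\<lambda>u. 1 - angle1 t u / pi)) has_vector_derivative 1 - angle1 t x / pi) (at x)"
    unfolding Diff_empty at_within_Icc_at[OF lox r(1)] .
  then have "((\<lambda>u. integral {lower_edge t..u} (\<lambda>u. 1 - angle1 t u / pi)) has_real_derivative 1 - angle1 t x / pi) (at x)"
    unfolding has_real_derivative_iff_has_vector_derivative .
  then show ?thesis
  proof (rule has_field_derivative_transform_within_open[OF _ op])
    show "x \<in> {u. inside t u}" using assms by simp
    show "integral {lower_edge t..u} (\<lambda>u. 1 - angle1 t u / pi) = height b c q \<kappa> t u" if "u \<in> {u. inside t u}" for u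
      using height_eq[of t u] that by simp
  qed
qed

section \<open>The time derivative of the height\<close>

lemma isCont_lower_edge: "isCont lower_edge t"
  unfolding lower_edge_def[abs_def] by (intro continuous_intros)

lemma eventually_inside:
  assumes "inside t x"
  shows "\<forall>\<^sub>F s in nhds t. inside s x"
proof -
  have "open ((\<lambda>s. (s, x)) -` {p. inside (fst p) (snd p)})"
    by (intro open_vimage open_inside continuous_intros)
  then show ?thesis using assms by (auto dest: eventually_nhds_in_open)
qed

lemma eventually_isCont:
  fixes f :: "real \<Rightarrow> real"
  assumes "isCont f a"
  shows "f a < y \<Longrightarrow> \<forall>\<^sub>F x in nhds a. f x < y" "y < f a \<Longrightarrow> \<forall>\<^sub>F x in nhds a. y < f x"
  using assms order_tendstoD[of f "f a" "nhds a" y] by (auto simp: isCont_def tendsto_at_iff_tendsto_nhds)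

text \<open>Needed at the isolated times at which the derivative is found by L'Hospital's rule. The
  density is bounded, so dominated convergence applies without any control of singularities.\<close>

lemma height_isCont_t:
  assumes ins: "inside t x"
  shows "(\<lambda>s. height b c q \<kappa> s x) \<midarrow>t\<rightarrow> height b c q \<kappa> t x"
  unfolding LIMSEQ_SEQ_conv[symmetric]
proof (intro allI impI)
  fix S :: "nat \<Rightarrow> real" assume S: "(\<forall>n. S n \<noteq> t) \<and> S \<longlonglongrightarrow> t"
  then have "\<forall>\<^sub>F n in sequentially. inside (S n) x"
    using eventually_inside[OF ins] by (auto simp: filterlim_iff)
  then obtain N where N: "\<And>n. n \<ge> N \<Longrightarrow> inside (S n) x" by (auto simp: eventually_sequentially)
  define T where "T n = S (n + N)" for n
  have T: "T \<longlonglongrightarrow> t" and Ti: "\<And>n. inside (T n) x"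
    using S N by (auto simp: T_def[abs_def] intro: LIMSEQ_ignore_initial_segment)
  \<comment> \<open>The integrand is extended by 0 to the fixed interval \<open>{0..x}\<close>,
    since the lower edge moves with \<open>s\<close>. The single point \<open>lower_edge t\<close>,
    where pointwise convergence may fail, is removed.\<close>
  define f where "f s u = (if u = lower_edge t then 0 else if u \<in> {lower_edge s..x} then 1 - angle1 s u / pi else 0)" for s u
  have f_int: "(f s has_integral height b c q \<kappa> s x) {0..x}" if "inside s x" for s
  proof -
    have "((\<lambda>u. 1 - angle1 s u / pi) has_integral height b c q \<kappa> s x) {lower_edge s..x}"
      unfolding height_eq[OF that] by (rule integrable_integral[OF density_integrable])
    moreover have "{lower_edge s..x} \<subseteq> {0..x}" by (auto simp: lower_edge_def)
    ultimately have "((\<lambda>u. if u \<in> {lower_edge s..x} then 1 - angle1 s u / pi else 0) has_integral height b c q \<kappa> s x) {0..x}"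
      by (simp only: has_integral_restrict)
    then show ?thesis by (rule has_integral_spike[rotated 2, where S = "{lower_edge t}"]) (auto simp: f_def)
  qed
  have bound: "norm (f s u) \<le> 1" for s u
  proof -
    have "0 \<le> angle1 s u / pi" "angle1 s u / pi \<le> 1"
      using clamped_arccos_range[of "cosine1 s u"] by (auto simp: angle1_def)
    then show ?thesis by (auto simp: f_def)
  qed
  have conv: "(\<lambda>n. f (T n) u) \<longlonglongrightarrow> f t u" if "u \<in> {0..x}" for u
  proof -
    have loT: "(\<lambda>n. lower_edge (T n)) \<longlonglongrightarrow> lower_edge t" using isCont_tendsto_compose[OF isCont_lower_edge T] .
    consider "u = lower_edge t" | "u < lower_edge t" | "lower_edge t < u" by linarith
    then show ?thesis
    proof cases
      case 1
      then show ?thesis by (simp add: f_def)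
    next
      case 2
      have "\<forall>\<^sub>F n in sequentially. f (T n) u = f t u"
        using order_tendstoD(1)[OF loT 2] by eventually_elim (use 2 in \<open>auto simp: f_def\<close>)
      then show ?thesis by (rule tendsto_eventually)
    next
      case 3
      have insu: "inside t u" using inside_between[OF ins 3] that by simp
      have "(\<lambda>n. 1 - angle1 (T n) u / pi) \<longlonglongrightarrow> 1 - angle1 t u / pi"
        by (intro tendsto_intros isCont_tendsto_compose[OF isCont_angles(1)[OF insu] T]) simp
      moreover have "\<forall>\<^sub>F n in sequentially. 1 - angle1 (T n) u / pi = f (T n) u"
        using order_tendstoD(2)[OF loT 3] by eventually_elim (use 3 that in \<open>auto simp: f_def\<close>)
      moreover have "f t u = 1 - angle1 t u / pi" using 3 that by (simp add: f_def)
      ultimately show ?thesis using Lim_transform_eventually by metis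
    qed
  qed
  have "(\<lambda>n. integral {0..x} (f (T n))) \<longlonglongrightarrow> integral {0..x} (f t)"
    by (rule dominated_convergence(2)[where h = "\<lambda>_. 1"]) (use f_int Ti bound conv in auto)
  then have "(\<lambda>n. height b c q \<kappa> (S (n + N)) x) \<longlonglongrightarrow> height b c q \<kappa> t x"
    unfolding integral_unique[OF f_int[OF Ti]] integral_unique[OF f_int[OF ins]] unfolding T_def .
  then show "(\<lambda>n. height b c q \<kappa> (S n) x) \<longlonglongrightarrow> height b c q \<kappa> t x" by (rule LIMSEQ_offset)
qed

definition cosine1_t where
  "cosine1_t s u = ((ln q * side_a_t s u + - ln q * side_b s u - ln q * side_v_t s u) * (2 * sqrt (side_a s u * side_b s u)) -
      (side_a s u + side_b s u - side_v s u) * (2 * (inverse (sqrt (side_a s u * side_b s u)) / 2 *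
        (ln q * side_a_t s u * side_b s u + - ln q * side_b s u * side_a s u))))
    / (2 * sqrt (side_a s u * side_b s u) * (2 * sqrt (side_a s u * side_b s u)))"

lemma DERIV_cosine1:
  assumes "inside s u"
  shows "((\<lambda>s. cosine1 s u) has_real_derivative cosine1_t s u) (at s)"
proof -
  have ab: "0 < side_a s u * side_b s u" using inside_pos[OF assms] by simp
  have nz: "2 * sqrt (side_a s u * side_b s u) \<noteq> 0" using inside_pos(1,2)[OF assms] by simp
  note d = DERIV_sides(2,4,6)
  show ?thesis
    unfolding cosine1_def cosine1_t_def
    by (rule DERIV_divide[OF DERIV_diff[OF DERIV_add[OF d(1,2)] d(3)]
          DERIV_cmult[OF DERIV_chain2[OF DERIV_real_sqrt[OF ab] DERIV_mult[OF d(1,2)]]] nz])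
qed

lemma continuous_cosine1_t: "continuous_on {p. inside (fst p) (snd p)} (\<lambda>p. cosine1_t (fst p) (snd p))"
proof -
  have c: "continuous_on S (\<lambda>p. side_a (fst p) (snd p))" "continuous_on S (\<lambda>p. side_b (fst p) (snd p))"
    "continuous_on S (\<lambda>p. side_v (fst p) (snd p))" for S
    using continuous_sides continuous_on_subset by blast+
  have d: "continuous_on S (\<lambda>p. side_a_t (fst p) (snd p))" "continuous_on S (\<lambda>p. side_v_t (fst p) (snd p))" for S
    unfolding side_a_t_def side_v_t_def Z_def J_def e2_def nn_def by (intro continuous_intros; simp)+
  show ?thesis unfolding cosine1_t_def
    by (intro continuous_intros c d) (auto dest: inside_pos)
qed

text \<open>The point \<open>l\<close> lies strictly inside the hexagon, so a whole compact
  rectangle around the segment does, and the time derivative is bounded on it.\<close>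

lemma cosine1_Lipschitz:
  assumes "inside t l" "inside t x" "l \<le> x"
  obtains C \<delta> where "\<delta> > 0" "\<And>s u. \<bar>s - t\<bar> < \<delta> \<Longrightarrow> u \<in> {l..x} \<Longrightarrow> \<bar>cosine1 s u - cosine1 t u\<bar> \<le> C * \<bar>s - t\<bar>"
proof -
  have insl: "inside s u" if "inside s l" "inside s x" "u \<in> {l..x}" for s u
  proof -
    have "lower_edge s < l" using that(1) by (simp add: inside_iff)
    then show ?thesis using inside_between[OF that(2), of u] that(3) by simp
  qed
  have "\<forall>\<^sub>F s in nhds t. inside s l \<and> inside s x"
    by (rule eventually_conj[OF eventually_inside[OF assms(1)] eventually_inside[OF assms(2)]])
  from this[unfolded eventually_nhds_metric]
  obtain e where e0: "0 < e \<and> (\<forall>s. dist s t < e \<longrightarrow> inside s l \<and> inside s x)" by (rule exE)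
  then have e: "e > 0" "\<And>s. dist s t < e \<Longrightarrow> inside s l \<and> inside s x" by simp_all
  define B where "B = {t - e / 2..t + e / 2}"
  have B: "inside s u" if "s \<in> B" "u \<in> {l..x}" for s u
  proof -
    have "dist s t < e" using that(1) e(1) by (simp add: B_def dist_real_def abs_less_iff)
    then show ?thesis using e(2) insl that(2) by blast
  qed
  have "compact (B \<times> {l..x})" unfolding B_def by (intro compact_Times compact_Icc)
  moreover have "continuous_on (B \<times> {l..x}) (\<lambda>p. cosine1_t (fst p) (snd p))"
    by (rule continuous_on_subset[OF continuous_cosine1_t]) (use B in force)
  ultimately have "compact ((\<lambda>p. cosine1_t (fst p) (snd p)) ` (B \<times> {l..x}))" by (rule compact_continuous_image[rotated])
  from compact_imp_bounded[OF this, unfolded bounded_iff]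
  obtain C where C0: "\<forall>y\<in>(\<lambda>p. cosine1_t (fst p) (snd p)) ` (B \<times> {l..x}). norm y \<le> C" by (rule exE)
  have C: "\<bar>cosine1_t s u\<bar> \<le> C" if "s \<in> B" "u \<in> {l..x}" for s u
  proof -
    have "cosine1_t (fst (s, u)) (snd (s, u)) \<in> (\<lambda>p. cosine1_t (fst p) (snd p)) ` (B \<times> {l..x})"
      by (rule imageI) (use that in simp)
    from bspec[OF C0 this] show ?thesis by simp
  qed
  show thesis
  proof (rule that[of "e / 2" C])
    fix s u assume su: "\<bar>s - t\<bar> < e / 2" "u \<in> {l..x}"
    have "norm (cosine1 s u - cosine1 t u) \<le> C * norm (s - t)"
    proof (rule field_differentiable_bound[of B "\<lambda>s. cosine1 s u" "\<lambda>s. cosine1_t s u"])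
      show "((\<lambda>s. cosine1 s u) has_field_derivative cosine1_t r u) (at r within B)" if "r \<in> B" for r
        using DERIV_cosine1[OF B[OF that su(2)]] by (rule has_field_derivative_at_within)
      show "norm (cosine1_t r u) \<le> C" if "r \<in> B" for r using C[OF that su(2)] by simp
      show "s \<in> B" "t \<in> B" using su(1) e(1) unfolding B_def atLeastAtMost_iff abs_less_iff by linarith+
    qed (simp add: B_def)
    then show "\<bar>cosine1 s u - cosine1 t u\<bar> \<le> C * \<bar>s - t\<bar>" by simp
  qed (use e in simp)
qed

lemma angle1_locally_frozen:
  assumes "inside t u" "heron t u < 0"
  shows "\<forall>\<^sub>F s in nhds t. angle1 s u = angle1 t u"
proof -
  note c = continuous_on_sides_t[of UNIV u, unfolded continuous_on_eq_continuous_at[OF open_UNIV],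
      rule_format, OF UNIV_I]
  have ch: "isCont (\<lambda>s. heron s u) t" "isCont (\<lambda>s. side_a s u + side_b s u - side_v s u) t"
    by (intro continuous_add continuous_diff c)+
  note f = frozen_angle1[OF assms]
  have "\<forall>\<^sub>F s in nhds t. 0 < side_a s u + side_b s u - side_v s u \<longleftrightarrow> 0 < side_a t u + side_b t u - side_v t u"
  proof (cases "0 < side_a t u + side_b t u - side_v t u")
    case True
    from eventually_isCont(2)[OF ch(2) this] show ?thesis by eventually_elim (use True in auto)
  next
    case False
    then have "side_a t u + side_b t u - side_v t u < 0" using f(2) by simp
    from eventually_isCont(1)[OF ch(2) this] show ?thesis by eventually_elim (use False in auto)
  qed
  with eventually_isCont(1)[OF ch(1) assms(2)] eventually_inside[OF assms(1)]
  show ?thesis by eventually_elim (simp add: frozen_angle1(1) f(1))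
qed

text \<open>The time derivative of \<open>angle1\<close> is 0 below \<open>p\<close> and the
  x-derivative of \<open>angle0\<close> above it, so its integral is a difference of values of
  \<open>angle0\<close>. Continuity of \<open>angle0\<close> at \<open>p\<close> is enough for the
  fundamental theorem there.\<close>

lemma angle1_integral_derivative:
  assumes liq: "liquid t x" and l: "lower_edge t < l" "l < p" "p < x"
    and neg: "\<And>u. l \<le> u \<Longrightarrow> u < p \<Longrightarrow> heron t u < 0" and pos: "\<And>u. p < u \<Longrightarrow> u \<le> x \<Longrightarrow> heron t u > 0"
    and lower: "k > 0" "\<And>u. u \<in> {l..x} \<Longrightarrow> k * \<bar>u - p\<bar> \<le> \<bar>1 - (cosine1 t u)\<^sup>2\<bar>"
  shows "((\<lambda>s. integral {l..x} (\<lambda>u. angle1 s u)) has_real_derivative angle0 t x - angle0 t p) (at t)"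
proof -
  have ins: "inside t u" if "u \<in> {l..x}" for u
    using liq that l inside_between[of t x u] by (auto simp: liquid_def)
  obtain C \<delta> where C: "\<delta> > 0" "\<And>s u. \<bar>s - t\<bar> < \<delta> \<Longrightarrow> u \<in> {l..x} \<Longrightarrow> \<bar>cosine1 s u - cosine1 t u\<bar> \<le> C * \<bar>s - t\<bar>"
  proof -
    have il: "inside t l" "inside t x" "l \<le> x" using ins l by auto
    show thesis by (rule cosine1_Lipschitz[OF il]) (rule that)
  qed
  define W where "W u = (if u \<le> p then 0 else angle_rate t u)" for u
  have "(W has_integral 0) {l..p}" by (rule has_integral_is_0) (simp add: W_def)
  moreover have "(W has_integral angle0 t x - angle0 t p) {p..x}"
  proof (rule fundamental_theorem_of_calculus_interior)
    show "continuous_on {p..x} (angle0 t)"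
      by (rule continuous_at_imp_continuous_on) (use isCont_angles(4)[OF ins] l in auto)
    fix u assume u: "u \<in> {p<..<x}"
    then have "liquid t u" using ins[of u] pos[of u] l by (auto simp: liquid_def)
    from angles_closed(1)[OF this] show "(angle0 t has_vector_derivative W u) (at u)"
      using u by (simp add: W_def has_real_derivative_iff_has_vector_derivative)
  qed (use l in simp)
  ultimately have W: "(W has_integral 0 + (angle0 t x - angle0 t p)) {l..x}"
    by (rule has_integral_combine[rotated 2]) (use l in auto)
  have "((\<lambda>s. integral {l..x} (\<lambda>u. clamped_arccos (cosine1 s u))) has_real_derivative 0 + (angle0 t x - angle0 t p)) (at t)"
  proof (rule clamped_arccos_integral_derivative[OF _ _ lower(1) C(1) C(2) lower(2) _ _ W])
    fix u assume u: "u \<in> {l..x}" "u \<noteq> p"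
    show "((\<lambda>s. clamped_arccos (cosine1 s u)) has_real_derivative W u) (at t)"
      unfolding angle1_def[symmetric]
    proof (cases "u < p")
      case True
      then have ev: "\<forall>\<^sub>F s in nhds t. angle1 s u = angle1 t u"
        using angle1_locally_frozen[OF ins[OF u(1)]] neg u by auto
      show "((\<lambda>s. angle1 s u) has_real_derivative W u) (at t)"
        by (rule DERIV_cong_ev[THEN iffD2, OF refl ev refl]) (use True in \<open>simp add: W_def\<close>)
    next
      case False
      then have "liquid t u" using u ins pos by (auto simp: liquid_def)
      from angles_closed(2)[OF this] show "((\<lambda>s. angle1 s u) has_real_derivative W u) (at t)"
        using False u by (simp add: W_def)
    qed
  next
    show "(\<lambda>u. clamped_arccos (cosine1 s u)) integrable_on {l..x}" for s
      using angle1_integrable unfolding angle1_def .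
  qed (use l in auto)
  then show ?thesis unfolding angle1_def by simp
qed

lemma DERIV_lower_edge:
  assumes "t \<noteq> b"
  shows "(lower_edge has_real_derivative (if t < b then 0 else 1)) (at t)"
proof (cases "t < b")
  case True
  have "\<forall>\<^sub>F s in nhds t. lower_edge s = 0"
    using eventually_nhds_in_open[of "{..<b}" t] True by (auto simp: lower_edge_def elim: eventually_mono)
  from DERIV_cong_ev[THEN iffD2, OF refl this refl] show ?thesis using True by simp
next
  case False
  then have "\<forall>\<^sub>F s in nhds t. lower_edge s = s - b"
    using eventually_nhds_in_open[of "{b<..}" t] assms by (auto simp: lower_edge_def elim: eventually_mono)
  moreover have "((\<lambda>s. s - b) has_real_derivative 1) (at t)"
    by (auto intro!: derivative_eq_intros)
  ultimately have "(lower_edge has_real_derivative 1) (at t)" using DERIV_cong_ev[of t t lower_edge "\<lambda>s. s - b" 1 1] by simp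
  then show ?thesis using False by simp
qed

text \<open>At \<open>p\<close> the triangle is degenerate, so the angle is 0 or pi according to the
  sign of \<open>P1\<close>. As \<open>P1\<close> and \<open>P3\<close> have no zero between the
  edge and \<open>p\<close> or \<open>l\<close>, their signs can be read off at the edge. For t < b
  \<open>side_b\<close> vanishes there and \<open>P1\<close> is positive; for t > b
  \<open>side_a\<close> vanishes and \<open>P1\<close> = - \<open>P3\<close>.\<close>

lemma edge_angle0:
  assumes ins: "inside t p" and l: "lower_edge t < l" "l < p" and "t \<noteq> b" and hp: "heron t p = 0"
    and neg: "\<And>u. lower_edge t \<le> u \<Longrightarrow> u < p \<Longrightarrow> heron t u < 0"
  shows "angle0 t p = (pi - angle1 t l) * (if t < b then 0 else 1)"
proof -
  define P1 P3 where "P1 u = side_a t u + side_v t u - side_b t u" and "P3 u = side_a t u + side_b t u - side_v t u" for u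
  have h: "heron t u = 4 * (side_a t u * side_v t u) - (P1 u)\<^sup>2" "heron t u = 4 * (side_a t u * side_b t u) - (P3 u)\<^sup>2" for u
    unfolding heron_def P1_def P3_def by algebra+
  note ip = inside_pos[OF ins] and ib = inside_bounds[OF ins]
  have nonneg: "0 \<le> side_a t u" "0 \<le> side_b t u" "0 < side_v t u" if "lower_edge t \<le> u" "u \<le> p" for u
  proof -
    have u: "0 \<le> u" "t - b \<le> u" using that by (auto simp: lower_edge_def)
    have u2: "u < 1 + t" "u < 1 + c" using that ib by linarith+
    show "0 \<le> side_a t u" "0 \<le> side_b t u" using u u2 by (auto intro: side_a_nonneg side_b_nonneg)
    have "t - b < 2 * u" using u \<open>t \<noteq> b\<close> by linarith
    then show "0 < side_v t u" using ib u2 by (intro side_v_pos) linarith+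
  qed
  have P1: "P1 u \<noteq> 0" if "u \<in> {lower_edge t..p}" for u
  proof (cases "u = p")
    case True
    then show ?thesis using h(1)[of p] hp ip by auto
  next
    case False
    have "0 \<le> side_a t u * side_v t u" using nonneg[of u] that by simp
    then show ?thesis using h(1)[of u] neg[of u] that False by auto
  qed
  have P3: "P3 u \<noteq> 0" if "u \<in> {lower_edge t..l}" for u
  proof -
    have "0 \<le> side_a t u * side_b t u" using nonneg[of u] that l by simp
    then show ?thesis using h(2)[of u] neg[of u] that l by auto
  qed
  have s1: "P1 (lower_edge t) * P1 p > 0"
    by (rule nonzero_same_sign) (use P1 l in \<open>auto simp: P1_def intro!: continuous_on_add continuous_on_diff continuous_on_sides_x\<close>)
  have s3: "P3 (lower_edge t) * P3 l > 0"
    by (rule nonzero_same_sign) (use P3 l in \<open>auto simp: P3_def intro!: continuous_on_add continuous_on_diff continuous_on_sides_x\<close>)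
  have sq: "0 < sqrt (side_a t p * side_v t p)" using ip by simp
  have "sqrt ((P1 p)\<^sup>2) = sqrt (4 * (side_a t p * side_v t p))" using h(1)[of p] hp by simp
  then have "\<bar>P1 p\<bar> = 2 * sqrt (side_a t p * side_v t p)" by (simp add: real_sqrt_mult)
  then have "P1 p = (if 0 < P1 p then 1 else - 1) * (2 * sqrt (side_a t p * side_v t p))"
    by (auto simp: abs_if split: if_splits)
  then have "cosine0 t p = (if 0 < P1 p then 1 else - 1)"
    using sq unfolding cosine0_def P1_def[symmetric] by (subst nonzero_divide_eq_eq) (linarith, assumption)
  then have t1: "angle0 t p = (if 0 < P1 p then 0 else pi)"
    by (simp add: angle0_def clamped_arccos_def)
  have "inside t l" using inside_between[OF ins] l by simp
  then have t3: "angle1 t l = (if 0 < P3 l then 0 else pi)"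
    using frozen_angle1(1)[of t l] neg[of l] l by (simp add: P3_def)
  show ?thesis
  proof (cases "t < b")
    case True
    then have lower_edge: "lower_edge t = 0" by (simp add: lower_edge_def)
    have "0 < P1 (lower_edge t)"
      using nonneg[of "lower_edge t"] l unfolding P1_def lower_edge side_b_at_0 by linarith
    then show ?thesis using s1 t1 True by (simp add: zero_less_mult_iff)
  next
    case False
    then have lower_edge: "lower_edge t = t - b" by (simp add: lower_edge_def)
    have eq: "P1 (lower_edge t) = - P3 (lower_edge t)" unfolding P1_def P3_def lower_edge side_a_at_edge by simp
    have "0 < P1 p \<longleftrightarrow> \<not> 0 < P3 l"
      using s1 s3 unfolding eq by (auto simp: zero_less_mult_iff mult_less_0_iff)
    then show ?thesis using False by (simp add: t1 t3)
  qed
qed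

lemma frozen_slice:
  assumes "inside s l" "lower_edge s < u" "u \<le> l" "\<And>v. v \<in> {u..l} \<Longrightarrow> heron s v < 0"
  shows "angle1 s u = angle1 s l"
proof -
  have ins: "inside s v" if "v \<in> {u..l}" for v
    using inside_between[OF assms(1)] that assms(2) by auto
  have "(side_a s u + side_b s u - side_v s u) * (side_a s l + side_b s l - side_v s l) > 0"
    by (rule nonzero_same_sign[OF assms(3)])
      (intro continuous_on_add continuous_on_diff continuous_on_sides_x, use frozen_angle1(2)[OF ins assms(4)] in blast)
  then show ?thesis
    using frozen_angle1(1)[OF ins assms(4)] assms(3) by (auto simp: zero_less_mult_iff)
qed

text \<open>Below \<open>l\<close> the density is constant, in x and also for times near t, so this
  part contributes a constant times \<open>l - lower_edge s\<close>. Its derivative cancels the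
  value of \<open>angle0\<close> at \<open>p\<close> left over by the integral above
  \<open>l\<close>.\<close>

lemma height_derivative_generic:
  assumes liq: "liquid t x" and "t \<noteq> b" and frozen: "heron t (lower_edge t) < 0"
  shows "((\<lambda>s. height b c q \<kappa> s x) has_real_derivative - angle0 t x / pi) (at t)"
proof -
  have ins: "inside t x" using liq by (simp add: liquid_def)
  obtain p where p: "lower_edge t < p" "p < x" "heron t p = 0"
    and neg: "\<And>u. lower_edge t \<le> u \<Longrightarrow> u < p \<Longrightarrow> heron t u < 0" and pos: "\<And>u. p < u \<Longrightarrow> u \<le> x \<Longrightarrow> heron t u > 0"
    and lower: "\<And>l. lower_edge t < l \<Longrightarrow> l \<le> p \<Longrightarrow> \<exists>k>0. \<forall>u\<in>{l..x}. k * \<bar>u - p\<bar> \<le> \<bar>1 - (cosine1 t u)\<^sup>2\<bar>"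
    by (rule slice[OF assms]) blast
  \<comment> \<open>Any point strictly between works: above the edge, where \<open>cosine1\<close>
    is regular, and below the singularity at \<open>p\<close>.\<close>
  define l where "l = (lower_edge t + p) / 2"
  have l: "lower_edge t < l" "l < p" using p by (auto simp: l_def)
  then obtain k where k: "k > 0" "\<And>u. u \<in> {l..x} \<Longrightarrow> k * \<bar>u - p\<bar> \<le> \<bar>1 - (cosine1 t u)\<^sup>2\<bar>"
    using lower[of l] by auto
  have insl: "inside t l" and insp: "inside t p" using inside_between[OF ins] l p by auto
  have int_deriv: "((\<lambda>s. integral {l..x} (\<lambda>u. angle1 s u)) has_real_derivative angle0 t x - angle0 t p) (at t)"
    by (rule angle1_integral_derivative[OF liq l p(2) _ pos k]) (use neg l in auto)
  have "isCont (\<lambda>u. heron t u) (lower_edge t)"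
    using continuous_on_sides_x(6)[of UNIV t] by (simp add: continuous_on_eq_continuous_at)
  from eventually_isCont(1)[OF this frozen, unfolded eventually_nhds_metric]
  obtain d where d: "d > 0" "\<forall>u. dist u (lower_edge t) < d \<longrightarrow> heron t u < 0" by auto
  \<comment> \<open>The segment starts below the edge because \<open>lower_edge s\<close> may be
    smaller than \<open>lower_edge t\<close>. The tube lemma then keeps \<open>heron\<close>
    negative on it for all \<open>s\<close> near \<open>t\<close>.\<close>
  have sub: "{t} \<times> {lower_edge t - d / 2..l} \<subseteq> {p. heron (fst p) (snd p) < 0}"
  proof (clarsimp)
    fix u assume u: "lower_edge t - d / 2 \<le> u" "u \<le> l"
    show "heron t u < 0"
    proof (cases "lower_edge t \<le> u")
      case False
      then have "dist u (lower_edge t) < d" using u d(1) by (simp add: dist_real_def)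
      then show ?thesis using d(2) by simp
    qed (use neg u l in simp)
  qed
  have op: "open {p. heron (fst p) (snd p) < 0}"
    by (rule open_Collect_less[OF continuous_sides(4) continuous_on_const])
  from Elementary_Topology.tube_lemma[OF compact_Icc op sub] obtain U where "t \<in> U \<and> open U \<and> U \<times> {lower_edge t - d / 2..l} \<subseteq> {p. heron (fst p) (snd p) < 0}"
    by (rule exE)
  then have U: "t \<in> U" "open U" "U \<times> {lower_edge t - d / 2..l} \<subseteq> {p. heron (fst p) (snd p) < 0}"
    by simp_all
  have "\<forall>\<^sub>F s in nhds t. lower_edge t - d / 2 < lower_edge s"
    by (rule eventually_isCont(2)[OF isCont_lower_edge]) (use d in simp)
  moreover note eventually_isCont(1)[OF isCont_lower_edge l(1)] eventually_inside[OF ins]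
    eventually_nhds_in_open[OF U(2,1)] angle1_locally_frozen[OF insl neg[OF less_imp_le[OF l(1)] l(2)]]
  ultimately have ev: "\<forall>\<^sub>F s in nhds t. height b c q \<kappa> s x =
      (1 - angle1 t l / pi) * (l - lower_edge s) + ((x - l) - integral {l..x} (\<lambda>u. angle1 s u) / pi)"
  proof eventually_elim
    case (elim s)
    have insl: "inside s l" using inside_between[OF elim(3,2)] l p by simp
    have neg_s: "heron s v < 0" if "lower_edge s < v" "v \<le> l" for v
    proof -
      have "(s, v) \<in> U \<times> {lower_edge t - d / 2..l}" using elim(1,4) that by simp
      from subsetD[OF U(3) this] show ?thesis by simp
    qed
    have "integral {lower_edge s..l} (\<lambda>u. 1 - angle1 s u / pi) = integral {lower_edge s..l} (\<lambda>u. 1 - angle1 t l / pi)"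
    proof (rule integral_spike[of "{lower_edge s}"])
      fix u assume u: "u \<in> {lower_edge s..l} - {lower_edge s}"
      have "angle1 s u = angle1 s l"
        by (rule frozen_slice[OF insl]) (use u neg_s in auto)
      then show "1 - angle1 t l / pi = 1 - angle1 s u / pi" using elim(5) by simp
    qed simp
    also have "\<dots> = (1 - angle1 t l / pi) * (l - lower_edge s)" using elim(2) by simp
    finally have a: "integral {lower_edge s..l} (\<lambda>u. 1 - angle1 s u / pi) = (1 - angle1 t l / pi) * (l - lower_edge s)" .
    have b: "integral {l..x} (\<lambda>u. 1 - angle1 s u / pi) = (x - l) - integral {l..x} (\<lambda>u. angle1 s u) / pi"
    proof -
      have "integral {l..x} (\<lambda>u. 1 - angle1 s u / pi) = integral {l..x} (\<lambda>u. 1) - integral {l..x} (\<lambda>u. angle1 s u / pi)"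
        by (intro integral_diff integrable_const_ivl integrable_on_divide angle1_integrable)
      then show ?thesis using l p by simp
    qed
    have "height b c q \<kappa> s x = integral {lower_edge s..l} (\<lambda>u. 1 - angle1 s u / pi) + integral {l..x} (\<lambda>u. 1 - angle1 s u / pi)"
      unfolding height_eq[OF elim(3)]
      by (rule Henstock_Kurzweil_Integration.integral_combine[symmetric]) (use elim(2) l p density_integrable in auto)
    then show ?case unfolding a b .
  qed
  have "((\<lambda>s. (1 - angle1 t l / pi) * (l - lower_edge s) + ((x - l) - integral {l..x} (\<lambda>u. angle1 s u) / pi)) has_real_derivative
      (1 - angle1 t l / pi) * (0 - (if t < b then 0 else 1)) + (0 - (angle0 t x - angle0 t p) / pi)) (at t)"
    by (intro DERIV_add DERIV_diff DERIV_cmult DERIV_cdivide DERIV_const DERIV_lower_edge[OF \<open>t \<noteq> b\<close>] int_deriv)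
  moreover have "(1 - angle1 t l / pi) * (0 - (if t < b then 0 else 1)) + (0 - (angle0 t x - angle0 t p) / pi) = - angle0 t x / pi"
  proof -
    have e: "angle0 t p = (pi - angle1 t l) * (if t < b then 0 else 1)"
      by (rule edge_angle0[OF insp l \<open>t \<noteq> b\<close> p(3) neg])
    show ?thesis unfolding e by (cases "t < b") (simp_all add: field_simps)
  qed
  ultimately show ?thesis using DERIV_cong_ev[THEN iffD2, OF refl ev refl] by simp
qed

section \<open>The exceptional times are isolated\<close>

lemma K_neq: "q * K \<noteq> 1"
proof
  assume h: "q * K = 1"
  then have K: "K = q powr (-1)" using q_pos by (simp add: powr_minus_divide field_simps)
  then have "\<not> K < 0" using q_pos by simp
  then obtain s where s: "K = q powr s" "s \<le> -2 \<or> b + c \<le> s" using K_range unfolding K_def by blast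
  \<comment> \<open>The exponent -1 of 1/q lies strictly inside the excluded range from -2 to b +
    c.\<close>
  then consider "s < -1" | "-1 < s" using b_pos c_pos by linarith
  then show False
    by cases (use qdiff[of s "-1"] qdiff[of "-1" s] K s(1) in simp_all)
qed

lemma qpowr_neq_1: "u \<noteq> 0 \<Longrightarrow> q powr u \<noteq> 1"
  using qdiff[of 0 u] qdiff[of u 0] by (cases u "0::real" rule: linorder_cases) auto

text \<open>The witness \<open>T\<close> only shows that the affine function is not identically
  zero. It then has at most one zero, and q^s is injective in s.\<close>

lemma eventually_affine_nonzero:
  assumes "\<alpha> + \<beta> * T \<noteq> 0"
  shows "\<forall>\<^sub>F s in at t. \<alpha> + \<beta> * q powr s \<noteq> 0"
proof (cases "\<alpha> + \<beta> * q powr t = 0")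
  case True
  then have "\<beta> \<noteq> 0" using assms by auto
  have "\<alpha> + \<beta> * q powr s \<noteq> 0" if "s \<noteq> t" for s
  proof -
    have "q powr s - q powr t \<noteq> 0"
      using qdiff[of s t] qdiff[of t s] that by (cases s t rule: linorder_cases) auto
    moreover have "\<alpha> + \<beta> * q powr s = \<beta> * (q powr s - q powr t)" using True by (simp add: algebra_simps)
    ultimately show ?thesis using \<open>\<beta> \<noteq> 0\<close> by simp
  qed
  then show ?thesis by (simp add: eventually_at_filter)
next
  case False
  have "isCont (\<lambda>s. \<alpha> + \<beta> * q powr s) t" by (intro continuous_intros) simp
  then show ?thesis using False
    by (auto simp: isCont_def dest: tendsto_imp_eventually_ne)
qed

text \<open>\<open>heron\<close> vanishes at the lower edge where two sides agree. Up to nonvanishing factors their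
  difference is a cubic polynomial in \<open>q powr s\<close> whose first and last coefficients cancel, hence
  affine, so that this happens for at most one \<open>s\<close> on each of the two edges.\<close>

lemma tangency_left:
  obtains \<alpha> \<beta> T where "\<alpha> + \<beta> * T \<noteq> 0" "\<And>s. s < b \<Longrightarrow> 0 < s \<Longrightarrow> \<alpha> + \<beta> * q powr s \<noteq> 0 \<Longrightarrow> side_a s 0 \<noteq> side_v s 0"
proof -
  define B j h where "B = q powr (-b)" and "j = K * q powr (-c)" and "h = B * e1 * q"
  define \<beta> where "\<beta> = q * e1 + B * (q * j + e1) - 1 - h * (1 + j)"
  define \<alpha> where "\<alpha> = - (q * j + e1) - B * j + (1 + j) + h * j"
  show thesis
  \<comment> \<open>The witness 1 is q^s at s = 0, the end of the left edge, where the affine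
    function factorizes into visibly nonzero terms.\<close>
  proof (rule that[of \<alpha> \<beta> 1])
    have "\<alpha> + \<beta> * 1 = (q - 1) * (e1 - j) * (1 - B)"
      unfolding \<alpha>_def \<beta>_def h_def by algebra
    moreover have "q * (e1 - j) = q powr (-c) * (1 - q * K)"
    proof -
      have "q * e1 = q powr (-c)" using q_pos by (simp add: e1_def powr_mult_base)
      then show ?thesis by (simp add: j_def algebra_simps)
    qed
    then have "e1 - j \<noteq> 0" using K_neq by auto
    moreover have "1 - B \<noteq> 0" using qpowr_neq_1[of "-b"] b_pos by (simp add: B_def)
    ultimately show "\<alpha> + \<beta> * 1 \<noteq> 0" using q_neq by simp
    fix s assume s: "s < b" "0 < s" "\<alpha> + \<beta> * q powr s \<noteq> 0"
    define T where "T = q powr s"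
    have T: "T > 0" using q_pos by (simp add: T_def)
    have "q * T * e2 s = q * (q powr s * q powr (- s - 1))" by (simp add: T_def e2_def)
    also have "\<dots> = 1" using q_pos by (simp add: powr_mult_base flip: powr_add)
    finally have r1: "q * T * e2 s = 1" .
    have r2: "T * J s 0 = j" by (simp add: T_def J_def j_def algebra_simps flip: powr_add)
    have r3: "nn s = B * T" by (simp add: T_def nn_def B_def algebra_simps flip: powr_add)
    have r4: "Z 0 = 1" by (simp add: Z_def)
    have "T * T * (side_a s 0 - side_v s 0) = (1 - J s 0) * (T * (\<alpha> + \<beta> * T))"
      unfolding side_a_def side_v_def r3 r4 \<alpha>_def \<beta>_def h_def using r1 r2 by algebra
    moreover have "1 - J s 0 \<noteq> 0"
    proof -
      have "s - b < 0" "0 < 1 + s" using s by simp_all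
      then obtain \<tau> where "0 < \<tau> * (1 - J s 0)" using J_signs by metis
      then show ?thesis by auto
    qed
    ultimately show "side_a s 0 \<noteq> side_v s 0" using s(3) T by (auto simp: T_def[symmetric])
  qed
qed

lemma tangency_right:
  obtains \<alpha> \<beta> T where "\<alpha> + \<beta> * T \<noteq> 0"
    "\<And>s. b < s \<Longrightarrow> s < b + c \<Longrightarrow> \<alpha> + \<beta> * q powr s \<noteq> 0 \<Longrightarrow> side_b s (s - b) \<noteq> side_v s (s - b)"
proof -
  define B D j h where "B = q powr (-b)" and "D = q powr b" and "j = K * q powr (-b-c)" and "h = B * e1 * q"
  have BD: "B * D = 1" by (simp add: B_def D_def flip: powr_add)
  define \<beta> where "\<beta> = - (B * e1 + q * j * (1 + e1)) + h * D + j * (1 + h)"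
  define \<alpha> where "\<alpha> = (1 + e1) + q * j * D - (1 + h) * D - j"
  define R where "R = q powr (b + c)"
  have R: "R > 0" using q_pos by (simp add: R_def)
  have hR: "h * R = 1"
  proof -
    have "h * R = q * (q powr (-b) * q powr (-c-1) * q powr (b + c))" by (simp add: h_def B_def e1_def R_def)
    then show ?thesis using q_pos by (simp add: powr_mult_base flip: powr_add)
  qed
  show thesis
  \<comment> \<open>Here the witness is q^s at s = b + c, the other end of the hexagon;
    \<open>j * R\<close> is then \<kappa>^2, so that \<open>K_neq\<close> applies again.\<close>
  proof (rule that[of \<alpha> \<beta> R])
    have "R * (\<alpha> + \<beta> * R) = - (B * R - 1) * (e1 * R - D) * (1 - q * (j * R))"
      unfolding \<alpha>_def \<beta>_def using BD hR h_def by algebra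
    moreover have "j * R = K" by (simp add: j_def R_def flip: powr_add)
    moreover have "B * R - 1 \<noteq> 0" using qpowr_neq_1[of c] c_pos by (simp add: B_def R_def flip: powr_add)
    moreover have "e1 * R - D \<noteq> 0"
    proof -
      have "e1 * R = q powr (b - 1)" by (simp add: e1_def R_def flip: powr_add)
      then show ?thesis using qdiff[of "b - 1" b] by (auto simp: D_def)
    qed
    ultimately show "\<alpha> + \<beta> * R \<noteq> 0" using K_neq R by auto
    fix s assume s: "b < s" "s < b + c" "\<alpha> + \<beta> * q powr s \<noteq> 0"
    define T where "T = q powr s"
    have T: "T > 0" using q_pos by (simp add: T_def)
    have "q * T * e2 s = q * (q powr s * q powr (- s - 1))" by (simp add: T_def e2_def)
    also have "\<dots> = 1" using q_pos by (simp add: powr_mult_base flip: powr_add)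
    finally have r1: "q * T * e2 s = 1" .
    have r2: "J s (s - b) = j" by (simp add: J_def j_def algebra_simps)
    have r3: "nn s = B * T" by (simp add: T_def nn_def B_def algebra_simps flip: powr_add)
    have r4: "T * Z (s - b) = D" by (simp add: Z_def T_def D_def flip: powr_add)
    have "T * T * (side_b s (s - b) - side_v s (s - b)) = (Z (s - b) - J s (s - b)) * (T * (\<alpha> + \<beta> * T))"
      unfolding side_b_def side_v_def r2 r3 \<alpha>_def \<beta>_def h_def using r1 r4 BD by algebra
    moreover have "Z (s - b) - J s (s - b) \<noteq> 0" using L_neq0[of s "s - b"] s b_pos c_pos by simp
    ultimately show "side_b s (s - b) \<noteq> side_v s (s - b)" using s(3) T by (auto simp: T_def[symmetric])
  qed
qed

lemma eventually_generic:
  assumes "0 < t" "t < b + c"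
  shows "\<forall>\<^sub>F s in at t. s \<noteq> b \<and> heron s (lower_edge s) < 0"
proof -
  obtain \<alpha> \<beta> T where L: "\<alpha> + \<beta> * T \<noteq> 0"
    "\<And>s. s < b \<Longrightarrow> 0 < s \<Longrightarrow> \<alpha> + \<beta> * q powr s \<noteq> 0 \<Longrightarrow> side_a s 0 \<noteq> side_v s 0" by (rule tangency_left) blast
  obtain \<gamma> \<delta> T' where R: "\<gamma> + \<delta> * T' \<noteq> 0"
    "\<And>s. b < s \<Longrightarrow> s < b + c \<Longrightarrow> \<gamma> + \<delta> * q powr s \<noteq> 0 \<Longrightarrow> side_b s (s - b) \<noteq> side_v s (s - b)" by (rule tangency_right) blast
  have "\<forall>\<^sub>F s in at t. s \<in> {0<..<b + c}"
    using assms by (intro eventually_at_in_open') auto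
  moreover have "\<forall>\<^sub>F s in at t. s \<noteq> b"
    by (rule eventually_neq_at_within)
  moreover note eventually_affine_nonzero[OF L(1), of t] eventually_affine_nonzero[OF R(1), of t]
  ultimately show ?thesis
  proof eventually_elim
    case (elim s)
    show ?case
    proof (cases "s < b")
      case True
      then have "heron s (lower_edge s) = - (side_a s 0 - side_v s 0)\<^sup>2" by (simp add: lower_edge_def heron_def side_b_at_0)
      then show ?thesis using L(2)[OF True] elim by simp
    next
      case False
      then have "heron s (lower_edge s) = - (side_b s (s - b) - side_v s (s - b))\<^sup>2" by (simp add: lower_edge_def heron_def side_a_at_edge)
      then show ?thesis using R(2)[of s] elim False by simp
    qed
  qed
qed

lemma height_has_derivative_t:
  assumes "liquid t x"
  shows "((\<lambda>s. height b c q \<kappa> s x) has_real_derivative - angle0 t x / pi) (at t)"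
proof (rule DERIV_punctured_limit)
  have ins: "inside t x" using assms by (simp add: liquid_def)
  show "(\<lambda>s. height b c q \<kappa> s x) \<midarrow>t\<rightarrow> height b c q \<kappa> t x" by (rule height_isCont_t[OF ins])
  have "\<forall>\<^sub>F s in at t. liquid s x"
    using eventually_liquid(2)[OF assms] by (simp add: eventually_at_filter eventually_mono)
  moreover have "\<forall>\<^sub>F s in at t. s \<noteq> b \<and> heron s (lower_edge s) < 0"
    by (rule eventually_generic) (use ins in \<open>auto simp: inside_iff\<close>)
  ultimately show "\<forall>\<^sub>F s in at t. ((\<lambda>s. height b c q \<kappa> s x) has_real_derivative - angle0 s x / pi) (at s)"
    by eventually_elim (rule height_derivative_generic, auto)
  have "isCont (\<lambda>s. - angle0 s x / pi) t"
    unfolding divide_inverse by (intro continuous_minus continuous_mult continuous_const isCont_angles(3)[OF ins])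
  then show "(\<lambda>s. - angle0 s x / pi) \<midarrow>t\<rightarrow> - angle0 t x / pi" by (simp add: isCont_def)
qed

lemma complex_slope_liquid:
  assumes "liquid t x"
  shows "complex_slope b c q \<kappa> t x = slope t x"
proof (rule complex_slope_eq[OF assms])
  have ins: "inside t x" using assms by (simp add: liquid_def)
  show "rho_I b c q \<kappa> t x = angle0 t x"
    by (simp add: rho_I_def height_dt_def DERIV_imp_deriv[OF height_has_derivative_t[OF assms]])
  show "rho_III b c q \<kappa> t x = angle1 t x"
    by (simp add: rho_III_def height_dx_def DERIV_imp_deriv[OF height_has_derivative_x[OF ins]] algebra_simps)
qed

section \<open>Points on the boundary of the hexagon\<close>

lemma Z_edges: "Z (1 + t) = e2 t" "Z (1 + c) = e1"
  unfolding Z_def e1_def e2_def by (rule arg_cong[of _ _ "(powr) q"]; simp)+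

text \<open>\<open>liquid_region\<close> is defined with closed slices. On an edge one of
  \<open>side_a\<close>, \<open>side_b\<close> vanishes and \<open>heron\<close> is minus a square,
  so no liquid point lies there. This needs Z \<noteq> J to pass from \<open>disc\<close> to
  \<open>heron\<close>; the remaining places, x = 0 and the corner x = 1 + t = 1 + c, are excluded
  through the numerators.\<close>

lemma liquid_region_imp_liquid:
  assumes "(t, x) \<in> liquid_region b c q \<kappa>"
  shows "liquid t x"
proof -
  have t: "0 < t" "t < b + c" and x: "lower_edge t \<le> x" "x \<le> 1 + min t c" and disc: "0 < disc b c q \<kappa> 1 t x"
    using assms by (auto simp: liquid_region_def hexagon_def lower_edge_def)
  have x': "0 \<le> x" "t - b \<le> x" "x \<le> 1 + t" "x \<le> 1 + c" using x by (auto simp: lower_edge_def)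
  have D: "disc b c q \<kappa> 1 t x * denom 1 ^ 4 = 4 * numA 1 t * numC 1 t -
      ((Z x - 1) * (1 - J t x) * (denom 1)\<^sup>2 + numA 1 t + numC 1 t)\<^sup>2"
    by (rule disc_numerator[OF denom_1_nonzero less_imp_le[OF num_1_pos[OF t]]])
  have D0: "disc b c q \<kappa> 1 t x * denom 1 ^ 4 > 0" using disc denom_1_nonzero by simp
  have Z: "x \<noteq> 0"
  proof
    assume "x = 0"
    then have "disc b c q \<kappa> 1 t x * denom 1 ^ 4 = - (numA 1 t - numC 1 t)\<^sup>2"
      unfolding D by (simp add: Z_def power2_eq_square algebra_simps)
    then show False using D0 by (metis less_irrefl neg_0_less_iff_less not_less zero_le_power2)
  qed
  have L: "Z x \<noteq> J t x"
  proof
    assume L: "Z x = J t x"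
    then have "\<not> (t - b < 2 * x \<and> 2 * x < t + c + 2)" using L_neq0 by blast
    \<comment> \<open>Failure of the bounds forces 2x \<ge> t + c + 2, while x is at most both 1 + t
      and 1 + c.\<close>
    then have "x = 1 + t" "x = 1 + c" using x' Z by linarith+
    then have e: "e2 t = Z x" "e1 = Z x" using Z_edges(1)[of t] Z_edges(2) by metis+
    have "disc b c q \<kappa> 1 t x * denom 1 ^ 4 = 0"
      unfolding D unfolding numA_eq[of 1 t x] numC_eq[of 1 t x] denom_eq[of 1 t] e L[symmetric] by algebra
    then show False using D0 by (metis less_irrefl)
  qed
  then have h: "heron t x > 0" unfolding heron_eq[OF t] using disc denom_1_nonzero by simp
  have "side_a t x * side_b t x \<noteq> 0"
  proof
    assume "side_a t x * side_b t x = 0"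
    then have "heron t x = - (side_a t x + side_b t x - side_v t x)\<^sup>2" by (auto simp: heron_def)
    then show False using h by (metis less_irrefl neg_0_less_iff_less not_less zero_le_power2)
  qed
  then have "side_a t x \<noteq> 0" "side_b t x \<noteq> 0" by auto
  moreover have "side_a t x = 0" if "x = 1 + t" using that by (simp add: side_a_def Z_edges(1))
  moreover have "side_b t x = 0" if "x = 1 + c" using that by (simp add: side_b_def Z_edges(2))
  ultimately have "x \<noteq> t - b" "x \<noteq> 1 + t" "x \<noteq> 1 + c" using side_a_at_edge by auto
  then show ?thesis using h t x' Z by (auto simp: liquid_def inside_def)
qed

lemma slope_rhs:
  "(of_real (q powr (c + t)) + of_real K * of_real (q powr (2 * x))) /
    (of_real (q powr (c + t)) - of_real K * of_real (q powr (2 * x))) = (of_real ((Z x + J t x) / (Z x - J t x)) :: complex)"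
proof -
  define m where "m = q powr (c + t + x)"
  have m: "m \<noteq> 0" by (simp add: m_def)
  have e: "q powr (c + t) = m * Z x" "K * q powr (2 * x) = m * J t x"
    by (simp_all add: m_def Z_def J_def flip: powr_add)
  have "(q powr (c + t) + K * q powr (2 * x)) / (q powr (c + t) - K * q powr (2 * x)) = (Z x + J t x) / (Z x - J t x)"
    unfolding e distrib_left[symmetric] right_diff_distrib[symmetric] using m by simp
  from arg_cong[OF this, of complex_of_real] show ?thesis by simp
qed

end

section \<open>The complex Burgers equation\<close>

lemma q_racah_intro:
  fixes \<kappa> :: complex
  assumes "b > 0" "c > 0" "q > 0" "q \<noteq> 1" "\<kappa> \<noteq> 0"
    and "Re \<kappa> = 0 \<or> \<kappa> \<in> \<real> \<and> norm \<kappa> \<notin> open_segment (1 / q) (q powr ((b + c) / 2))"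
  shows "q_racah b c q \<kappa>" "\<kappa>\<^sup>2 = of_real (Re (\<kappa>\<^sup>2))"
proof -
  show "\<kappa>\<^sup>2 = of_real (Re (\<kappa>\<^sup>2))"
    using assms(6) by (auto simp: complex_eq_iff power2_eq_square complex_is_Real_iff)
  have "Re (\<kappa>\<^sup>2) < 0 \<or> (\<exists>s. Re (\<kappa>\<^sup>2) = q powr s \<and> (s \<le> - 2 \<or> b + c \<le> s))"
    using assms(6)
  proof (elim disjE conjE)
    assume "Re \<kappa> = 0"
    then have "Re (\<kappa>\<^sup>2) = - (Im \<kappa>)\<^sup>2" "Im \<kappa> \<noteq> 0"
      using assms(5) by (simp_all add: power2_eq_square complex_eq_iff)
    then have "Re (\<kappa>\<^sup>2) < 0" by simp
    then show ?thesis ..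
  next
    assume r: "\<kappa> \<in> \<real>" and seg: "norm \<kappa> \<notin> open_segment (1 / q) (q powr ((b + c) / 2))"
    define s where "s = 2 * log q (norm \<kappa>)"
    have n: "norm \<kappa> = q powr (s / 2)" using assms by (simp add: s_def)
    have "Re (\<kappa>\<^sup>2) = (norm \<kappa>)\<^sup>2" 
      unfolding cmod_power2 using r by (simp add: complex_is_Real_iff power2_eq_square)
    also have "\<dots> = q powr s" unfolding n by (simp add: power2_eq_square flip: powr_add)
    finally have e: "Re (\<kappa>\<^sup>2) = q powr s" .
    have "s \<le> -2 \<or> b + c \<le> s"
    proof (rule ccontr)
      assume "\<not> ?thesis"
      then have s: "-1 < s / 2" "s / 2 < (b + c) / 2" by auto
      have i: "1 / q = q powr (-1)" using assms by (simp add: powr_minus_divide)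
      have "norm \<kappa> \<in> open_segment (1 / q) (q powr ((b + c) / 2))"
      proof (cases "q > 1")
        case True
        then have "1 / q < norm \<kappa>" "norm \<kappa> < q powr ((b + c) / 2)" 
          unfolding n i using powr_less_mono[OF s(1) True] powr_less_mono[OF s(2) True] by blast+
        then show ?thesis by (simp add: open_segment_eq_real_ivl)
      next
        case False
        then have "q < 1" using assms by simp
        then have "norm \<kappa> < 1 / q" "q powr ((b + c) / 2) < norm \<kappa>"
          unfolding n i using powr_less_mono'[OF assms(3) _ s(1)] powr_less_mono'[OF assms(3) _ s(2)] by blast+
        then show ?thesis by (simp add: open_segment_eq_real_ivl)
      qed
      then show False using seg by simp
    qed
    then show ?thesis using e by blast
  qed
  then show "q_racah b c q \<kappa>" using assms by unfold_locales
qed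

theorem theorem6p6:
  fixes b c q t x :: real and \<kappa> :: complex
  defines "\<Omega> \<equiv> complex_slope b c q \<kappa>"
  assumes "b > 0" and "c > 0" and "q > 0" and "q \<noteq> 1" and "\<kappa> \<noteq> 0"
    and "Re \<kappa> = 0 \<or> \<kappa> \<in> \<real> \<and> norm \<kappa> \<notin> open_segment (1 / q) (q powr ((b + c) / 2))"
    and "(t, x) \<in> liquid_region b c q \<kappa>"
  shows "\<exists>\<Omega>\<^sub>x \<Omega>\<^sub>t.
           ((\<lambda>u. \<Omega> t u) has_vector_derivative \<Omega>\<^sub>x) (at x) \<and>
           ((\<lambda>s. \<Omega> s x) has_vector_derivative \<Omega>\<^sub>t) (at t) \<and>
           \<Omega>\<^sub>x / \<Omega> t x - \<Omega>\<^sub>t / (1 - \<Omega> t x) =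
             - of_real (ln q) *
               ((of_real (q powr (c + t)) + \<kappa>\<^sup>2 * of_real (q powr (2 * x))) /
                (of_real (q powr (c + t)) - \<kappa>\<^sup>2 * of_real (q powr (2 * x))))"
proof -
  interpret q_racah b c q \<kappa> using q_racah_intro(1)[OF assms(2-7)] .
  have liq: "liquid t x" by (rule liquid_region_imp_liquid[OF assms(8)])
  have \<kappa>: "\<kappa>\<^sup>2 = of_real K" unfolding K_def by (rule q_racah_intro(2)[OF assms(2-7)])
  have dx: "((\<lambda>u. \<Omega> t u) has_vector_derivative slope_x t x) (at x)"
    by (rule has_vector_derivative_cong_ev[THEN iffD2, OF _ _ slope_derivatives(1)[OF liq]])
      (use eventually_liquid(1)[OF liq] complex_slope_liquid liq in
        \<open>auto simp: \<Omega>_def elim!: eventually_mono\<close>)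
  have dt: "((\<lambda>s. \<Omega> s x) has_vector_derivative slope_t t x) (at t)"
    by (rule has_vector_derivative_cong_ev[THEN iffD2, OF _ _ slope_derivatives(2)[OF liq]])
      (use eventually_liquid(2)[OF liq] complex_slope_liquid liq in
        \<open>auto simp: \<Omega>_def elim!: eventually_mono\<close>)
  have "\<Omega> t x = slope t x" unfolding \<Omega>_def by (rule complex_slope_liquid[OF liq])
  then have "slope_x t x / \<Omega> t x - slope_t t x / (1 - \<Omega> t x) =
      - of_real (ln q) * ((of_real (q powr (c + t)) + \<kappa>\<^sup>2 * of_real (q powr (2 * x))) /
        (of_real (q powr (c + t)) - \<kappa>\<^sup>2 * of_real (q powr (2 * x))))"
    unfolding \<kappa> slope_rhs[of t x] using slope_burgers[OF liq] by simp
  with dx dt show ?thesis by blast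
qed

end
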